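(* The space $\mathcal H$, along with the maps $m_{\mathcal H}|_{\mathcal G\otimes\mathcal H}\colon\mathcal G\otimes\mathcal H\to\mathcal H$ and $\delta_{\mathcal H}=(Pr_{\mathcal H}\otimes\mathrm{id})\circ\Delta_{\mathcal H}\colon\mathcal H\to\mathcal G\otimes\mathcal H$, is a (left) $\mathcal G$-Hopf module.
   Context: $\mathbb K$ is a field of characteristic $0$; tensor products are over $\mathbb K$. A framed graph is a finite simple graph $\Gamma$ (up to isomorphism) with a framing, i.e. a map $f$ from its vertex set to $\mathbb Z/2\mathbb Z$. Vertices of framing $0$ are black, vertices of framing $1$ are white. $\Gamma$ is black if all its vertices are black. Unframed graphs are identified with black framed graphs. Let $u,v$ be two vertices of $\Gamma$ joined by an edge. $\Gamma'_{uv}$ is obtained from $\Gamma$ by erasing the edge $uv$. $\tilde\Gamma_{uv}$ is obtained from $\Gamma$ as follows: for every vertex $w\ne u,v$ joined to $v$, the vertices $u$ and $w$ are joined in $\tilde\Gamma_{uv}$ if and only if they are not joined in $\Gamma$; all other adjacencies are unchanged. $\tilde\Gamma'_{uv}$ is obtained from $\tilde\Gamma_{uv}$ by erasing the edge $uv$. In $\tilde\Gamma_{uv}$ and $\tilde\Gamma'_{uv}$ the framing of $u$ is $f(u)+f(v)$, the other framings being unchanged. The framed 4T-relation is $\Gamma-\Gamma'_{uv}=(-1)^{f(v)}(\tilde\Gamma_{uv}-\tilde\Gamma'_{uv})$. $\mathcal H$ is the $\mathbb K$-vector space spanned by framed graphs modulo all framed 4T-relations. $\mathcal G$ is the $\mathbb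 K$-vector space spanned by finite simple (unframed) graphs modulo the relations $\Gamma-\Gamma'_{uv}=\tilde\Gamma_{uv}-\tilde\Gamma'_{uv}$. Both are graded commutative cocommutative Hopf algebras: the product $m_{\mathcal H}$ (resp. $m_{\mathcal G}$) is induced by disjoint union, the coproduct is $\Delta(\Gamma)=\sum\Gamma_I\otimes\Gamma_J$ over all ways to decompose the vertex set into two disjoint subsets $I,J$, where $\Gamma_I$ is the induced subgraph on $I$ with the restricted framing; the unit is the empty graph, and the counit is $1$ on the empty graph and $0$ on all other graphs. There is a monomorphism of Hopf algebras $\mathcal G\to\mathcal H$ sending a graph to the same graph with all vertices black. $Pr_{\mathcal H}\colon\mathcal H\to\mathcal G$ is the linear map with $Pr_{\mathcal H}(\Gamma)=\Gamma$ if $\Gamma$ is black and $0$ otherwise. For a Hopf algebra $H$ over $\mathbb K$ with product $m_H$, coproduct $\Delta_H$, counit $\epsilon_H$: a left $H$-comodule is a vector space $V$ with a linear map $\delta_V\colon V\to H\otimes V$ such that $(\mathrm{id}\otimes\delta_V)\circ\delta_V=(\Delta_H\otimes\mathrm{id})\circ\delta_V$ and $\iota\circ(\epsilon_H\otimes\mathrm{id})\circ\delta_V=\mathrm{id}$, where $\iota\colon\mathbb K\otimes V\to V$ is canonical. A left $H$-Hopf module is a vector space $V$ with a left $H$-module structure $m_V\colon H\otimes V\to V$ and a left $H$-comodule structure $\delta_V\colon V\to H\otimes V$ such that $\delta_V$ is a morphism of $H$-modules, where $H\otimes V$ has the $H$-module structure $m_{H\otimes V}=(m_H\otimes m_V)\circ(\mathrm{id}\otimes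 s\otimes\mathrm{id})\circ(\Delta_H\otimes(\mathrm{id}\otimes\mathrm{id}))\colon H\otimes(H\otimes V)\to H\otimes V$, with $s\colon H\otimes H\to H\otimes H$ the permutation of the tensor factors. *)

theory Defs
  imports "HOL-Algebra.Module" "HOL-Algebra.AbelCoset" "HOL-Library.Z2"
begin

section \<open>Vector spaces\<close>

text \<open>A vector space over a field \<open>K\<close> is a HOL-Algebra module over \<open>K\<close>. The fields \<open>mult\<close> and
  \<open>one\<close>, which the record type \<open>module\<close> inherits from \<open>ring\<close>, play no role. A linear map only
  matters on the carrier of its source.\<close>

definition linear_map ::
  "('k, 'm) ring_scheme \<Rightarrow> ('k, 'v, 'n) module_scheme \<Rightarrow> ('k, 'w, 'p) module_scheme \<Rightarrow> ('v \<Rightarrow> 'w) \<Rightarrow> bool"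
  where
  "linear_map K V W f \<longleftrightarrow>
     f \<in> carrier V \<rightarrow> carrier W \<and>
     (\<forall>x\<in>carrier V. \<forall>y\<in>carrier V. f (x \<oplus>\<^bsub>V\<^esub> y) = f x \<oplus>\<^bsub>W\<^esub> f y) \<and>
     (\<forall>a\<in>carrier K. \<forall>x\<in>carrier V. f (a \<odot>\<^bsub>V\<^esub> x) = a \<odot>\<^bsub>W\<^esub> f x)"

definition ground :: "('k, 'm) ring_scheme \<Rightarrow> ('k, 'k) module"
  where
  "ground K = \<lparr>carrier = carrier K, mult = mult K, one = one K, zero = zero K, add = add K,
     smult = mult K\<rparr>"

text \<open>The space with basis \<open>X\<close>: finitely supported functions, extended by \<open>0\<close> outside of \<open>X\<close>.\<close>

definition free :: "('k, 'm) ring_scheme \<Rightarrow> 'x set \<Rightarrow> ('k, 'x \<Rightarrow> 'k) module"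
  where
  "free K X =
     \<lparr>carrier = {f. (\<forall>x\<in>X. f x \<in> carrier K) \<and> (\<forall>x. x \<notin> X \<longrightarrow> f x = \<zero>\<^bsub>K\<^esub>) \<and> finite {x. f x \<noteq> \<zero>\<^bsub>K\<^esub>}},
      mult = undefined, one = undefined,
      zero = (\<lambda>x. \<zero>\<^bsub>K\<^esub>), add = (\<lambda>f g x. f x \<oplus>\<^bsub>K\<^esub> g x), smult = (\<lambda>a f x. a \<otimes>\<^bsub>K\<^esub> f x)\<rparr>"

definition single :: "('k, 'm) ring_scheme \<Rightarrow> 'x \<Rightarrow> ('x \<Rightarrow> 'k)"
  where "single K x = (\<lambda>y. if y = x then \<one>\<^bsub>K\<^esub> else \<zero>\<^bsub>K\<^esub>)"

definition linear_extension ::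
  "('k, 'm) ring_scheme \<Rightarrow> ('k, 'w, 'n) module_scheme \<Rightarrow> ('x \<Rightarrow> 'w) \<Rightarrow> ('x \<Rightarrow> 'k) \<Rightarrow> 'w"
  where "linear_extension K W g f = (\<Oplus>\<^bsub>W\<^esub>x\<in>{x. f x \<noteq> \<zero>\<^bsub>K\<^esub>}. f x \<odot>\<^bsub>W\<^esub> g x)"

definition submodule_span ::
  "('k, 'm) ring_scheme \<Rightarrow> ('k, 'v, 'n) module_scheme \<Rightarrow> 'v set \<Rightarrow> 'v set"
  where "submodule_span K V S = \<Inter>{N. submodule N K V \<and> S \<subseteq> N}"

definition quotient_module :: "('k, 'v, 'n) module_scheme \<Rightarrow> 'v set \<Rightarrow> ('k, 'v set) module"
  where
  "quotient_module V N =
     \<lparr>carrier = a_rcosets\<^bsub>V\<^esub> N, mult = undefined, one = undefined, zero = N, add = set_add V,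
      smult = (\<lambda>a A. \<Union>x\<in>A. N +>\<^bsub>V\<^esub> (a \<odot>\<^bsub>V\<^esub> x))\<rparr>"

text \<open>The space spanned by \<open>X\<close> modulo the relations \<open>R\<close>, and the class of a generator.\<close>

definition presented ::
  "('k, 'm) ring_scheme \<Rightarrow> 'x set \<Rightarrow> ('x \<Rightarrow> 'k) set \<Rightarrow> ('k, ('x \<Rightarrow> 'k) set) module"
  where "presented K X R = quotient_module (free K X) (submodule_span K (free K X) R)"

definition generator ::
  "('k, 'm) ring_scheme \<Rightarrow> 'x set \<Rightarrow> ('x \<Rightarrow> 'k) set \<Rightarrow> 'x \<Rightarrow> ('x \<Rightarrow> 'k) set"
  where "generator K X R x = submodule_span K (free K X) R +>\<^bsub>free K X\<^esub> single K x"

text \<open>The linear map from such a quotient to \<open>W\<close> taking the prescribed values \<open>g\<close> on the generators.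
  It takes the common value of the linear extension of \<open>g\<close> on all elements of the given coset, and
  is only meaningful when this extension kills the relations.\<close>

definition induced ::
  "('k, 'm) ring_scheme \<Rightarrow> ('k, 'w, 'n) module_scheme \<Rightarrow> ('x \<Rightarrow> 'w) \<Rightarrow> ('x \<Rightarrow> 'k) set \<Rightarrow> 'w"
  where "induced K W g A = the_elem (linear_extension K W g ` A)"


section \<open>Tensor products\<close>

definition tensor_relations ::
  "('k, 'm) ring_scheme \<Rightarrow> ('k, 'v, 'n) module_scheme \<Rightarrow> ('k, 'w, 'p) module_scheme \<Rightarrow>
   ('v \<times> 'w \<Rightarrow> 'k) set"
  where
  "tensor_relations K V W = (let F = free K (carrier V \<times> carrier W); d = single K in
     {d (x \<oplus>\<^bsub>V\<^esub> x', y) \<ominus>\<^bsub>F\<^esub> (d (x, y) \<oplus>\<^bsub>F\<^esub> d (x', y)) | x x' y.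
        x \<in> carrier V \<and> x' \<in> carrier V \<and> y \<in> carrier W} \<union>
     {d (x, y \<oplus>\<^bsub>W\<^esub> y') \<ominus>\<^bsub>F\<^esub> (d (x, y) \<oplus>\<^bsub>F\<^esub> d (x, y')) | x y y'.
        x \<in> carrier V \<and> y \<in> carrier W \<and> y' \<in> carrier W} \<union>
     {d (a \<odot>\<^bsub>V\<^esub> x, y) \<ominus>\<^bsub>F\<^esub> a \<odot>\<^bsub>F\<^esub> d (x, y) | a x y.
        a \<in> carrier K \<and> x \<in> carrier V \<and> y \<in> carrier W} \<union>
     {d (x, a \<odot>\<^bsub>W\<^esub> y) \<ominus>\<^bsub>F\<^esub> a \<odot>\<^bsub>F\<^esub> d (x, y) | a x y.
        a \<in> carrier K \<and> x \<in> carrier V \<and> y \<in> carrier W})"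

definition tensor ::
  "('k, 'm) ring_scheme \<Rightarrow> ('k, 'v, 'n) module_scheme \<Rightarrow> ('k, 'w, 'p) module_scheme \<Rightarrow>
   ('k, ('v \<times> 'w \<Rightarrow> 'k) set) module"
  where "tensor K V W = presented K (carrier V \<times> carrier W) (tensor_relations K V W)"

definition pure_tensor ::
  "('k, 'm) ring_scheme \<Rightarrow> ('k, 'v, 'n) module_scheme \<Rightarrow> ('k, 'w, 'p) module_scheme \<Rightarrow>
   'v \<Rightarrow> 'w \<Rightarrow> ('v \<times> 'w \<Rightarrow> 'k) set"
  where
  "pure_tensor K V W x y = generator K (carrier V \<times> carrier W) (tensor_relations K V W) (x, y)"

text \<open>The linear map from a tensor product to \<open>U\<close> induced by a bilinear map \<open>b\<close>.\<close>

definition tensor_lift ::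
  "('k, 'm) ring_scheme \<Rightarrow> ('k, 'u, 'n) module_scheme \<Rightarrow> ('v \<Rightarrow> 'w \<Rightarrow> 'u) \<Rightarrow> ('v \<times> 'w \<Rightarrow> 'k) set \<Rightarrow> 'u"
  where "tensor_lift K U b = induced K U (\<lambda>(x, y). b x y)"

text \<open>The tensor product of the maps \<open>f\<close> into \<open>V\<close> and \<open>g\<close> into \<open>W\<close>; \<open>V\<close> and \<open>W\<close> are the targets.\<close>

definition tensor_map ::
  "('k, 'm) ring_scheme \<Rightarrow> ('k, 'v, 'n) module_scheme \<Rightarrow> ('k, 'w, 'p) module_scheme \<Rightarrow>
   ('a \<Rightarrow> 'v) \<Rightarrow> ('b \<Rightarrow> 'w) \<Rightarrow> ('a \<times> 'b \<Rightarrow> 'k) set \<Rightarrow> ('v \<times> 'w \<Rightarrow> 'k) set"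
  where
  "tensor_map K V W f g = tensor_lift K (tensor K V W) (\<lambda>x y. pure_tensor K V W (f x) (g y))"

text \<open>The canonical maps
  \<open>(U \<otimes> V) \<otimes> W \<rightarrow> U \<otimes> (V \<otimes> W)\<close>, its inverse, \<open>V \<otimes> W \<rightarrow> W \<otimes> V\<close>,
  \<open>K \<otimes> V \<rightarrow> V\<close> and \<open>V \<otimes> K \<rightarrow> V\<close>.\<close>

definition assoc_map where
  "assoc_map K U V W =
     tensor_lift K (tensor K U (tensor K V W))
       (\<lambda>t z. tensor_lift K (tensor K U (tensor K V W))
          (\<lambda>x y. pure_tensor K U (tensor K V W) x (pure_tensor K V W y z)) t)"

definition assoc_inv_map where
  "assoc_inv_map K U V W =
     tensor_lift K (tensor K (tensor K U V) W)
       (\<lambda>x t. tensor_lift K (tensor K (tensor K U V) W)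
          (\<lambda>y z. pure_tensor K (tensor K U V) W (pure_tensor K U V x y) z) t)"

definition swap_map where
  "swap_map K V W = tensor_lift K (tensor K W V) (\<lambda>x y. pure_tensor K W V y x)"

definition left_unit_map where
  "left_unit_map K V = tensor_lift K V (\<lambda>a x. a \<odot>\<^bsub>V\<^esub> x)"

definition right_unit_map where
  "right_unit_map K V = tensor_lift K V (\<lambda>x a. a \<odot>\<^bsub>V\<^esub> x)"

text \<open>The map \<open>id \<otimes> s \<otimes> id : (A \<otimes> B) \<otimes> (C \<otimes> D) \<rightarrow> (A \<otimes> C) \<otimes> (B \<otimes> D)\<close>, where \<open>s\<close> exchanges the
  two middle factors, with the rebracketings spelled out.\<close>

definition middle_swap_map where
  "middle_swap_map K A B C D =
     assoc_inv_map K A C (tensor K B D) \<circ>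
     tensor_map K A (tensor K C (tensor K B D)) id (assoc_map K C B D) \<circ>
     tensor_map K A (tensor K (tensor K C B) D) id
       (tensor_map K (tensor K C B) D (swap_map K B C) id) \<circ>
     tensor_map K A (tensor K (tensor K B C) D) id (assoc_inv_map K B C D) \<circ>
     assoc_map K A B (tensor K C D)"


section \<open>Hopf algebras and Hopf modules\<close>

text \<open>The unit is given as the element \<open>u\<close>, i.e. as the image of \<open>1\<close> under \<open>K \<rightarrow> H\<close>.\<close>

locale hopf_algebra =
  fixes K :: "('k, 'm) ring_scheme"
    and H :: "('k, 'h, 'n) module_scheme"
    and mH :: "('h \<times> 'h \<Rightarrow> 'k) set \<Rightarrow> 'h"
    and uH :: 'h
    and \<Delta>H :: "'h \<Rightarrow> ('h \<times> 'h \<Rightarrow> 'k) set"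
    and \<epsilon>H :: "'h \<Rightarrow> 'k"
  assumes ground_field: "field K"
    and vector_space: "module K H"
    and mult_linear: "linear_map K (tensor K H H) H mH"
    and unit_closed: "uH \<in> carrier H"
    and mult_assoc: "\<forall>t \<in> carrier (tensor K (tensor K H H) H).
      mH (tensor_map K H H mH id t) = mH (tensor_map K H H id mH (assoc_map K H H H t))"
    and mult_unit: "\<forall>x \<in> carrier H.
      mH (pure_tensor K H H uH x) = x \<and> mH (pure_tensor K H H x uH) = x"
    and comult_linear: "linear_map K H (tensor K H H) \<Delta>H"
    and counit_linear: "linear_map K H (ground K) \<epsilon>H"
    and comult_coassoc: "\<forall>x \<in> carrier H.
      tensor_map K H (tensor K H H) id \<Delta>H (\<Delta>H x) =
      assoc_map K H H H (tensor_map K (tensor K H H) H \<Delta>H id (\<Delta>H x))"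
    and comult_counit: "\<forall>x \<in> carrier H.
      left_unit_map K H (tensor_map K (ground K) H \<epsilon>H id (\<Delta>H x)) = x \<and>
      right_unit_map K H (tensor_map K H (ground K) id \<epsilon>H (\<Delta>H x)) = x"
    and comult_mult: "\<forall>t \<in> carrier (tensor K H H).
      \<Delta>H (mH t) =
      tensor_map K H H mH mH (middle_swap_map K H H H H
        (tensor_map K (tensor K H H) (tensor K H H) \<Delta>H \<Delta>H t))"
    and comult_unit: "\<Delta>H uH = pure_tensor K H H uH uH"
    and counit_mult: "\<forall>t \<in> carrier (tensor K H H).
      \<epsilon>H (mH t) = left_unit_map K (ground K) (tensor_map K (ground K) (ground K) \<epsilon>H \<epsilon>H t)"
    and counit_unit: "\<epsilon>H uH = \<one>\<^bsub>K\<^esub>"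
    and antipode: "\<exists>S. linear_map K H H S \<and> (\<forall>x \<in> carrier H.
      mH (tensor_map K H H S id (\<Delta>H x)) = \<epsilon>H x \<odot>\<^bsub>H\<^esub> uH \<and>
      mH (tensor_map K H H id S (\<Delta>H x)) = \<epsilon>H x \<odot>\<^bsub>H\<^esub> uH)"

locale left_module = hopf_algebra K H mH uH \<Delta>H \<epsilon>H
  for K :: "('k, 'm) ring_scheme"
    and H :: "('k, 'h, 'n) module_scheme"
    and mH uH \<Delta>H \<epsilon>H +
  fixes V :: "('k, 'v, 'q) module_scheme"
    and mV :: "('h \<times> 'v \<Rightarrow> 'k) set \<Rightarrow> 'v"
  assumes module_space: "module K V"
    and action_linear: "linear_map K (tensor K H V) V mV"
    and action_assoc: "\<forall>t \<in> carrier (tensor K (tensor K H H) V).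
      mV (tensor_map K H V mH id t) = mV (tensor_map K H V id mV (assoc_map K H H V t))"
    and action_unit: "\<forall>v \<in> carrier V. mV (pure_tensor K H V uH v) = v"

locale left_comodule = hopf_algebra K H mH uH \<Delta>H \<epsilon>H
  for K :: "('k, 'm) ring_scheme"
    and H :: "('k, 'h, 'n) module_scheme"
    and mH uH \<Delta>H \<epsilon>H +
  fixes V :: "('k, 'v, 'q) module_scheme"
    and \<delta>V :: "'v \<Rightarrow> ('h \<times> 'v \<Rightarrow> 'k) set"
  assumes comodule_space: "module K V"
    and coaction_linear: "linear_map K V (tensor K H V) \<delta>V"
    and coaction_coassoc: "\<forall>v \<in> carrier V.
      tensor_map K H (tensor K H V) id \<delta>V (\<delta>V v) =
      assoc_map K H H V (tensor_map K (tensor K H H) V \<Delta>H id (\<delta>V v))"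
    and coaction_counit: "\<forall>v \<in> carrier V.
      left_unit_map K V (tensor_map K (ground K) V \<epsilon>H id (\<delta>V v)) = v"

text \<open>The action of \<open>H\<close> on \<open>H \<otimes> V\<close>.\<close>

definition tensor_action where
  "tensor_action K H mH \<Delta>H V mV =
     tensor_map K H V mH mV \<circ>
     middle_swap_map K H H H V \<circ>
     tensor_map K (tensor K H H) (tensor K H V) \<Delta>H (tensor_map K H V id id)"

locale left_hopf_module =
  left_module K H mH uH \<Delta>H \<epsilon>H V mV + left_comodule K H mH uH \<Delta>H \<epsilon>H V \<delta>V
  for K :: "('k, 'm) ring_scheme"
    and H :: "('k, 'h, 'n) module_scheme"
    and mH uH \<Delta>H \<epsilon>H
    and V :: "('k, 'v, 'q) module_scheme"
    and mV \<delta>V +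
  assumes coaction_action: "\<forall>t \<in> carrier (tensor K H V).
    \<delta>V (mV t) = tensor_action K H mH \<Delta>H V mV (tensor_map K H (tensor K H V) id \<delta>V t)"


section \<open>Framed graphs\<close>

text \<open>The framing \<open>0\<close> is black, the framing \<open>1\<close> is white; values of \<open>framing\<close> outside of the
  vertex set are irrelevant. As graphs only matter up to isomorphism, vertices are natural numbers.\<close>

record framed_graph =
  verts :: "nat set"
  edges :: "nat set set"
  framing :: "nat \<Rightarrow> bit"

definition framed_graphs :: "framed_graph set"
  where
  "framed_graphs = {\<Gamma>. finite (verts \<Gamma>) \<and> (\<forall>e\<in>edges \<Gamma>. e \<subseteq> verts \<Gamma> \<and> card e = 2)}"

definition black :: "framed_graph \<Rightarrow> bool"
  where "black \<Gamma> \<longleftrightarrow> (\<forall>v\<in>verts \<Gamma>. framing \<Gamma> v = 0)"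

definition black_graphs :: "framed_graph set"
  where "black_graphs = {\<Gamma> \<in> framed_graphs. black \<Gamma>}"

definition isomorphic :: "framed_graph \<Rightarrow> framed_graph \<Rightarrow> bool"
  where
  "isomorphic \<Gamma> \<Gamma>' \<longleftrightarrow> (\<exists>\<phi>. bij_betw \<phi> (verts \<Gamma>) (verts \<Gamma>') \<and>
     (\<forall>v\<in>verts \<Gamma>. \<forall>w\<in>verts \<Gamma>. {v, w} \<in> edges \<Gamma> \<longleftrightarrow> {\<phi> v, \<phi> w} \<in> edges \<Gamma>') \<and>
     (\<forall>v\<in>verts \<Gamma>. framing \<Gamma>' (\<phi> v) = framing \<Gamma> v))"

definition iso_class :: "framed_graph \<Rightarrow> framed_graph set"
  where "iso_class \<Gamma> = {\<Gamma>' \<in> framed_graphs. isomorphic \<Gamma> \<Gamma>'}"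

definition representative :: "framed_graph set \<Rightarrow> framed_graph"
  where "representative c = (SOME \<Gamma>. \<Gamma> \<in> c)"

definition empty_graph :: framed_graph
  where "empty_graph = \<lparr>verts = {}, edges = {}, framing = (\<lambda>_. 0)\<rparr>"

text \<open>The vertices of the first graph are renumbered by \<open>n \<mapsto> 2n\<close>, those of the second by
  \<open>n \<mapsto> 2n + 1\<close>.\<close>

definition disjoint_union :: "framed_graph \<Rightarrow> framed_graph \<Rightarrow> framed_graph"
  where
  "disjoint_union \<Gamma> \<Gamma>' =
     \<lparr>verts = (\<lambda>n. 2 * n) ` verts \<Gamma> \<union> (\<lambda>n. 2 * n + 1) ` verts \<Gamma>',
      edges = (\<lambda>e. (\<lambda>n. 2 * n) ` e) ` edges \<Gamma> \<union> (\<lambda>e. (\<lambda>n. 2 * n + 1) ` e) ` edges \<Gamma>',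
      framing = (\<lambda>n. if even n then framing \<Gamma> (n div 2) else framing \<Gamma>' (n div 2))\<rparr>"

definition induced_subgraph :: "framed_graph \<Rightarrow> nat set \<Rightarrow> framed_graph"
  where
  "induced_subgraph \<Gamma> I = \<lparr>verts = I, edges = {e \<in> edges \<Gamma>. e \<subseteq> I}, framing = framing \<Gamma>\<rparr>"

text \<open>\<open>\<Gamma>'\<^sub>u\<^sub>v\<close>\<close>

definition erase_edge :: "framed_graph \<Rightarrow> nat \<Rightarrow> nat \<Rightarrow> framed_graph"
  where "erase_edge \<Gamma> u v = \<Gamma>\<lparr>edges := edges \<Gamma> - {{u, v}}\<rparr>"

text \<open>\<open>\<Gamma>\<close> with a tilde, without prime\<close>

definition slide :: "framed_graph \<Rightarrow> nat \<Rightarrow> nat \<Rightarrow> framed_graph"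
  where
  "slide \<Gamma> u v = (let T = {{u, w} | w. w \<noteq> u \<and> w \<noteq> v \<and> {v, w} \<in> edges \<Gamma>} in
     \<Gamma>\<lparr>edges := (edges \<Gamma> - T) \<union> (T - edges \<Gamma>),
       framing := (framing \<Gamma>)(u := framing \<Gamma> u + framing \<Gamma> v)\<rparr>)"


section \<open>The Hopf algebras spanned by graphs modulo the framed 4T-relations\<close>

text \<open>All constructions take a set \<open>\<A>\<close> of graphs: \<open>framed_graphs\<close> gives \<open>\<H>\<close> and \<open>black_graphs\<close>
  gives \<open>\<G>\<close>. For a black graph, all four terms of the framed 4T-relation are black and the sign is
  \<open>+\<close>, so that it is the 4T-relation of the underlying unframed graph.\<close>

definition four_term ::
  "('k, 'm) ring_scheme \<Rightarrow> framed_graph set \<Rightarrow> framed_graph \<Rightarrow> nat \<Rightarrow> nat \<Rightarrow> (framed_graph set \<Rightarrow> 'k)"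
  where
  "four_term K \<A> \<Gamma> u v =
     (let F = free K (iso_class ` \<A>); d = (\<lambda>\<Gamma>. single K (iso_class \<Gamma>));
          sign = (if framing \<Gamma> v = 0 then \<one>\<^bsub>K\<^esub> else \<ominus>\<^bsub>K\<^esub> \<one>\<^bsub>K\<^esub>)
      in (d \<Gamma> \<ominus>\<^bsub>F\<^esub> d (erase_edge \<Gamma> u v)) \<ominus>\<^bsub>F\<^esub>
         sign \<odot>\<^bsub>F\<^esub> (d (slide \<Gamma> u v) \<ominus>\<^bsub>F\<^esub> d (erase_edge (slide \<Gamma> u v) u v)))"

definition four_term_relations ::
  "('k, 'm) ring_scheme \<Rightarrow> framed_graph set \<Rightarrow> (framed_graph set \<Rightarrow> 'k) set"
  where
  "four_term_relations K \<A> = {four_term K \<A> \<Gamma> u v | \<Gamma> u v. \<Gamma> \<in> \<A> \<and> {u, v} \<in> edges \<Gamma>}"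

definition graph_space ::
  "('k, 'm) ring_scheme \<Rightarrow> framed_graph set \<Rightarrow> ('k, (framed_graph set \<Rightarrow> 'k) set) module"
  where "graph_space K \<A> = presented K (iso_class ` \<A>) (four_term_relations K \<A>)"

definition graph_element ::
  "('k, 'm) ring_scheme \<Rightarrow> framed_graph set \<Rightarrow> framed_graph \<Rightarrow> (framed_graph set \<Rightarrow> 'k) set"
  where "graph_element K \<A> \<Gamma> = generator K (iso_class ` \<A>) (four_term_relations K \<A>) (iso_class \<Gamma>)"

text \<open>The linear map out of \<open>graph_space K \<A>\<close> induced by a function \<open>g\<close> on graphs. It is only used
  with functions \<open>g\<close> that are invariant under isomorphism.\<close>

definition graph_induced ::
  "('k, 'm) ring_scheme \<Rightarrow> ('k, 'w, 'n) module_scheme \<Rightarrow> (framed_graph \<Rightarrow> 'w) \<Rightarrow>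
   (framed_graph set \<Rightarrow> 'k) set \<Rightarrow> 'w"
  where "graph_induced K W g = induced K W (\<lambda>c. g (representative c))"

definition graph_mult where
  "graph_mult K \<A> = tensor_lift K (graph_space K \<A>)
     (\<lambda>x y. graph_induced K (graph_space K \<A>)
        (\<lambda>\<Gamma>. graph_induced K (graph_space K \<A>)
           (\<lambda>\<Gamma>'. graph_element K \<A> (disjoint_union \<Gamma> \<Gamma>')) y) x)"

definition graph_unit where
  "graph_unit K \<A> = graph_element K \<A> empty_graph"

definition graph_comult where
  "graph_comult K \<A> = (let S = graph_space K \<A> in
     graph_induced K (tensor K S S)
       (\<lambda>\<Gamma>. \<Oplus>\<^bsub>tensor K S S\<^esub>I\<in>Pow (verts \<Gamma>).
          pure_tensor K S S
            (graph_element K \<A> (induced_subgraph \<Gamma> I))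
            (graph_element K \<A> (induced_subgraph \<Gamma> (verts \<Gamma> - I)))))"

definition graph_counit where
  "graph_counit K = graph_induced K (ground K) (\<lambda>\<Gamma>. if verts \<Gamma> = {} then \<one>\<^bsub>K\<^esub> else \<zero>\<^bsub>K\<^esub>)"

abbreviation \<H> where "\<H> K \<equiv> graph_space K framed_graphs"
abbreviation \<G> where "\<G> K \<equiv> graph_space K black_graphs"

text \<open>The embedding of \<open>\<G>\<close> into \<open>\<H>\<close> and the projection of \<open>\<H>\<close> onto \<open>\<G>\<close>.\<close>

definition black_embedding where
  "black_embedding K = graph_induced K (\<H> K) (graph_element K framed_graphs)"

definition black_projection where
  "black_projection K = graph_induced K (\<G> K)
     (\<lambda>\<Gamma>. if black \<Gamma> then graph_element K black_graphs \<Gamma> else \<zero>\<^bsub>\<G> K\<^esub>)"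

text \<open>The restriction of the product of \<open>\<H>\<close> to \<open>\<G> \<otimes> \<H>\<close>, and the map \<open>(Pr \<otimes> id) \<circ> \<Delta>\<close>.\<close>

definition \<H>_action where
  "\<H>_action K = graph_mult K framed_graphs \<circ> tensor_map K (\<H> K) (\<H> K) (black_embedding K) id"

definition \<H>_coaction where
  "\<H>_coaction K = tensor_map K (\<G> K) (\<H> K) (black_projection K) id \<circ> graph_comult K framed_graphs"

end

theory Submission
  imports Defs
begin

text \<open>
  Linear maps out of \<open>\<G>\<close>, \<open>\<H>\<close> and their tensor products are determined by their values on
  graphs, so every axiom reduces to an identity between sums over subsets of vertex sets; the
  4T-relations only enter through the existence of the structure maps. The coproduct respects them
  because a summand in which the edge \<open>uv\<close> is cut contributes zero, and a summand in which it is
  not cut contributes the relation of an induced subgraph. The antipode is the geometric series for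
  the convolution inverse of the identity, which is finite on each graph; it descends to the quotient
  because the relations are homogeneous in the number of vertices.

  For the comodule axioms, \<open>Pr\<close> is a morphism of coalgebras, since a graph is black if and only if
  both parts of any decomposition are; hence coassociativity and counit pass from \<open>\<H>\<close> to the
  coaction. The compatibility with the action uses that the summands of \<open>\<Delta>(\<Gamma> \<squnion> \<Gamma>')\<close> are
  the disjoint unions of those of \<open>\<Delta>(\<Gamma>)\<close> and \<open>\<Delta>(\<Gamma>')\<close>, and that for black
  \<open>\<Gamma>\<close> the projection kills \<open>\<Gamma> \<squnion> \<Gamma>'\<close> exactly when it kills \<open>\<Gamma>'\<close>.
\<close>

section \<open>Linear maps\<close>

text \<open>Induced maps are defined by \<open>the_elem\<close> on the image of a coset, and
  functions of graphs are evaluated at a chosen representative of an isomorphism class, so nothing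
  can be computed before well-definedness is known. Hence each structure map comes with two facts
  proved together, its linearity and its value on generators, and later computations rest on these
  pairs. The delicate map is the product, an induced map nested in another: the second factor is
  handled for a fixed graph, and then the conditions on the first factor are tested on generators of
  the second. Such tests go through \<open>spans\<close>, which speaks of submodules instead of
  linear combinations, because the points where two linear maps agree, or where a family of maps is
  linear, form a submodule. \<G> and \<H> are two instances of one construction (locale
  \<open>graph_family\<close>), so the Hopf algebra is built once.\<close>

definition spans ::
  "('k, 'm) ring_scheme \<Rightarrow> ('k, 'v, 'n) module_scheme \<Rightarrow> 'v set \<Rightarrow> bool"
  where
  "spans K V B \<longleftrightarrow> B \<subseteq> carrier V \<and> (\<forall>N. submodule N K V \<and> B \<subseteq> N \<longrightarrow> carrier V \<subseteq> N)"

definition bilinear_map ::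
  "('k, 'm) ring_scheme \<Rightarrow> ('k, 'v, 'n) module_scheme \<Rightarrow> ('k, 'w, 'p) module_scheme \<Rightarrow>
   ('k, 'u, 'q) module_scheme \<Rightarrow> ('v \<Rightarrow> 'w \<Rightarrow> 'u) \<Rightarrow> bool"
  where
  "bilinear_map K V W U b \<longleftrightarrow>
     (\<forall>x\<in>carrier V. linear_map K W U (b x)) \<and> (\<forall>y\<in>carrier W. linear_map K V U (\<lambda>x. b x y))"

lemma spansD:
  "spans K V B \<Longrightarrow> submodule N K V \<Longrightarrow> B \<subseteq> N \<Longrightarrow> x \<in> carrier V \<Longrightarrow> x \<in> N"
  unfolding spans_def by auto

lemma linear_mapI:
  assumes "\<And>x. x \<in> carrier V \<Longrightarrow> f x \<in> carrier W"
    and "\<And>x y. x \<in> carrier V \<Longrightarrow> y \<in> carrier V \<Longrightarrow> f (x \<oplus>\<^bsub>V\<^esub> y) = f x \<oplus>\<^bsub>W\<^esub> f y"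
    and "\<And>a x. a \<in> carrier K \<Longrightarrow> x \<in> carrier V \<Longrightarrow> f (a \<odot>\<^bsub>V\<^esub> x) = a \<odot>\<^bsub>W\<^esub> f x"
  shows "linear_map K V W f"
  using assms unfolding linear_map_def by blast

lemma linear_map_closed: "linear_map K V W f \<Longrightarrow> x \<in> carrier V \<Longrightarrow> f x \<in> carrier W"
  unfolding linear_map_def by blast

lemma linear_map_add:
  "linear_map K V W f \<Longrightarrow> x \<in> carrier V \<Longrightarrow> y \<in> carrier V \<Longrightarrow>
   f (x \<oplus>\<^bsub>V\<^esub> y) = f x \<oplus>\<^bsub>W\<^esub> f y"
  unfolding linear_map_def by blast

lemma linear_map_smult:
  "linear_map K V W f \<Longrightarrow> a \<in> carrier K \<Longrightarrow> x \<in> carrier V \<Longrightarrow>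
   f (a \<odot>\<^bsub>V\<^esub> x) = a \<odot>\<^bsub>W\<^esub> f x"
  unfolding linear_map_def by blast

lemma linear_map_id: "linear_map K V V id"
  by (simp add: linear_map_def)

lemma linear_map_comp:
  "linear_map K U V f \<Longrightarrow> linear_map K V W g \<Longrightarrow> linear_map K U W (\<lambda>x. g (f x))"
  unfolding linear_map_def by (auto simp: Pi_def)

text \<open>The maps agree on the carrier only, so the source has to be closed under its operations
  before values at sums and multiples can be exchanged.\<close>

lemma linear_map_cong:
  assumes "linear_map K V W f" "module K V" "\<And>x. x \<in> carrier V \<Longrightarrow> g x = f x"
  shows "linear_map K V W g"
proof -
  interpret V: module K V by fact
  show ?thesis
    using assms(1,3) unfolding linear_map_def by (auto simp: Pi_def)
qed

lemma bilinear_mapI: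
  assumes "\<And>x. x \<in> carrier V \<Longrightarrow> linear_map K W U (b x)"
    and "\<And>y. y \<in> carrier W \<Longrightarrow> linear_map K V U (\<lambda>x. b x y)"
  shows "bilinear_map K V W U b"
  using assms unfolding bilinear_map_def by blast

lemma bilinear_map_right: "bilinear_map K V W U b \<Longrightarrow> x \<in> carrier V \<Longrightarrow> linear_map K W U (b x)"
  and bilinear_map_left:
    "bilinear_map K V W U b \<Longrightarrow> y \<in> carrier W \<Longrightarrow> linear_map K V U (\<lambda>x. b x y)"
  unfolding bilinear_map_def by blast+

lemma bilinear_map_closed:
  "bilinear_map K V W U b \<Longrightarrow> x \<in> carrier V \<Longrightarrow> y \<in> carrier W \<Longrightarrow> b x y \<in> carrier U"
  using bilinear_map_right linear_map_closed by metis

lemma bilinear_map_comp: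
  assumes "bilinear_map K V' W' U b" "linear_map K V V' f" "linear_map K W W' g"
  shows "bilinear_map K V W U (\<lambda>x y. b (f x) (g y))"
  using assms
  by (intro bilinear_mapI linear_map_comp[OF assms(3)] linear_map_comp[OF assms(2)])
    (auto intro: bilinear_map_left bilinear_map_right linear_map_closed)

lemma linear_map_comp_bilinear:
  assumes "bilinear_map K V W U b" "linear_map K U U' f"
  shows "bilinear_map K V W U' (\<lambda>x y. f (b x y))"
  using assms
  by (intro bilinear_mapI linear_map_comp[OF _ assms(2)])
    (auto intro: bilinear_map_left bilinear_map_right)

lemma bilinear_map_flip: "bilinear_map K V W U b \<Longrightarrow> bilinear_map K W V U (\<lambda>y x. b x y)"
  unfolding bilinear_map_def by blast

section \<open>Finite sums in abelian monoids and groups\<close>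

lemma (in abelian_group) finsum_a_minus:
  assumes "finite A" "f \<in> A \<rightarrow> carrier G" "g \<in> A \<rightarrow> carrier G"
  shows "(\<Oplus>x\<in>A. f x \<ominus> g x) = (\<Oplus>x\<in>A. f x) \<ominus> (\<Oplus>x\<in>A. g x)"
  using assms
proof (induction A rule: finite_induct)
  case empty
  show ?case by (simp add: r_neg a_minus_def)
next
  case (insert x A)
  then show ?case
    by (simp add: Pi_def a_minus_def minus_add a_ac)
qed

lemma (in abelian_monoid) finsum_Sigma:
  assumes "finite A" "\<And>x. x \<in> A \<Longrightarrow> finite (B x)"
    "\<And>x y. x \<in> A \<Longrightarrow> y \<in> B x \<Longrightarrow> f x y \<in> carrier G"
  shows "(\<Oplus>x\<in>A. \<Oplus>y\<in>B x. f x y) = (\<Oplus>p\<in>Sigma A B. f (fst p) (snd p))"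
  using assms
proof (induction A rule: finite_induct)
  case empty
  show ?case by simp
next
  case (insert x A)
  have S: "Sigma (insert x A) B = Pair x ` B x \<union> Sigma A B"
    by auto
  have "(\<Oplus>p\<in>Pair x ` B x. f (fst p) (snd p)) = (\<Oplus>y\<in>B x. f x y)"
    using insert.prems by (subst finsum_reindex) (auto simp: inj_on_def)
  moreover have "(\<Oplus>p\<in>Sigma (insert x A) B. f (fst p) (snd p))
      = (\<Oplus>p\<in>Pair x ` B x. f (fst p) (snd p)) \<oplus> (\<Oplus>p\<in>Sigma A B. f (fst p) (snd p))"
    unfolding S using insert by (intro finsum_Un_disjoint) auto
  moreover have "(\<Oplus>y\<in>A. \<Oplus>z\<in>B y. f y z) = (\<Oplus>p\<in>Sigma A B. f (fst p) (snd p))"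
    using insert by auto
  moreover have "(\<Oplus>y\<in>insert x A. \<Oplus>z\<in>B y. f y z) = (\<Oplus>z\<in>B x. f x z) \<oplus> (\<Oplus>y\<in>A. \<Oplus>z\<in>B y. f y z)"
    using insert by (intro finsum_insert) auto
  ultimately show ?case
    by simp
qed

lemma (in abelian_monoid) finsum_bij:
  assumes "bij_betw h A B" "\<And>x. x \<in> A \<Longrightarrow> f x = g (h x)" "g \<in> B \<rightarrow> carrier G"
  shows "(\<Oplus>x\<in>A. f x) = (\<Oplus>y\<in>B. g y)"
proof -
  have B: "B = h ` A" and inj: "inj_on h A"
    using assms(1) by (auto simp: bij_betw_def)
  have "(\<Oplus>y\<in>B. g y) = (\<Oplus>x\<in>A. g (h x))"
    unfolding B using assms(3) inj B by (intro finsum_reindex) auto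
  also have "\<dots> = (\<Oplus>x\<in>A. f x)"
    using assms(2,3) B by (intro finsum_cong') auto
  finally show ?thesis
    by simp
qed

text \<open>Both sides run over the ordered partitions of V into three parts: the left picks the
  first part and then splits the rest, the right picks the union M of the first two parts. The pair
  (M, I) corresponds to (I, M - I).\<close>

lemma (in abelian_monoid) finsum_Pow_coassoc:
  assumes "finite V" "\<And>I J L. f I J L \<in> carrier G"
  shows "(\<Oplus>I\<in>Pow V. \<Oplus>J\<in>Pow (V - I). f I J (V - I - J))
    = (\<Oplus>M\<in>Pow V. \<Oplus>I\<in>Pow M. f I (M - I) (V - M))"
proof -
  have fin: "finite (Pow M)" if "M \<subseteq> V" for M
    using that assms(1) finite_subset by auto
  have "bij_betw (\<lambda>(M, I). (I, M - I)) (Sigma (Pow V) Pow) (Sigma (Pow V) (\<lambda>I. Pow (V - I)))"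
    by (rule bij_betwI[where g = "\<lambda>(I, J). (I \<union> J, I)"]) auto
  moreover have "f (snd p) (fst p - snd p) (V - fst p)
      = f (fst (case p of (M, I) \<Rightarrow> (I, M - I))) (snd (case p of (M, I) \<Rightarrow> (I, M - I)))
          (V - fst (case p of (M, I) \<Rightarrow> (I, M - I)) - snd (case p of (M, I) \<Rightarrow> (I, M - I)))"
    if "p \<in> Sigma (Pow V) Pow" for p
  proof -
    have "V - fst p = V - snd p - (fst p - snd p)"
      using that by auto
    then show ?thesis
      by (simp add: case_prod_unfold)
  qed
  ultimately have "(\<Oplus>p\<in>Sigma (Pow V) Pow. f (snd p) (fst p - snd p) (V - fst p))
      = (\<Oplus>p\<in>Sigma (Pow V) (\<lambda>I. Pow (V - I)). f (fst p) (snd p) (V - fst p - snd p))"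
    using assms(2) by (intro finsum_bij) auto
  moreover have "(\<Oplus>I\<in>Pow V. \<Oplus>J\<in>Pow (V - I). f I J (V - I - J))
      = (\<Oplus>p\<in>Sigma (Pow V) (\<lambda>I. Pow (V - I)). f (fst p) (snd p) (V - fst p - snd p))"
    using assms by (intro finsum_Sigma fin) auto
  moreover have "(\<Oplus>M\<in>Pow V. \<Oplus>I\<in>Pow M. f I (M - I) (V - M))
      = (\<Oplus>p\<in>Sigma (Pow V) Pow. f (snd p) (fst p - snd p) (V - fst p))"
    using assms by (intro finsum_Sigma fin) auto
  ultimately show ?thesis
    by simp
qed

text \<open>Translates between a relation, which is a difference sent to zero, and the equation it
  stands for.\<close>

lemma (in abelian_group) a_minus_zero_iff:
  "x \<in> carrier G \<Longrightarrow> y \<in> carrier G \<Longrightarrow> x \<ominus> y = \<zero> \<longleftrightarrow> x = y"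
  by (metis a_minus_def add.inv_closed add.inv_equality minus_minus r_neg)

section \<open>Linear and bilinear maps of modules over a commutative ring\<close>

context cring
begin

lemma linear_map_zero:
  assumes "linear_map R V W f" "module R V" "module R W"
  shows "f \<zero>\<^bsub>V\<^esub> = \<zero>\<^bsub>W\<^esub>"
proof -
  interpret V: module R V by fact
  interpret W: module R W by fact
  show ?thesis
    using linear_map_smult[OF assms(1), of \<zero> "\<zero>\<^bsub>V\<^esub>"] linear_map_closed[OF assms(1), of "\<zero>\<^bsub>V\<^esub>"]
    by simp
qed

lemma linear_map_uminus:
  assumes "linear_map R V W f" "module R V" "module R W" "x \<in> carrier V"
  shows "f (\<ominus>\<^bsub>V\<^esub> x) = \<ominus>\<^bsub>W\<^esub> f x"
proof -
  interpret V: module R V by fact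
  interpret W: module R W by fact
  have "\<ominus>\<^bsub>V\<^esub> x = (\<ominus> \<one>) \<odot>\<^bsub>V\<^esub> x"
    using assms by (simp add: V.smult_l_minus)
  moreover have "\<ominus>\<^bsub>W\<^esub> f x = (\<ominus> \<one>) \<odot>\<^bsub>W\<^esub> f x"
    using assms linear_map_closed[OF assms(1)] by (simp add: W.smult_l_minus)
  ultimately show ?thesis
    using linear_map_smult[OF assms(1)] assms by simp
qed

lemma linear_map_minus:
  assumes "linear_map R V W f" "module R V" "module R W" "x \<in> carrier V" "y \<in> carrier V"
  shows "f (x \<ominus>\<^bsub>V\<^esub> y) = f x \<ominus>\<^bsub>W\<^esub> f y"
proof -
  interpret V: module R V by fact
  show ?thesis
    using assms by (simp add: a_minus_def linear_map_add[OF assms(1)] linear_map_uminus)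
qed

lemma linear_map_finsum:
  assumes "linear_map R V W f" "module R V" "module R W" "finite A" "g \<in> A \<rightarrow> carrier V"
  shows "f (\<Oplus>\<^bsub>V\<^esub>x\<in>A. g x) = (\<Oplus>\<^bsub>W\<^esub>x\<in>A. f (g x))"
proof -
  interpret V: module R V by fact
  interpret W: module R W by fact
  show ?thesis
    using assms(4,5)
  proof (induction A rule: finite_induct)
    case empty
    show ?case using linear_map_zero assms by simp
  next
    case (insert x A)
    have "(\<lambda>x. f (g x)) \<in> A \<rightarrow> carrier W" "f (g x) \<in> carrier W"
      using insert.prems linear_map_closed[OF assms(1)] by auto
    then show ?case
      using insert linear_map_add[OF assms(1)] by (simp add: Pi_def)
  qed
qed

lemma linear_map_diff:
  assumes "linear_map R V W f" "linear_map R V W g" "module R W"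
  shows "linear_map R V W (\<lambda>x. f x \<ominus>\<^bsub>W\<^esub> g x)"
proof -
  interpret W: module R W by fact
  note f = linear_map_closed[OF assms(1)] linear_map_add[OF assms(1)] linear_map_smult[OF assms(1)]
  note g = linear_map_closed[OF assms(2)] linear_map_add[OF assms(2)] linear_map_smult[OF assms(2)]
  show ?thesis
    by (rule linear_mapI)
      (simp_all add: f g a_minus_def W.minus_add W.a_ac W.smult_r_distr W.smult_r_minus)
qed

lemma ground_module: "module R (ground R)"
  by (rule moduleI)
    (auto simp: ground_def is_cring l_distr r_distr m_assoc a_ac intro!: abelian_groupI l_neg
      intro: bexI[of _ "\<ominus> _"])

lemma ground_simps:
  "carrier (ground R) = carrier R" "zero (ground R) = \<zero>" "add (ground R) = add R"
  "smult (ground R) = mult R"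
  by (auto simp: ground_def)

text \<open>Provides the map that sends x to its counit times the unit, the neutral element of
  convolution.\<close>

lemma linear_map_smult_const:
  assumes "linear_map R V (ground R) f" "module R W" "u \<in> carrier W"
  shows "linear_map R V W (\<lambda>x. f x \<odot>\<^bsub>W\<^esub> u)"
proof -
  interpret W: module R W by fact
  show ?thesis
    using linear_map_closed[OF assms(1)] linear_map_add[OF assms(1)]
      linear_map_smult[OF assms(1)] assms(3)
    by (intro linear_mapI) (auto simp: ground_simps W.smult_l_distr W.smult_assoc1)
qed

lemma smult_bilinear:
  assumes "module R V"
  shows "bilinear_map R (ground R) V V (\<lambda>a x. a \<odot>\<^bsub>V\<^esub> x)"
proof -
  interpret V: module R V by fact
  show ?thesis
    by (intro bilinear_mapI linear_mapI)
      (auto simp: ground_simps V.smult_l_distr V.smult_r_distr V.smult_assoc1[symmetric] m_comm)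
qed

text \<open>The points where f and g agree form a submodule, which contains B and therefore
  everything.\<close>

lemma linear_map_eqI:
  assumes "spans R V B" "linear_map R V W f" "linear_map R V W g" "module R V" "module R W"
    "\<And>x. x \<in> B \<Longrightarrow> f x = g x" "x \<in> carrier V"
  shows "f x = g x"
proof -
  interpret V: module R V by fact
  let ?N = "{x \<in> carrier V. f x = g x}"
  have "submodule ?N R V"
    using assms(2-5) linear_map_zero[OF assms(2,4,5)] linear_map_zero[OF assms(3-5)]
    by (intro V.submoduleI)
      (auto simp: linear_map_uminus[of V W] linear_map_add[of R V W] linear_map_smult[of R V W])
  moreover have "B \<subseteq> ?N"
    using assms by (auto simp: spans_def)
  ultimately show ?thesis
    using assms(1,7) unfolding spans_def by blast
qed

lemma linear_map_kernel:
  assumes "linear_map R V W f" "module R V" "module R W"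
  shows "submodule {x \<in> carrier V. f x = \<zero>\<^bsub>W\<^esub>} R V"
proof -
  interpret V: module R V by fact
  interpret W: module R W by fact
  show ?thesis
    using assms linear_map_zero[OF assms]
    by (intro V.submoduleI)
      (auto simp: linear_map_uminus[of V W] linear_map_add[of R V W] linear_map_smult[of R V W]
        simp del: V.add.one_closed)
qed

text \<open>Since b is additive and homogeneous in x, the x for which \<open>b x\<close> is linear
  form a submodule. This serves maps induced in x, whose dependence on y is explicit only when x is
  a generator.\<close>

lemma bilinear_mapI_spanning:
  assumes B: "spans R V B" and mod: "module R V" "module R W" "module R U"
    and left: "\<And>y. y \<in> carrier W \<Longrightarrow> linear_map R V U (\<lambda>x. b x y)"
    and right: "\<And>x. x \<in> B \<Longrightarrow> linear_map R W U (b x)"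
  shows "bilinear_map R V W U b"
proof (rule bilinear_mapI[OF _ left])
  interpret V: module R V by fact
  interpret W: module R W by fact
  interpret U: module R U by fact
  fix x assume x: "x \<in> carrier V"
  let ?N = "{x \<in> carrier V. linear_map R W U (b x)}"
  have cl: "b x y \<in> carrier U" if "x \<in> carrier V" "y \<in> carrier W" for x y
    using linear_map_closed[OF left] that by metis
  have "submodule ?N R V"
  proof (intro V.submoduleI subsetI CollectI conjI)
    show "linear_map R W U (b \<zero>\<^bsub>V\<^esub>)"
      using linear_map_zero[OF left mod(1,3)] by (intro linear_mapI) auto
  next
    fix x assume "x \<in> ?N"
    then show "linear_map R W U (b (\<ominus>\<^bsub>V\<^esub> x))"
      using linear_map_uminus[OF left mod(1,3)] cl linear_map_add[of R W U "b x"]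
        linear_map_smult[of R W U "b x"]
      by (intro linear_mapI) (auto simp: U.minus_add U.smult_r_minus U.a_comm)
  next
    fix x y assume "x \<in> ?N" "y \<in> ?N"
    then show "linear_map R W U (b (x \<oplus>\<^bsub>V\<^esub> y))"
      using linear_map_add[OF left] cl linear_map_add[of R W U "b x"]
        linear_map_smult[of R W U "b x"] linear_map_add[of R W U "b y"]
        linear_map_smult[of R W U "b y"]
      by (intro linear_mapI) (auto simp: U.a_ac U.smult_r_distr)
  next
    fix a x assume "a \<in> carrier R" "x \<in> ?N"
    then show "linear_map R W U (b (a \<odot>\<^bsub>V\<^esub> x))"
      using linear_map_smult[OF left] cl linear_map_add[of R W U "b x"]
        linear_map_smult[of R W U "b x"]
      by (intro linear_mapI)
        (auto simp: U.a_ac U.smult_r_distr U.smult_assoc1[symmetric] m_comm)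
  qed auto
  moreover have "B \<subseteq> ?N"
    using B right by (auto simp: spans_def)
  ultimately show "linear_map R W U (b x)"
    using B x unfolding spans_def by blast
qed

lemma bilinear_map_finsum:
  assumes b: "bilinear_map R V W U b" and mods: "module R V" "module R W" "module R U"
    and "finite A" "finite B" "\<And>i. i \<in> A \<Longrightarrow> f i \<in> carrier V" "\<And>j. j \<in> B \<Longrightarrow> g j \<in> carrier W"
  shows "b (\<Oplus>\<^bsub>V\<^esub>i\<in>A. f i) (\<Oplus>\<^bsub>W\<^esub>j\<in>B. g j) = (\<Oplus>\<^bsub>U\<^esub>i\<in>A. \<Oplus>\<^bsub>U\<^esub>j\<in>B. b (f i) (g j))"
proof -
  interpret V: module R V by fact
  interpret W: module R W by fact
  interpret U: module R U by fact
  have "(\<Oplus>\<^bsub>W\<^esub>j\<in>B. g j) \<in> carrier W"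
    using assms by auto
  then have "b (\<Oplus>\<^bsub>V\<^esub>i\<in>A. f i) (\<Oplus>\<^bsub>W\<^esub>j\<in>B. g j) = (\<Oplus>\<^bsub>U\<^esub>i\<in>A. b (f i) (\<Oplus>\<^bsub>W\<^esub>j\<in>B. g j))"
    using assms by (intro linear_map_finsum[OF bilinear_map_left[OF b]]) auto
  also have "\<dots> = (\<Oplus>\<^bsub>U\<^esub>i\<in>A. \<Oplus>\<^bsub>U\<^esub>j\<in>B. b (f i) (g j))"
    using assms bilinear_map_closed[OF b]
    by (intro U.finsum_cong' refl linear_map_finsum[OF bilinear_map_right[OF b]] U.finsum_closed) auto
  finally show ?thesis .
qed

lemma submodule_zero_closed: "submodule N R V \<Longrightarrow> \<zero>\<^bsub>V\<^esub> \<in> N"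
  using subgroup.one_closed[OF submodule.axioms(1)] by simp

text \<open>Pulling submodules back is how spanning sets are carried through quotients and tensor
  products.\<close>

lemma linear_map_vimage:
  assumes f: "linear_map R V W f" "module R V" "module R W" and N: "submodule N R W"
  shows "submodule {x \<in> carrier V. f x \<in> N} R V"
proof -
  interpret V: module R V by fact
  interpret W: module R W by fact
  note sub = W.submoduleE[OF N] submodule_zero_closed[OF N]
  show ?thesis
    by (intro V.submoduleI) (auto simp: sub linear_map_add[OF f(1)] linear_map_smult[OF f(1)]
        linear_map_zero[OF f] linear_map_uminus[OF f])
qed

section \<open>Free modules, quotients and tensor products\<close>

lemma free_carrier_iff:
  "f \<in> carrier (free R X) \<longleftrightarrow>
     (\<forall>x\<in>X. f x \<in> carrier R) \<and> (\<forall>x. x \<notin> X \<longrightarrow> f x = \<zero>) \<and> finite {x. f x \<noteq> \<zero>}"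
  by (simp add: free_def)

lemma free_simps:
  "\<zero>\<^bsub>free R X\<^esub> = (\<lambda>x. \<zero>)" "f \<oplus>\<^bsub>free R X\<^esub> g = (\<lambda>x. f x \<oplus> g x)"
  "a \<odot>\<^bsub>free R X\<^esub> f = (\<lambda>x. a \<otimes> f x)"
  by (simp_all add: free_def)

lemma free_value_closed: "f \<in> carrier (free R X) \<Longrightarrow> f x \<in> carrier R"
  by (cases "x \<in> X") (auto simp: free_carrier_iff)

lemma free_outside: "f \<in> carrier (free R X) \<Longrightarrow> x \<notin> X \<Longrightarrow> f x = \<zero>"
  by (simp add: free_carrier_iff)

lemma free_finite_support: "f \<in> carrier (free R X) \<Longrightarrow> finite {x. f x \<noteq> \<zero>}"
  by (simp add: free_carrier_iff)

lemma free_carrierI: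
  assumes "\<And>x. f x \<in> carrier R" "\<And>x. x \<notin> X \<Longrightarrow> f x = \<zero>" "finite S" "{x. f x \<noteq> \<zero>} \<subseteq> S"
  shows "f \<in> carrier (free R X)"
  using assms finite_subset by (auto simp: free_carrier_iff)

lemma free_add_closed:
  assumes f: "f \<in> carrier (free R X)" and g: "g \<in> carrier (free R X)"
  shows "(\<lambda>x. f x \<oplus> g x) \<in> carrier (free R X)"
proof (rule free_carrierI)
  show "finite ({x. f x \<noteq> \<zero>} \<union> {x. g x \<noteq> \<zero>})"
    using free_finite_support[OF f] free_finite_support[OF g] by simp
qed (use free_value_closed[OF f] free_value_closed[OF g] in
    \<open>auto simp: free_outside[OF f] free_outside[OF g]\<close>)

lemma free_smult_closed:
  assumes "a \<in> carrier R" and f: "f \<in> carrier (free R X)"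
  shows "(\<lambda>x. a \<otimes> f x) \<in> carrier (free R X)"
  using assms(1) free_value_closed[OF f]
  by (intro free_carrierI[OF _ _ free_finite_support[OF f]]) (auto simp: free_outside[OF f])

lemma free_module: "module R (free R X)"
proof (rule moduleI[OF is_cring])
  show "abelian_group (free R X)"
  proof (rule abelian_groupI)
    fix f assume f: "f \<in> carrier (free R X)"
    then have "(\<lambda>x. (\<ominus> \<one>) \<otimes> f x) \<in> carrier (free R X)"
      by (intro free_smult_closed) auto
    moreover have "(\<lambda>x. (\<ominus> \<one>) \<otimes> f x) \<oplus>\<^bsub>free R X\<^esub> f = \<zero>\<^bsub>free R X\<^esub>"
      using free_value_closed[OF f] by (auto simp: free_simps l_minus l_neg)
    ultimately show "\<exists>g\<in>carrier (free R X). g \<oplus>\<^bsub>free R X\<^esub> f = \<zero>\<^bsub>free R X\<^esub>"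
      by blast
  qed (auto simp: free_simps free_add_closed free_value_closed a_ac, auto simp: free_carrier_iff)
qed (auto simp: free_simps free_smult_closed free_value_closed l_distr r_distr m_assoc)

lemma single_closed: "x \<in> X \<Longrightarrow> single R x \<in> carrier (free R X)"
  by (auto simp: free_carrier_iff single_def intro: finite_subset[of _ "{x}"])

text \<open>Induction on the support: a function supported on S and one further point y is its
  restriction to S plus a multiple of \<open>single R y\<close>.\<close>

lemma free_spans: "spans R (free R X) (single R ` X)"
  unfolding spans_def
proof (intro conjI allI impI subsetI)
  fix f assume "f \<in> single R ` X"
  then show "f \<in> carrier (free R X)"
    by (elim imageE) (simp only: single_closed)
next
  interpret F: module R "free R X" by (rule free_module)
  fix N f assume N: "submodule N R (free R X) \<and> single R ` X \<subseteq> N" and f: "f \<in> carrier (free R X)"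
  note sub = F.submoduleE[OF conjunct1[OF N]]
  have zero: "\<zero>\<^bsub>free R X\<^esub> \<in> N"
    using N submodule_zero_closed by blast
  have "finite S \<Longrightarrow> f \<in> carrier (free R X) \<Longrightarrow> {x. f x \<noteq> \<zero>} = S \<Longrightarrow> f \<in> N" for S f
  proof (induction S arbitrary: f rule: finite_induct)
    case empty
    then have "f = \<zero>\<^bsub>free R X\<^esub>"
      by (auto simp: free_simps)
    then show ?case
      using zero by simp
  next
    case (insert y S)
    define g where "g = f(y := \<zero>)"
    have supp: "{x. g x \<noteq> \<zero>} = S"
      using insert.hyps insert.prems by (auto simp: g_def)
    have y: "y \<in> X" and fy: "f y \<in> carrier R"
      using insert.prems by (auto simp: free_carrier_iff)
    have "g \<in> carrier (free R X)"
      using insert.prems insert.hyps supp by (auto simp: free_carrier_iff g_def)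
    then have "g \<in> N"
      using insert.IH supp by blast
    moreover have "f y \<odot>\<^bsub>free R X\<^esub> single R y \<in> N"
      using sub(4) fy y N by blast
    moreover have "f = g \<oplus>\<^bsub>free R X\<^esub> (f y \<odot>\<^bsub>free R X\<^esub> single R y)"
      using free_value_closed[OF insert.prems(1)] by (auto simp: free_simps g_def single_def)
    ultimately show ?case
      using sub(5) by metis
  qed
  then show "f \<in> N"
    using f by (auto simp: free_carrier_iff)
qed

text \<open>The support changes under addition and scaling, where values may cancel. Summing over a
  common finite superset instead makes the sums comparable term by term.\<close>

lemma linear_extension_superset:
  assumes "module R W" "f \<in> carrier (free R X)" "g \<in> X \<rightarrow> carrier W"
    "finite S" "{x. f x \<noteq> \<zero>} \<subseteq> S" "S \<subseteq> X"
  shows "linear_extension R W g f = (\<Oplus>\<^bsub>W\<^esub>x\<in>S. f x \<odot>\<^bsub>W\<^esub> g x)"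
proof -
  interpret W: module R W by fact
  show ?thesis
    unfolding linear_extension_def
    using assms free_value_closed[OF assms(2)]
    by (intro W.add.finprod_mono_neutral_cong_left) (auto simp: Pi_def subset_iff)
qed

lemma linear_extension_linear:
  assumes "module R W" "g \<in> X \<rightarrow> carrier W"
  shows "linear_map R (free R X) W (linear_extension R W g)"
proof (rule linear_mapI)
  interpret W: module R W by fact
  interpret F: module R "free R X" by (rule free_module)
  have supp: "finite {x. f x \<noteq> \<zero>}" "{x. f x \<noteq> \<zero>} \<subseteq> X" if "f \<in> carrier (free R X)" for f
    using that by (auto simp: free_carrier_iff)
  note ext = linear_extension_superset[OF assms(1) _ assms(2)]
  have gX: "g x \<in> carrier W" if "S \<subseteq> X" "x \<in> S" for S x
    using that assms(2) by auto
  fix f assume f: "f \<in> carrier (free R X)"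
  note fR = free_value_closed[OF f]
  show "linear_extension R W g f \<in> carrier W"
    unfolding linear_extension_def using f fR assms(2) supp[OF f]
    by (intro W.finsum_closed) (auto simp: Pi_def subset_iff)
  { fix h assume h: "h \<in> carrier (free R X)"
    note hR = free_value_closed[OF h]
    define S where "S = {x. f x \<noteq> \<zero>} \<union> {x. h x \<noteq> \<zero>}"
    have S: "finite S" "S \<subseteq> X" "{x. f x \<noteq> \<zero>} \<subseteq> S" "{x. h x \<noteq> \<zero>} \<subseteq> S"
      "{x. (f \<oplus>\<^bsub>free R X\<^esub> h) x \<noteq> \<zero>} \<subseteq> S"
      using supp[OF f] supp[OF h] by (auto simp: S_def free_simps)
    have "linear_extension R W g (f \<oplus>\<^bsub>free R X\<^esub> h)
        = (\<Oplus>\<^bsub>W\<^esub>x\<in>S. f x \<odot>\<^bsub>W\<^esub> g x \<oplus>\<^bsub>W\<^esub> h x \<odot>\<^bsub>W\<^esub> g x)"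
      using gX[OF S(2)] fR hR ext[OF F.a_closed[OF f h] S(1,5,2)]
      by (simp only:) (rule W.finsum_cong', auto simp: free_simps W.smult_l_distr)
    also have "\<dots> = linear_extension R W g f \<oplus>\<^bsub>W\<^esub> linear_extension R W g h"
      using gX[OF S(2)] fR hR ext[OF f S(1,3,2)] ext[OF h S(1,4,2)]
      by (simp only:) (rule W.finsum_addf, auto)
    finally show "linear_extension R W g (f \<oplus>\<^bsub>free R X\<^esub> h)
        = linear_extension R W g f \<oplus>\<^bsub>W\<^esub> linear_extension R W g h" . }
  fix a assume a: "a \<in> carrier R"
  define S where "S = {x. f x \<noteq> \<zero>}"
  have S: "finite S" "S \<subseteq> X" "{x. f x \<noteq> \<zero>} \<subseteq> S" "{x. (a \<odot>\<^bsub>free R X\<^esub> f) x \<noteq> \<zero>} \<subseteq> S"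
    using supp[OF f] a by (auto simp: S_def free_simps)
  have "linear_extension R W g (a \<odot>\<^bsub>free R X\<^esub> f) = (\<Oplus>\<^bsub>W\<^esub>x\<in>S. a \<odot>\<^bsub>W\<^esub> (f x \<odot>\<^bsub>W\<^esub> g x))"
    using gX[OF S(2)] fR a ext[OF F.smult_closed[OF a f] S(1,4,2)]
    by (simp only:) (rule W.finsum_cong', auto simp: free_simps W.smult_assoc1)
  also have "\<dots> = a \<odot>\<^bsub>W\<^esub> linear_extension R W g f"
    using gX[OF S(2)] S(1) fR ext[OF f S(1,3,2)]
    by (simp only:) (rule W.finsum_smult_ldistr[OF _ a, symmetric], auto)
  finally show "linear_extension R W g (a \<odot>\<^bsub>free R X\<^esub> f) = a \<odot>\<^bsub>W\<^esub> linear_extension R W g f" .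
qed

lemma linear_extension_single:
  assumes "module R W" "g \<in> X \<rightarrow> carrier W" "x \<in> X"
  shows "linear_extension R W g (single R x) = g x"
proof -
  interpret W: module R W by fact
  have "linear_extension R W g (single R x) = (\<Oplus>\<^bsub>W\<^esub>y\<in>{x}. single R x y \<odot>\<^bsub>W\<^esub> g y)"
    using assms single_closed[OF assms(3)]
    by (intro linear_extension_superset) (auto simp: single_def)
  also have "\<dots> = g x"
    using funcset_mem[OF assms(2,3)] by (simp add: single_def)
  finally show ?thesis .
qed

section \<open>Quotients by the span of a set of relations\<close>

lemma submodule_span_superset: "S \<subseteq> submodule_span R V S"
  unfolding submodule_span_def by blast

lemma submodule_span_least: "submodule N R V \<Longrightarrow> S \<subseteq> N \<Longrightarrow> submodule_span R V S \<subseteq> N"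
  unfolding submodule_span_def by blast

text \<open>If S left the carrier, no submodule would contain it and the intersection would be the
  whole type; with S inside, the carrier itself is one of the sets intersected.\<close>

lemma submodule_span_submodule:
  assumes "module R V" "S \<subseteq> carrier V"
  shows "submodule (submodule_span R V S) R V"
proof -
  interpret V: module R V by fact
  have car: "submodule_span R V S \<subseteq> carrier V"
    using V.carrier_is_submodule assms(2) by (rule submodule_span_least)
  show ?thesis
    using car
    by (rule V.submoduleI)
      (auto simp: submodule_span_def intro: submodule_zero_closed V.submoduleE(3,4,5))
qed

lemma submodule_abelian_subgroup:
  assumes "module R V" "submodule N R V"
  shows "abelian_subgroup N V"
proof -
  interpret V: module R V by fact
  show ?thesis
    using submodule.axioms(1)[OF assms(2)]
    by (intro abelian_subgroupI3 additive_subgroupI) (simp_all add: V.abelian_group_axioms)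
qed

lemma coset_eqI:
  assumes "module R V" "submodule N R V" "y \<in> carrier V" "x \<in> N +>\<^bsub>V\<^esub> y"
  shows "N +>\<^bsub>V\<^esub> x = N +>\<^bsub>V\<^esub> y"
proof -
  interpret V: module R V by fact
  interpret N: abelian_subgroup N V using assms(1,2) by (rule submodule_abelian_subgroup)
  show ?thesis
    using N.a_repr_independence'[OF assms(4,3)] by simp
qed

lemma quotient_module_simps:
  "carrier (quotient_module V N) = (\<lambda>x. N +>\<^bsub>V\<^esub> x) ` carrier V"
  "\<zero>\<^bsub>quotient_module V N\<^esub> = N"
  by (auto simp: quotient_module_def A_RCOSETS_def RCOSETS_def a_r_coset_def)

lemma quotient_module_add:
  assumes "module R V" "submodule N R V" "x \<in> carrier V" "y \<in> carrier V"
  shows "(N +>\<^bsub>V\<^esub> x) \<oplus>\<^bsub>quotient_module V N\<^esub> (N +>\<^bsub>V\<^esub> y) = N +>\<^bsub>V\<^esub> (x \<oplus>\<^bsub>V\<^esub> y)"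
proof -
  interpret N: abelian_subgroup N V using assms(1,2) by (rule submodule_abelian_subgroup)
  show ?thesis
    using assms(3,4) by (simp add: quotient_module_def N.a_rcos_sum)
qed

text \<open>The product is defined as a union over all representatives of the coset. They all give
  the same coset, and there is at least one, so the union collapses.\<close>

lemma quotient_module_smult:
  assumes "module R V" "submodule N R V" "a \<in> carrier R" "x \<in> carrier V"
  shows "a \<odot>\<^bsub>quotient_module V N\<^esub> (N +>\<^bsub>V\<^esub> x) = N +>\<^bsub>V\<^esub> (a \<odot>\<^bsub>V\<^esub> x)"
proof -
  interpret V: module R V by fact
  interpret N: abelian_subgroup N V using assms(1,2) by (rule submodule_abelian_subgroup)
  have "N +>\<^bsub>V\<^esub> (a \<odot>\<^bsub>V\<^esub> y) = N +>\<^bsub>V\<^esub> (a \<odot>\<^bsub>V\<^esub> x)" if y: "y \<in> N +>\<^bsub>V\<^esub> x" for y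
  proof (rule coset_eqI[OF assms(1,2)])
    obtain n where n: "n \<in> N" "y = n \<oplus>\<^bsub>V\<^esub> x"
      using y by (auto simp: a_r_coset_def')
    then have "n \<in> carrier V"
      using N.a_Hcarr by simp
    then have "a \<odot>\<^bsub>V\<^esub> y = a \<odot>\<^bsub>V\<^esub> n \<oplus>\<^bsub>V\<^esub> a \<odot>\<^bsub>V\<^esub> x"
      using n assms by (simp add: V.smult_r_distr)
    moreover have "a \<odot>\<^bsub>V\<^esub> n \<in> N"
      using V.submoduleE(4)[OF assms(2)] assms(3) n by blast
    ultimately show "a \<odot>\<^bsub>V\<^esub> y \<in> N +>\<^bsub>V\<^esub> (a \<odot>\<^bsub>V\<^esub> x)"
      by (auto simp: a_r_coset_def')
  qed (use assms in simp)
  then have "(\<Union>y\<in>N +>\<^bsub>V\<^esub> x. N +>\<^bsub>V\<^esub> (a \<odot>\<^bsub>V\<^esub> y)) = (\<Union>y\<in>N +>\<^bsub>V\<^esub> x. N +>\<^bsub>V\<^esub> (a \<odot>\<^bsub>V\<^esub> x))"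
    by (intro SUP_cong refl)
  moreover have "N +>\<^bsub>V\<^esub> x \<noteq> {}"
    using N.a_rcos_self[OF assms(4)] by blast
  ultimately show ?thesis
    by (simp add: quotient_module_def)
qed

lemma quotient_module_module:
  assumes "module R V" "submodule N R V"
  shows "module R (quotient_module V N)"
proof (rule moduleI[OF is_cring])
  interpret V: module R V by fact
  interpret N: abelian_subgroup N V using assms by (rule submodule_abelian_subgroup)
  note simps = quotient_module_simps quotient_module_add[OF assms] quotient_module_smult[OF assms]
  \<comment> \<open>The zero of the quotient is the set N itself; written as a coset it falls under
    the rules for cosets.\<close>
  have zero: "N = N +>\<^bsub>V\<^esub> \<zero>\<^bsub>V\<^esub>"
    using N.a_subset by simp
  show "abelian_group (quotient_module V N)"
  proof (rule abelian_groupI)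
    fix A assume "A \<in> carrier (quotient_module V N)"
    then obtain x where x: "x \<in> carrier V" "A = N +>\<^bsub>V\<^esub> x"
      by (auto simp: simps)
    then have "(N +>\<^bsub>V\<^esub> (\<ominus>\<^bsub>V\<^esub> x)) \<oplus>\<^bsub>quotient_module V N\<^esub> A = N"
      using zero by (simp add: simps V.l_neg)
    with x show "\<exists>B\<in>carrier (quotient_module V N). B \<oplus>\<^bsub>quotient_module V N\<^esub> A = \<zero>\<^bsub>quotient_module V N\<^esub>"
      by (auto simp: simps)
    show "\<zero>\<^bsub>quotient_module V N\<^esub> \<oplus>\<^bsub>quotient_module V N\<^esub> A = A"
      using x quotient_module_add[OF assms V.zero_closed x(1)] zero by (simp add: simps(2))
  next
    show "\<zero>\<^bsub>quotient_module V N\<^esub> \<in> carrier (quotient_module V N)"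
      using zero by (auto simp: simps(1,2))
  qed (auto simp: simps V.a_ac)
qed (use assms in \<open>auto simp: quotient_module_simps quotient_module_add quotient_module_smult
    module.smult_closed module.smult_l_distr module.smult_r_distr module.smult_assoc1
    module.smult_one abelian_monoid.a_closed[OF abelian_group.axioms(1)[OF module.axioms(2)]]\<close>)

lemma coset_map_linear:
  assumes "module R V" "submodule N R V"
  shows "linear_map R V (quotient_module V N) (\<lambda>x. N +>\<^bsub>V\<^esub> x)"
  by (rule linear_mapI)
    (auto simp: quotient_module_simps quotient_module_add[OF assms] quotient_module_smult[OF assms])

context
  fixes X :: "'x set" and S :: "('x \<Rightarrow> 'a) set"
  assumes relations: "S \<subseteq> carrier (free R X)"
begin

lemmas span_submodule = submodule_span_submodule[OF free_module relations]

lemma presented_module: "module R (presented R X S)"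
  unfolding presented_def by (rule quotient_module_module[OF free_module span_submodule])

lemma projection_linear:
  "linear_map R (free R X) (presented R X S) (\<lambda>f. submodule_span R (free R X) S +>\<^bsub>free R X\<^esub> f)"
  unfolding presented_def by (rule coset_map_linear[OF free_module span_submodule])

lemma projection_relation:
  assumes "r \<in> S"
  shows "submodule_span R (free R X) S +>\<^bsub>free R X\<^esub> r = \<zero>\<^bsub>presented R X S\<^esub>"
proof -
  interpret N: abelian_subgroup "submodule_span R (free R X) S" "free R X"
    by (rule submodule_abelian_subgroup[OF free_module span_submodule])
  show ?thesis
    using N.a_rcos_const subsetD[OF submodule_span_superset[of S "free R X"] assms]
    by (simp add: presented_def quotient_module_simps)
qed

lemma generator_closed: "x \<in> X \<Longrightarrow> generator R X S x \<in> carrier (presented R X S)"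
  unfolding generator_def by (rule linear_map_closed[OF projection_linear single_closed])

text \<open>A submodule of the quotient that contains the generators pulls back to a submodule of
  the free module that contains the basis.\<close>

lemma presented_spans: "spans R (presented R X S) (generator R X S ` X)"
  unfolding spans_def
proof (intro conjI allI impI)
  show "generator R X S ` X \<subseteq> carrier (presented R X S)"
    using generator_closed by blast
  fix N assume N: "submodule N R (presented R X S) \<and> generator R X S ` X \<subseteq> N"
  let ?p = "\<lambda>f. submodule_span R (free R X) S +>\<^bsub>free R X\<^esub> f"
  let ?M = "{f \<in> carrier (free R X). ?p f \<in> N}"
  have "submodule ?M R (free R X)"
    using N by (intro linear_map_vimage[OF projection_linear free_module presented_module]) simp
  moreover have "single R ` X \<subseteq> ?M"
    using N by (simp add: image_subset_iff single_closed flip: generator_def)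
  ultimately have "carrier (free R X) \<subseteq> ?M"
    by (intro subsetI) (rule spansD[OF free_spans])
  then show "carrier (presented R X S) \<subseteq> N"
    by (auto simp: presented_def quotient_module_simps)
qed

context
  fixes W :: "('a, 'w, 'n) module_scheme" and g :: "'x \<Rightarrow> 'w"
  assumes W: "module R W" and g: "g \<in> X \<rightarrow> carrier W"
    and kills: "\<And>r. r \<in> S \<Longrightarrow> linear_extension R W g r = \<zero>\<^bsub>W\<^esub>"
begin

text \<open>Elements of one coset differ by an element of the span, on which the extension vanishes.
  The image of the coset is thus a singleton, and \<open>the_elem\<close> returns its
  element.\<close>

lemma induced_projection:
  assumes f: "f \<in> carrier (free R X)"
  shows "induced R W g (submodule_span R (free R X) S +>\<^bsub>free R X\<^esub> f) = linear_extension R W g f"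
proof -
  interpret W: module R W by (rule W)
  let ?N = "submodule_span R (free R X) S"
  interpret N: abelian_subgroup ?N "free R X"
    by (rule submodule_abelian_subgroup[OF free_module span_submodule])
  note lin = linear_extension_linear[OF W g]
  have "?N \<subseteq> {x \<in> carrier (free R X). linear_extension R W g x = \<zero>\<^bsub>W\<^esub>}"
    using relations kills
    by (intro submodule_span_least linear_map_kernel[OF lin free_module W]) auto
  then have "linear_extension R W g h = linear_extension R W g f" if "h \<in> ?N +>\<^bsub>free R X\<^esub> f" for h
    using that f linear_map_closed[OF lin f]
    by (auto simp: a_r_coset_def' linear_map_add[OF lin] subset_iff)
  moreover have "f \<in> ?N +>\<^bsub>free R X\<^esub> f"
    using f by (rule N.a_rcos_self)
  ultimately have "linear_extension R W g ` (?N +>\<^bsub>free R X\<^esub> f) = {linear_extension R W g f}"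
    by blast
  then show ?thesis
    by (simp add: induced_def)
qed

lemma induced_linear: "linear_map R (presented R X S) W (induced R W g)"
proof -
  interpret F: module R "free R X" by (rule free_module)
  note lin = linear_extension_linear[OF W g]
  show ?thesis
    using linear_map_closed[OF lin] linear_map_add[OF lin] linear_map_smult[OF lin]
    by (intro linear_mapI)
      (auto simp: presented_def quotient_module_simps induced_projection
        quotient_module_add[OF free_module span_submodule]
        quotient_module_smult[OF free_module span_submodule])
qed

lemma induced_generator: "x \<in> X \<Longrightarrow> induced R W g (generator R X S x) = g x"
  by (simp add: generator_def induced_projection single_closed linear_extension_single[OF W g])

end

end

section \<open>Tensor products and their universal property\<close>

lemma tensor_relations_closed:
  assumes "module R V" "module R W"
  shows "tensor_relations R V W \<subseteq> carrier (free R (carrier V \<times> carrier W))"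
proof -
  interpret V: module R V by fact
  interpret W: module R W by fact
  interpret F: module R "free R (carrier V \<times> carrier W)" by (rule free_module)
  show ?thesis
    by (auto simp: tensor_relations_def Let_def single_closed
        intro!: F.minus_closed F.a_closed F.smult_closed)
qed

lemma tensor_module: "module R V \<Longrightarrow> module R W \<Longrightarrow> module R (tensor R V W)"
  unfolding tensor_def by (intro presented_module tensor_relations_closed)

text \<open>Each of the four laws is one of the four families of relations, sent to zero by the
  projection.\<close>

lemma pure_tensor_bilinear:
  assumes "module R V" "module R W"
  shows "bilinear_map R V W (tensor R V W) (pure_tensor R V W)"
proof -
  interpret V: module R V by fact
  interpret W: module R W by fact
  interpret F: module R "free R (carrier V \<times> carrier W)" by (rule free_module)
  interpret T: module R "tensor R V W" using assms by (rule tensor_module)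
  note rel = tensor_relations_closed[OF assms]
  note lin = projection_linear[OF rel, folded tensor_def]
  note zero = projection_relation[OF rel, folded tensor_def]
  note lins = linear_map_minus[OF lin free_module T.module_axioms] linear_map_add[OF lin]
    linear_map_smult[OF lin]
  have cl: "pure_tensor R V W x y \<in> carrier (tensor R V W)"
    if "x \<in> carrier V" "y \<in> carrier W" for x y
    using that generator_closed[OF rel] by (simp add: pure_tensor_def tensor_def)
  let ?d = "single R" and ?F = "free R (carrier V \<times> carrier W)"
  have addl: "pure_tensor R V W (x \<oplus>\<^bsub>V\<^esub> x') y = pure_tensor R V W x y \<oplus>\<^bsub>tensor R V W\<^esub> pure_tensor R V W x' y"
    if "x \<in> carrier V" "x' \<in> carrier V" "y \<in> carrier W" for x x' y
  proof -
    have "?d (x \<oplus>\<^bsub>V\<^esub> x', y) \<ominus>\<^bsub>?F\<^esub> (?d (x, y) \<oplus>\<^bsub>?F\<^esub> ?d (x', y)) \<in> tensor_relations R V W"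
      using that unfolding tensor_relations_def Let_def by blast
    from zero[OF this] that cl show ?thesis
      by (simp add: lins single_closed T.a_minus_zero_iff
          flip: generator_def pure_tensor_def)
  qed
  have addr: "pure_tensor R V W x (y \<oplus>\<^bsub>W\<^esub> y') = pure_tensor R V W x y \<oplus>\<^bsub>tensor R V W\<^esub> pure_tensor R V W x y'"
    if "x \<in> carrier V" "y \<in> carrier W" "y' \<in> carrier W" for x y y'
  proof -
    have "?d (x, y \<oplus>\<^bsub>W\<^esub> y') \<ominus>\<^bsub>?F\<^esub> (?d (x, y) \<oplus>\<^bsub>?F\<^esub> ?d (x, y')) \<in> tensor_relations R V W"
      using that unfolding tensor_relations_def Let_def by blast
    from zero[OF this] that cl show ?thesis
      by (simp add: lins single_closed T.a_minus_zero_iff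
          flip: generator_def pure_tensor_def)
  qed
  have smultl: "pure_tensor R V W (a \<odot>\<^bsub>V\<^esub> x) y = a \<odot>\<^bsub>tensor R V W\<^esub> pure_tensor R V W x y"
    if "a \<in> carrier R" "x \<in> carrier V" "y \<in> carrier W" for a x y
  proof -
    have "?d (a \<odot>\<^bsub>V\<^esub> x, y) \<ominus>\<^bsub>?F\<^esub> a \<odot>\<^bsub>?F\<^esub> ?d (x, y) \<in> tensor_relations R V W"
      using that unfolding tensor_relations_def Let_def by blast
    from zero[OF this] that cl show ?thesis
      by (simp add: lins single_closed T.a_minus_zero_iff
          flip: generator_def pure_tensor_def)
  qed
  have smultr: "pure_tensor R V W x (a \<odot>\<^bsub>W\<^esub> y) = a \<odot>\<^bsub>tensor R V W\<^esub> pure_tensor R V W x y"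
    if "a \<in> carrier R" "x \<in> carrier V" "y \<in> carrier W" for a x y
  proof -
    have "?d (x, a \<odot>\<^bsub>W\<^esub> y) \<ominus>\<^bsub>?F\<^esub> a \<odot>\<^bsub>?F\<^esub> ?d (x, y) \<in> tensor_relations R V W"
      using that unfolding tensor_relations_def Let_def by blast
    from zero[OF this] that cl show ?thesis
      by (simp add: lins single_closed T.a_minus_zero_iff
          flip: generator_def pure_tensor_def)
  qed
  show ?thesis
    by (intro bilinear_mapI linear_mapI) (simp_all add: cl addl addr smultl smultr)
qed

lemma pure_tensor_closed:
  "module R V \<Longrightarrow> module R W \<Longrightarrow> x \<in> carrier V \<Longrightarrow> y \<in> carrier W \<Longrightarrow>
   pure_tensor R V W x y \<in> carrier (tensor R V W)"
  using pure_tensor_bilinear bilinear_map_closed by metis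

text \<open>The factors are enlarged one at a time: from C to W while the first factor stays in B,
  then from B to V.\<close>

lemma tensor_spans:
  assumes "module R V" "module R W" "spans R V B" "spans R W C"
  shows "spans R (tensor R V W) (case_prod (pure_tensor R V W) ` (B \<times> C))"
  unfolding spans_def
proof (intro conjI allI impI)
  have BC: "B \<subseteq> carrier V" "C \<subseteq> carrier W"
    using assms by (auto simp: spans_def)
  show "case_prod (pure_tensor R V W) ` (B \<times> C) \<subseteq> carrier (tensor R V W)"
    using BC pure_tensor_closed[OF assms(1,2)] by auto
  fix N assume N: "submodule N R (tensor R V W) \<and> case_prod (pure_tensor R V W) ` (B \<times> C) \<subseteq> N"
  interpret V: module R V by fact
  interpret W: module R W by fact
  interpret T: module R "tensor R V W" using assms(1,2) by (rule tensor_module)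
  note bil = pure_tensor_bilinear[OF assms(1,2)]
  have 1: "pure_tensor R V W x y \<in> N" if "x \<in> B" "y \<in> carrier W" for x y
  proof -
    have "x \<in> carrier V"
      using that BC by blast
    then have "submodule {y \<in> carrier W. pure_tensor R V W x y \<in> N} R W"
      by (intro linear_map_vimage[OF bilinear_map_right[OF bil] assms(2) T.module_axioms conjunct1[OF N]])
    moreover have "C \<subseteq> {y \<in> carrier W. pure_tensor R V W x y \<in> N}"
      using N BC that by auto
    ultimately show ?thesis
      using spansD[OF assms(4)] that by blast
  qed
  have 2: "pure_tensor R V W x y \<in> N" if "x \<in> carrier V" "y \<in> carrier W" for x y
  proof -
    have "submodule {x \<in> carrier V. pure_tensor R V W x y \<in> N} R V"
      using that
      by (intro linear_map_vimage[OF bilinear_map_left[OF bil] assms(1) T.module_axioms conjunct1[OF N]])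
    moreover have "B \<subseteq> {x \<in> carrier V. pure_tensor R V W x y \<in> N}"
      using 1 BC that by auto
    ultimately show ?thesis
      using spansD[OF assms(3)] that by blast
  qed
  show "carrier (tensor R V W) \<subseteq> N"
    using presented_spans[OF tensor_relations_closed[OF assms(1,2)]] N 2
    unfolding spans_def tensor_def[symmetric] by (auto simp flip: pure_tensor_def)
qed

text \<open>Bilinearity of b says exactly that its linear extension kills the four families of
  relations.\<close>

lemma
  assumes mods: "module R V" "module R W" "module R U" and b: "bilinear_map R V W U b"
  shows tensor_lift_linear: "linear_map R (tensor R V W) U (tensor_lift R U b)"
    and tensor_lift_pure: "x \<in> carrier V \<Longrightarrow> y \<in> carrier W \<Longrightarrow>
      tensor_lift R U b (pure_tensor R V W x y) = b x y"
proof -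
  interpret V: module R V by fact
  interpret W: module R W by fact
  interpret U: module R U by fact
  interpret F: module R "free R (carrier V \<times> carrier W)" by (rule free_module)
  let ?b = "\<lambda>(x, y). b x y"
  have g: "?b \<in> carrier V \<times> carrier W \<rightarrow> carrier U"
    using bilinear_map_closed[OF b] by auto
  note lin = linear_extension_linear[OF mods(3) g]
  note lins = linear_map_minus[OF lin free_module mods(3)] linear_map_add[OF lin]
    linear_map_smult[OF lin] linear_extension_single[OF mods(3) g]
  have "linear_extension R U ?b r = \<zero>\<^bsub>U\<^esub>" if "r \<in> tensor_relations R V W" for r
    using that unfolding tensor_relations_def Let_def
    by (auto simp: lins single_closed bilinear_map_closed[OF b] U.a_minus_zero_iff
        linear_map_add[OF bilinear_map_right[OF b]] linear_map_add[OF bilinear_map_left[OF b]]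
        linear_map_smult[OF bilinear_map_right[OF b]] linear_map_smult[OF bilinear_map_left[OF b]])
  note ind = tensor_relations_closed[OF mods(1,2)] mods(3) g this
  show "linear_map R (tensor R V W) U (tensor_lift R U b)"
    unfolding tensor_def tensor_lift_def by (rule induced_linear[OF ind])
  show "x \<in> carrier V \<Longrightarrow> y \<in> carrier W \<Longrightarrow> tensor_lift R U b (pure_tensor R V W x y) = b x y"
    unfolding tensor_lift_def pure_tensor_def by (subst induced_generator[OF ind]) auto
qed

text \<open>With this trivial spanning set, \<open>tensor_eqI\<close> tests maps on all pure
  tensors.\<close>

lemma spans_carrier: "spans R V (carrier V)"
  by (simp add: spans_def)

lemma tensor_eqI:
  assumes "module R V" "module R W" "module R U" "spans R V B" "spans R W C"
    and "linear_map R (tensor R V W) U f" "linear_map R (tensor R V W) U g"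
    and "\<And>x y. x \<in> B \<Longrightarrow> y \<in> C \<Longrightarrow> f (pure_tensor R V W x y) = g (pure_tensor R V W x y)"
    and "t \<in> carrier (tensor R V W)"
  shows "f t = g t"
  by (rule linear_map_eqI[OF tensor_spans[OF assms(1,2,4,5)] assms(6,7) tensor_module assms(3)])
    (use assms in auto)

text \<open>For lifts nested in lifts, as in the associativity maps. Linearity in z is tested on
  pure tensors, where the inner lift can be evaluated.\<close>

lemma tensor_lift_bilinear:
  assumes "module R V" "module R W" "module R Z" "module R U"
    and "\<And>z. z \<in> carrier Z \<Longrightarrow> bilinear_map R V W U (\<lambda>x y. b x y z)"
    and "\<And>x y. x \<in> carrier V \<Longrightarrow> y \<in> carrier W \<Longrightarrow> linear_map R Z U (b x y)"
  shows "bilinear_map R (tensor R V W) Z U (\<lambda>t z. tensor_lift R U (\<lambda>x y. b x y z) t)"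
proof (rule bilinear_mapI_spanning[OF tensor_spans[OF assms(1,2) spans_carrier spans_carrier]
      tensor_module[OF assms(1,2)] assms(3,4)])
  show "linear_map R (tensor R V W) U (tensor_lift R U (\<lambda>x y. b x y z))" if "z \<in> carrier Z" for z
    using assms(1,2,4) assms(5)[OF that] by (rule tensor_lift_linear)
  fix t assume "t \<in> case_prod (pure_tensor R V W) ` (carrier V \<times> carrier W)"
  then obtain x y where xy: "x \<in> carrier V" "y \<in> carrier W" "t = pure_tensor R V W x y"
    by auto
  then show "linear_map R Z U (\<lambda>z. tensor_lift R U (\<lambda>x y. b x y z) t)"
    using assms(5) by (intro linear_map_cong[OF assms(6) assms(3)])
      (simp_all add: tensor_lift_pure[OF assms(1,2,4)])
qed

lemma
  assumes "module R A" "module R B" "module R V" "module R W"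
    and "linear_map R A V f" "linear_map R B W g"
  shows tensor_map_linear: "linear_map R (tensor R A B) (tensor R V W) (tensor_map R V W f g)"
    and tensor_map_pure: "x \<in> carrier A \<Longrightarrow> y \<in> carrier B \<Longrightarrow>
      tensor_map R V W f g (pure_tensor R A B x y) = pure_tensor R V W (f x) (g y)"
proof -
  note bil = assms(1,2) tensor_module[OF assms(3,4)]
    bilinear_map_comp[OF pure_tensor_bilinear[OF assms(3,4)] assms(5,6)]
  show "linear_map R (tensor R A B) (tensor R V W) (tensor_map R V W f g)"
    unfolding tensor_map_def by (rule tensor_lift_linear[OF bil])
  show "x \<in> carrier A \<Longrightarrow> y \<in> carrier B \<Longrightarrow>
      tensor_map R V W f g (pure_tensor R A B x y) = pure_tensor R V W (f x) (g y)"
    unfolding tensor_map_def by (rule tensor_lift_pure[OF bil])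
qed

lemma
  assumes "module R V" "module R W"
  shows swap_map_linear: "linear_map R (tensor R V W) (tensor R W V) (swap_map R V W)"
    and swap_map_pure: "x \<in> carrier V \<Longrightarrow> y \<in> carrier W \<Longrightarrow>
      swap_map R V W (pure_tensor R V W x y) = pure_tensor R W V y x"
proof -
  note bil = assms tensor_module[OF assms(2,1)]
    bilinear_map_flip[OF pure_tensor_bilinear[OF assms(2,1)]]
  show "linear_map R (tensor R V W) (tensor R W V) (swap_map R V W)"
    unfolding swap_map_def by (rule tensor_lift_linear[OF bil])
  show "x \<in> carrier V \<Longrightarrow> y \<in> carrier W \<Longrightarrow>
      swap_map R V W (pure_tensor R V W x y) = pure_tensor R W V y x"
    unfolding swap_map_def by (rule tensor_lift_pure[OF bil])
qed

lemma
  assumes "module R V"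
  shows left_unit_map_linear: "linear_map R (tensor R (ground R) V) V (left_unit_map R V)"
    and left_unit_map_pure: "a \<in> carrier R \<Longrightarrow> x \<in> carrier V \<Longrightarrow>
      left_unit_map R V (pure_tensor R (ground R) V a x) = a \<odot>\<^bsub>V\<^esub> x"
    and right_unit_map_linear: "linear_map R (tensor R V (ground R)) V (right_unit_map R V)"
    and right_unit_map_pure: "a \<in> carrier R \<Longrightarrow> x \<in> carrier V \<Longrightarrow>
      right_unit_map R V (pure_tensor R V (ground R) x a) = a \<odot>\<^bsub>V\<^esub> x"
proof -
  note left = ground_module assms assms smult_bilinear[OF assms]
  note right = assms ground_module assms bilinear_map_flip[OF smult_bilinear[OF assms]]
  show "linear_map R (tensor R (ground R) V) V (left_unit_map R V)"
    unfolding left_unit_map_def by (rule tensor_lift_linear[OF left])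
  show "linear_map R (tensor R V (ground R)) V (right_unit_map R V)"
    unfolding right_unit_map_def by (rule tensor_lift_linear[OF right])
  show "a \<in> carrier R \<Longrightarrow> x \<in> carrier V \<Longrightarrow>
      left_unit_map R V (pure_tensor R (ground R) V a x) = a \<odot>\<^bsub>V\<^esub> x"
    unfolding left_unit_map_def by (subst tensor_lift_pure[OF left]) (simp_all add: ground_simps)
  show "a \<in> carrier R \<Longrightarrow> x \<in> carrier V \<Longrightarrow>
      right_unit_map R V (pure_tensor R V (ground R) x a) = a \<odot>\<^bsub>V\<^esub> x"
    unfolding right_unit_map_def by (subst tensor_lift_pure[OF right]) (simp_all add: ground_simps)
qed

lemma
  assumes U: "module R U" and V: "module R V" and W: "module R W"
  shows assoc_map_linear: "linear_map R (tensor R (tensor R U V) W) (tensor R U (tensor R V W))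
      (assoc_map R U V W)"
    and assoc_map_pure: "x \<in> carrier U \<Longrightarrow> y \<in> carrier V \<Longrightarrow> z \<in> carrier W \<Longrightarrow>
      assoc_map R U V W (pure_tensor R (tensor R U V) W (pure_tensor R U V x y) z)
      = pure_tensor R U (tensor R V W) x (pure_tensor R V W y z)"
proof -
  note mods = tensor_module[OF U V] tensor_module[OF V W] tensor_module[OF U tensor_module[OF V W]]
  note outer = pure_tensor_bilinear[OF U mods(2)] and inner = pure_tensor_bilinear[OF V W]
  have b1: "bilinear_map R U V (tensor R U (tensor R V W))
      (\<lambda>x y. pure_tensor R U (tensor R V W) x (pure_tensor R V W y z))" if "z \<in> carrier W" for z
    using bilinear_map_comp[OF outer linear_map_id bilinear_map_left[OF inner that]] by simp
  have "bilinear_map R (tensor R U V) W (tensor R U (tensor R V W))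
     (\<lambda>t z. tensor_lift R (tensor R U (tensor R V W))
        (\<lambda>x y. pure_tensor R U (tensor R V W) x (pure_tensor R V W y z)) t)"
    by (intro tensor_lift_bilinear U V W mods b1
        linear_map_comp[OF bilinear_map_right[OF inner] bilinear_map_right[OF outer]])
  note bil = mods(1) W mods(3) this
  show "linear_map R (tensor R (tensor R U V) W) (tensor R U (tensor R V W)) (assoc_map R U V W)"
    unfolding assoc_map_def by (rule tensor_lift_linear[OF bil])
  show "assoc_map R U V W (pure_tensor R (tensor R U V) W (pure_tensor R U V x y) z)
      = pure_tensor R U (tensor R V W) x (pure_tensor R V W y z)"
    if "x \<in> carrier U" "y \<in> carrier V" "z \<in> carrier W"
    unfolding assoc_map_def using that
    by (simp add: tensor_lift_pure[OF bil] tensor_lift_pure[OF U V mods(3) b1]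
        pure_tensor_closed U V)
qed

lemma
  assumes U: "module R U" and V: "module R V" and W: "module R W"
  shows assoc_inv_map_linear: "linear_map R (tensor R U (tensor R V W)) (tensor R (tensor R U V) W)
      (assoc_inv_map R U V W)"
    and assoc_inv_map_pure: "x \<in> carrier U \<Longrightarrow> y \<in> carrier V \<Longrightarrow> z \<in> carrier W \<Longrightarrow>
      assoc_inv_map R U V W (pure_tensor R U (tensor R V W) x (pure_tensor R V W y z))
      = pure_tensor R (tensor R U V) W (pure_tensor R U V x y) z"
proof -
  note mods = tensor_module[OF U V] tensor_module[OF V W] tensor_module[OF tensor_module[OF U V] W]
  note outer = pure_tensor_bilinear[OF mods(1) W] and inner = pure_tensor_bilinear[OF U V]
  have b1: "bilinear_map R V W (tensor R (tensor R U V) W)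
      (\<lambda>y z. pure_tensor R (tensor R U V) W (pure_tensor R U V x y) z)" if "x \<in> carrier U" for x
    using bilinear_map_comp[OF outer bilinear_map_right[OF inner that] linear_map_id] by simp
  \<comment> \<open>The inner lift runs over the second argument here, so bilinearity is proved with
    the arguments exchanged and flipped back in \<open>bil\<close>.\<close>
  have "bilinear_map R (tensor R V W) U (tensor R (tensor R U V) W)
     (\<lambda>t x. tensor_lift R (tensor R (tensor R U V) W)
        (\<lambda>y z. pure_tensor R (tensor R U V) W (pure_tensor R U V x y) z) t)"
    by (intro tensor_lift_bilinear U V W mods b1
        linear_map_comp[OF bilinear_map_left[OF inner] bilinear_map_left[OF outer]])
  note bil = U mods(2,3) bilinear_map_flip[OF this]
  show "linear_map R (tensor R U (tensor R V W)) (tensor R (tensor R U V) W) (assoc_inv_map R U V W)"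
    unfolding assoc_inv_map_def by (rule tensor_lift_linear[OF bil])
  show "assoc_inv_map R U V W (pure_tensor R U (tensor R V W) x (pure_tensor R V W y z))
      = pure_tensor R (tensor R U V) W (pure_tensor R U V x y) z"
    if "x \<in> carrier U" "y \<in> carrier V" "z \<in> carrier W"
    unfolding assoc_inv_map_def using that
    by (simp add: tensor_lift_pure[OF bil] tensor_lift_pure[OF V W mods(3) b1]
        pure_tensor_closed V W)
qed

lemma
  assumes A: "module R A" and B: "module R B" and C: "module R C" and D: "module R D"
  shows middle_swap_map_linear: "linear_map R (tensor R (tensor R A B) (tensor R C D))
      (tensor R (tensor R A C) (tensor R B D)) (middle_swap_map R A B C D)"
    and middle_swap_map_pure: "a \<in> carrier A \<Longrightarrow> b \<in> carrier B \<Longrightarrow> c \<in> carrier C \<Longrightarrow>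
      d \<in> carrier D \<Longrightarrow>
      middle_swap_map R A B C D
        (pure_tensor R (tensor R A B) (tensor R C D) (pure_tensor R A B a b) (pure_tensor R C D c d))
      = pure_tensor R (tensor R A C) (tensor R B D) (pure_tensor R A C a c) (pure_tensor R B D b d)"
proof -
  note mod = A B C D tensor_module
  note lin = assoc_map_linear assoc_inv_map_linear tensor_map_linear swap_map_linear linear_map_id
  \<comment> \<open>A term \<open>tensor_map\<close> records only its targets, so the source of each
    of the five stages has to be stated.\<close>
  have l1: "linear_map R (tensor R (tensor R A B) (tensor R C D))
      (tensor R A (tensor R B (tensor R C D))) (assoc_map R A B (tensor R C D))"
    by (intro lin mod)
  have l2: "linear_map R (tensor R A (tensor R B (tensor R C D)))
      (tensor R A (tensor R (tensor R B C) D))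
      (tensor_map R A (tensor R (tensor R B C) D) id (assoc_inv_map R B C D))"
    by (intro lin mod)
  have s: "linear_map R (tensor R (tensor R B C) D) (tensor R (tensor R C B) D)
      (tensor_map R (tensor R C B) D (swap_map R B C) id)"
    by (intro lin mod)
  have l3: "linear_map R (tensor R A (tensor R (tensor R B C) D))
      (tensor R A (tensor R (tensor R C B) D))
      (tensor_map R A (tensor R (tensor R C B) D) id
        (tensor_map R (tensor R C B) D (swap_map R B C) id))"
    by (intro lin mod)
  have l4: "linear_map R (tensor R A (tensor R (tensor R C B) D))
      (tensor R A (tensor R C (tensor R B D)))
      (tensor_map R A (tensor R C (tensor R B D)) id (assoc_map R C B D))"
    by (intro lin mod)
  have l5: "linear_map R (tensor R A (tensor R C (tensor R B D)))
      (tensor R (tensor R A C) (tensor R B D)) (assoc_inv_map R A C (tensor R B D))"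
    by (intro lin mod)
  show "linear_map R (tensor R (tensor R A B) (tensor R C D))
      (tensor R (tensor R A C) (tensor R B D)) (middle_swap_map R A B C D)"
    unfolding middle_swap_map_def comp_def
    by (intro linear_map_comp[OF l1] linear_map_comp[OF l2] linear_map_comp[OF l3]
        linear_map_comp[OF l4] l5)
  show "middle_swap_map R A B C D
        (pure_tensor R (tensor R A B) (tensor R C D) (pure_tensor R A B a b) (pure_tensor R C D c d))
      = pure_tensor R (tensor R A C) (tensor R B D) (pure_tensor R A C a c) (pure_tensor R B D b d)"
    if "a \<in> carrier A" "b \<in> carrier B" "c \<in> carrier C" "d \<in> carrier D"
    unfolding middle_swap_map_def comp_def using that
    by (simp add: assoc_map_pure assoc_inv_map_pure swap_map_pure pure_tensor_closed mod
        tensor_map_pure[OF _ _ _ _ linear_map_id assoc_inv_map_linear]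
        tensor_map_pure[OF _ _ _ _ linear_map_id s]
        tensor_map_pure[OF _ _ _ _ swap_map_linear linear_map_id]
        tensor_map_pure[OF _ _ _ _ linear_map_id assoc_map_linear])
qed

text \<open>The composites enter as maps h and k that agree with them on the carriers, since
  identities such as those of the projection hold only there. Read backwards, the lemma splits a map
  into two stages.\<close>

lemma tensor_map_compose:
  assumes mods: "module R A" "module R B" "module R V" "module R W" "module R V'" "module R W'"
    and f: "linear_map R A V f" and g: "linear_map R B W g"
    and f': "linear_map R V V' f'" and g': "linear_map R W W' g'"
    and h: "linear_map R A V' h" and k: "linear_map R B W' k"
    and eq: "\<And>x. x \<in> carrier A \<Longrightarrow> f' (f x) = h x" "\<And>y. y \<in> carrier B \<Longrightarrow> g' (g y) = k y"
    and t: "t \<in> carrier (tensor R A B)"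
  shows "tensor_map R V' W' f' g' (tensor_map R V W f g t) = tensor_map R V' W' h k t"
proof -
  note inner = mods(1-4) f g and outer = mods(3-6) f' g' and whole = mods(1,2,5,6) h k
  show ?thesis
    by (rule tensor_eqI[OF mods(1,2) tensor_module[OF mods(5,6)] spans_carrier spans_carrier
          linear_map_comp[OF tensor_map_linear[OF inner] tensor_map_linear[OF outer]]
          tensor_map_linear[OF whole] _ t])
      (simp add: tensor_map_pure[OF inner] tensor_map_pure[OF outer] tensor_map_pure[OF whole] eq
        linear_map_closed[OF f] linear_map_closed[OF g])
qed

text \<open>Moves three maps past a rebracketing, as required to carry the projection through
  coassociativity.\<close>

lemma assoc_map_natural:
  assumes mods: "module R A" "module R B" "module R C" "module R A'" "module R B'" "module R C'"
    and f: "linear_map R A A' f" and g: "linear_map R B B' g" and h: "linear_map R C C' h"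
    and t: "t \<in> carrier (tensor R (tensor R A B) C)"
  shows "tensor_map R A' (tensor R B' C') f (tensor_map R B' C' g h) (assoc_map R A B C t)
    = assoc_map R A' B' C' (tensor_map R (tensor R A' B') C' (tensor_map R A' B' f g) h t)"
proof -
  note fg = mods(1,2,4,5) f g and gh = mods(2,3,5,6) g h
  note left = tensor_module[OF mods(1,2)] mods(3) tensor_module[OF mods(4,5)] mods(6) tensor_map_linear[OF fg] h
  note right = mods(1) tensor_module[OF mods(2,3)] mods(4) tensor_module[OF mods(5,6)] f tensor_map_linear[OF gh]
  note assoc = mods(1-3) and assoc' = mods(4-6)
  note linear_left = linear_map_comp[OF assoc_map_linear[OF assoc] tensor_map_linear[OF right]]
  note linear_right = linear_map_comp[OF tensor_map_linear[OF left] assoc_map_linear[OF assoc']]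
  show ?thesis
    by (rule tensor_eqI[OF left(1,2) tensor_module[OF right(3,4)]
          tensor_spans[OF mods(1,2) spans_carrier spans_carrier] spans_carrier
          linear_left linear_right _ t])
      (auto simp: tensor_map_pure[OF fg] tensor_map_pure[OF gh] tensor_map_pure[OF left]
        tensor_map_pure[OF right] assoc_map_pure[OF assoc] assoc_map_pure[OF assoc']
        pure_tensor_closed mods linear_map_closed[OF f] linear_map_closed[OF g] linear_map_closed[OF h])
qed

end

section \<open>Graphs\<close>

text \<open>\<open>isomorphic\<close> hides its bijection, but transporting vertex subsets requires
  a named one.\<close>

definition graph_isomorphism :: "(nat \<Rightarrow> nat) \<Rightarrow> framed_graph \<Rightarrow> framed_graph \<Rightarrow> bool"
  where
  "graph_isomorphism \<phi> \<Gamma> \<Gamma>' \<longleftrightarrow> bij_betw \<phi> (verts \<Gamma>) (verts \<Gamma>') \<and>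
     (\<forall>v\<in>verts \<Gamma>. \<forall>w\<in>verts \<Gamma>. {v, w} \<in> edges \<Gamma> \<longleftrightarrow> {\<phi> v, \<phi> w} \<in> edges \<Gamma>') \<and>
     (\<forall>v\<in>verts \<Gamma>. framing \<Gamma>' (\<phi> v) = framing \<Gamma> v)"

lemma isomorphic_iff: "isomorphic \<Gamma> \<Gamma>' \<longleftrightarrow> (\<exists>\<phi>. graph_isomorphism \<phi> \<Gamma> \<Gamma>')"
  by (simp add: isomorphic_def graph_isomorphism_def)

text \<open>For graphs on the same vertices whose framings may differ elsewhere; it also reduces the
  comparison of edge sets to pairs of vertices.\<close>

lemma isomorphic_identity:
  assumes "verts \<Gamma> = verts \<Gamma>'"
    "\<And>v w. v \<in> verts \<Gamma> \<Longrightarrow> w \<in> verts \<Gamma> \<Longrightarrow> {v, w} \<in> edges \<Gamma> \<longleftrightarrow> {v, w} \<in> edges \<Gamma>'"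
    "\<And>v. v \<in> verts \<Gamma> \<Longrightarrow> framing \<Gamma> v = framing \<Gamma>' v"
  shows "isomorphic \<Gamma> \<Gamma>'"
  unfolding isomorphic_def using assms by (intro exI[of _ "\<lambda>v. v"]) (auto simp: bij_betw_def)

lemma isomorphic_refl: "isomorphic \<Gamma> \<Gamma>"
  by (rule isomorphic_identity) auto

lemma isomorphic_sym:
  assumes "isomorphic \<Gamma> \<Gamma>'"
  shows "isomorphic \<Gamma>' \<Gamma>"
proof -
  obtain \<phi> where \<phi>: "bij_betw \<phi> (verts \<Gamma>) (verts \<Gamma>')"
    "\<And>v w. v \<in> verts \<Gamma> \<Longrightarrow> w \<in> verts \<Gamma> \<Longrightarrow> {v, w} \<in> edges \<Gamma> \<longleftrightarrow> {\<phi> v, \<phi> w} \<in> edges \<Gamma>'"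
    "\<And>v. v \<in> verts \<Gamma> \<Longrightarrow> framing \<Gamma>' (\<phi> v) = framing \<Gamma> v"
    using assms by (auto simp: isomorphic_def)
  define \<psi> where "\<psi> = the_inv_into (verts \<Gamma>) \<phi>"
  have \<psi>: "bij_betw \<psi> (verts \<Gamma>') (verts \<Gamma>)"
    unfolding \<psi>_def using \<phi>(1) by (rule bij_betw_the_inv_into)
  have "\<psi> v \<in> verts \<Gamma>" "\<phi> (\<psi> v) = v" if "v \<in> verts \<Gamma>'" for v
    using that bij_betwE[OF \<psi>] f_the_inv_into_f_bij_betw[OF \<phi>(1)]
    by (simp_all add: \<psi>_def)
  then show ?thesis
    unfolding isomorphic_def using \<psi> \<phi>(2,3) by (intro exI[of _ \<psi>]) metis
qed

lemma isomorphic_trans: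
  assumes "isomorphic \<Gamma> \<Gamma>'" "isomorphic \<Gamma>' \<Gamma>''"
  shows "isomorphic \<Gamma> \<Gamma>''"
proof -
  obtain \<phi> \<psi> where \<phi>: "graph_isomorphism \<phi> \<Gamma> \<Gamma>'" and \<psi>: "graph_isomorphism \<psi> \<Gamma>' \<Gamma>''"
    using assms by (auto simp: isomorphic_iff)
  then have "bij_betw (\<psi> \<circ> \<phi>) (verts \<Gamma>) (verts \<Gamma>'')" "\<forall>v\<in>verts \<Gamma>. \<phi> v \<in> verts \<Gamma>'"
    by (auto simp: graph_isomorphism_def intro: bij_betw_trans dest: bij_betwE)
  then have "graph_isomorphism (\<psi> \<circ> \<phi>) \<Gamma> \<Gamma>''"
    using \<phi> \<psi> by (simp add: graph_isomorphism_def)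
  then show ?thesis
    by (auto simp: isomorphic_iff)
qed

lemma iso_class_eq: "isomorphic \<Gamma> \<Gamma>' \<Longrightarrow> iso_class \<Gamma> = iso_class \<Gamma>'"
  unfolding iso_class_def using isomorphic_sym isomorphic_trans by blast

lemma
  assumes "\<Gamma> \<in> framed_graphs"
  shows representative_framed: "representative (iso_class \<Gamma>) \<in> framed_graphs"
    and representative_isomorphic: "isomorphic \<Gamma> (representative (iso_class \<Gamma>))"
proof -
  have "\<Gamma> \<in> iso_class \<Gamma>"
    using assms by (simp add: iso_class_def isomorphic_refl)
  then have "representative (iso_class \<Gamma>) \<in> iso_class \<Gamma>"
    unfolding representative_def by (rule someI)
  then show "representative (iso_class \<Gamma>) \<in> framed_graphs"
    "isomorphic \<Gamma> (representative (iso_class \<Gamma>))"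
    by (auto simp: iso_class_def)
qed

section \<open>Vertices, adjacency and framing of the constructed graphs\<close>

lemma verts_simps [simp]:
  "verts (erase_edge \<Gamma> u v) = verts \<Gamma>" "verts (slide \<Gamma> u v) = verts \<Gamma>"
  "verts (induced_subgraph \<Gamma> I) = I" "verts empty_graph = {}"
  "verts (disjoint_union \<Gamma> \<Gamma>') = (\<lambda>n. 2 * n) ` verts \<Gamma> \<union> (\<lambda>n. 2 * n + 1) ` verts \<Gamma>'"
  by (simp_all add: erase_edge_def slide_def induced_subgraph_def empty_graph_def
      disjoint_union_def Let_def)

lemma framing_simps [simp]:
  "framing (erase_edge \<Gamma> u v) = framing \<Gamma>"
  "framing (slide \<Gamma> u v) = (framing \<Gamma>)(u := framing \<Gamma> u + framing \<Gamma> v)"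
  "framing (induced_subgraph \<Gamma> I) = framing \<Gamma>"
  "framing (disjoint_union \<Gamma> \<Gamma>') (2 * n) = framing \<Gamma> n"
  "framing (disjoint_union \<Gamma> \<Gamma>') (Suc (2 * n)) = framing \<Gamma>' n"
  by (simp_all add: erase_edge_def slide_def induced_subgraph_def disjoint_union_def Let_def)

lemma edge_erase [simp]:
  "{a, b} \<in> edges (erase_edge \<Gamma> u v) \<longleftrightarrow> {a, b} \<in> edges \<Gamma> \<and> {a, b} \<noteq> {u, v}"
  by (simp add: erase_edge_def)

text \<open>The inequality of truth values is an exclusive or: a pair that consists of u and another
  neighbour of v is toggled, all other pairs are kept.\<close>

lemma edge_slide [simp]:
  "{a, b} \<in> edges (slide \<Gamma> u v) \<longleftrightarrow>
     ({a, b} \<in> edges \<Gamma>) \<noteq> (a = u \<and> b \<noteq> u \<and> b \<noteq> v \<and> {v, b} \<in> edges \<Gamma> \<or>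
       b = u \<and> a \<noteq> u \<and> a \<noteq> v \<and> {v, a} \<in> edges \<Gamma>)"
proof -
  have "{a, b} \<in> {{u, w} | w. w \<noteq> u \<and> w \<noteq> v \<and> {v, w} \<in> edges \<Gamma>} \<longleftrightarrow>
      a = u \<and> b \<noteq> u \<and> b \<noteq> v \<and> {v, b} \<in> edges \<Gamma> \<or> b = u \<and> a \<noteq> u \<and> a \<noteq> v \<and> {v, a} \<in> edges \<Gamma>"
    by (auto simp: doubleton_eq_iff)
  then show ?thesis
    unfolding slide_def Let_def by auto
qed

lemma edge_induced [simp]:
  "{a, b} \<in> edges (induced_subgraph \<Gamma> I) \<longleftrightarrow> {a, b} \<in> edges \<Gamma> \<and> a \<in> I \<and> b \<in> I"
  by (auto simp: induced_subgraph_def)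

text \<open>Parity tells the two halves apart. Odd vertices are written \<open>Suc (2 * b)\<close>,
  the form to which the simplifier brings \<open>2 * b + 1\<close>.\<close>

lemma edge_disjoint_union [simp]:
  "{2 * a, 2 * b} \<in> edges (disjoint_union \<Gamma> \<Gamma>') \<longleftrightarrow> {a, b} \<in> edges \<Gamma>"
  "{Suc (2 * a), Suc (2 * b)} \<in> edges (disjoint_union \<Gamma> \<Gamma>') \<longleftrightarrow> {a, b} \<in> edges \<Gamma>'"
  "{2 * a, Suc (2 * b)} \<notin> edges (disjoint_union \<Gamma> \<Gamma>')"
  "{Suc (2 * b), 2 * a} \<notin> edges (disjoint_union \<Gamma> \<Gamma>')"
proof -
  have inj: "inj (\<lambda>n::nat. 2 * n)" "inj (\<lambda>n. Suc (2 * n))"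
    by (simp_all add: inj_on_def)
  have even: "{2 * a, 2 * b} = (\<lambda>n. 2 * n) ` e \<longleftrightarrow> {a, b} = e"
    and odd: "{Suc (2 * a), Suc (2 * b)} = (\<lambda>n. Suc (2 * n)) ` e \<longleftrightarrow> {a, b} = e" for e
    using inj_image_eq_iff[OF inj(1), of "{a, b}" e] inj_image_eq_iff[OF inj(2), of "{a, b}" e]
    by simp_all
  have no_even: "S \<noteq> (\<lambda>n. 2 * n) ` e" if "Suc (2 * x) \<in> S" for S e x
  proof
    assume "S = (\<lambda>n. 2 * n) ` e"
    with that show False
      by (auto simp: Suc_double_not_eq_double)
  qed
  have no_odd: "S \<noteq> (\<lambda>n. Suc (2 * n)) ` e" if "2 * x \<in> S" for S e x
  proof
    assume "S = (\<lambda>n. Suc (2 * n)) ` e"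
    with that show False
      by (auto simp: double_not_eq_Suc_double)
  qed
  have E: "edges (disjoint_union \<Gamma> \<Gamma>') =
      (\<lambda>e. (\<lambda>n. 2 * n) ` e) ` edges \<Gamma> \<union> (\<lambda>e. (\<lambda>n. Suc (2 * n)) ` e) ` edges \<Gamma>'"
    by (simp add: disjoint_union_def)
  show "{2 * a, 2 * b} \<in> edges (disjoint_union \<Gamma> \<Gamma>') \<longleftrightarrow> {a, b} \<in> edges \<Gamma>"
    using no_odd[of a "{2 * a, 2 * b}"] by (simp add: E image_iff even)
  show "{Suc (2 * a), Suc (2 * b)} \<in> edges (disjoint_union \<Gamma> \<Gamma>') \<longleftrightarrow> {a, b} \<in> edges \<Gamma>'"
    using no_even[of a "{Suc (2 * a), Suc (2 * b)}"] by (simp add: E image_iff odd)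
  show "{2 * a, Suc (2 * b)} \<notin> edges (disjoint_union \<Gamma> \<Gamma>')"
    using no_odd[of a "{2 * a, Suc (2 * b)}"] no_even[of b "{2 * a, Suc (2 * b)}"]
    by (simp add: E image_iff)
  then show "{Suc (2 * b), 2 * a} \<notin> edges (disjoint_union \<Gamma> \<Gamma>')"
    by (simp add: insert_commute)
qed

lemma framed_graph_edgeD:
  assumes "\<Gamma> \<in> framed_graphs" "{u, v} \<in> edges \<Gamma>"
  shows "u \<in> verts \<Gamma>" "v \<in> verts \<Gamma>" "u \<noteq> v"
proof -
  have "{u, v} \<subseteq> verts \<Gamma>" "card {u, v} = 2"
    using assms by (auto simp: framed_graphs_def)
  then show "u \<in> verts \<Gamma>" "v \<in> verts \<Gamma>" "u \<noteq> v"
    by auto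
qed

lemma framed_graph_finite: "\<Gamma> \<in> framed_graphs \<Longrightarrow> finite (verts \<Gamma>)"
  by (simp add: framed_graphs_def)

lemma empty_graph_framed: "empty_graph \<in> framed_graphs"
  by (simp add: framed_graphs_def empty_graph_def)

lemma erase_edge_framed: "\<Gamma> \<in> framed_graphs \<Longrightarrow> erase_edge \<Gamma> u v \<in> framed_graphs"
  by (auto simp: framed_graphs_def erase_edge_def)

lemma slide_framed:
  assumes "\<Gamma> \<in> framed_graphs" "{u, v} \<in> edges \<Gamma>"
  shows "slide \<Gamma> u v \<in> framed_graphs"
proof -
  have "e \<subseteq> verts \<Gamma> \<and> card e = 2" if "e \<in> {{u, w} | w. w \<noteq> u \<and> w \<noteq> v \<and> {v, w} \<in> edges \<Gamma>}" for e
    using that framed_graph_edgeD[OF assms] framed_graph_edgeD[OF assms(1)] by auto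
  then show ?thesis
    using assms(1) unfolding slide_def Let_def framed_graphs_def by auto
qed

lemma induced_subgraph_framed:
  "\<Gamma> \<in> framed_graphs \<Longrightarrow> I \<subseteq> verts \<Gamma> \<Longrightarrow> induced_subgraph \<Gamma> I \<in> framed_graphs"
  by (auto simp: framed_graphs_def induced_subgraph_def intro: finite_subset)

lemma disjoint_union_framed:
  assumes "\<Gamma> \<in> framed_graphs" "\<Gamma>' \<in> framed_graphs"
  shows "disjoint_union \<Gamma> \<Gamma>' \<in> framed_graphs"
proof -
  have "card ((\<lambda>n. 2 * n) ` e) = card e" "card ((\<lambda>n. Suc (2 * n)) ` e) = card e" for e :: "nat set"
    by (auto intro!: card_image inj_onI)
  note card = this
  have "e \<subseteq> verts (disjoint_union \<Gamma> \<Gamma>') \<and> card e = 2" if "e \<in> edges (disjoint_union \<Gamma> \<Gamma>')" for e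
  proof -
    consider e' where "e' \<in> edges \<Gamma>" "e = (\<lambda>n. 2 * n) ` e'"
      | e' where "e' \<in> edges \<Gamma>'" "e = (\<lambda>n. Suc (2 * n)) ` e'"
      using \<open>e \<in> edges (disjoint_union \<Gamma> \<Gamma>')\<close> by (auto simp: disjoint_union_def)
    then show ?thesis
    proof cases
      case 1
      then have "e' \<subseteq> verts \<Gamma>" "card e' = 2"
        using assms(1) by (simp_all add: framed_graphs_def)
      then show ?thesis
        unfolding 1(2) card verts_simps by (intro conjI le_supI1 image_mono)
    next
      case 2
      then have "e' \<subseteq> verts \<Gamma>'" "card e' = 2"
        using assms(2) by (simp_all add: framed_graphs_def)
      then show ?thesis
        unfolding 2(2) card verts_simps by (simp add: image_mono le_supI2)
    qed
  qed
  then show ?thesis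
    using assms by (simp add: framed_graphs_def)
qed

section \<open>Isomorphisms between disjoint unions and induced subgraphs\<close>

lemma isomorphic_card: "isomorphic \<Gamma> \<Gamma>' \<Longrightarrow> card (verts \<Gamma>) = card (verts \<Gamma>')"
  by (auto simp: isomorphic_def bij_betw_same_card)

lemma isomorphic_black: "isomorphic \<Gamma> \<Gamma>' \<Longrightarrow> black \<Gamma> \<longleftrightarrow> black \<Gamma>'"
  unfolding isomorphic_def black_def bij_betw_def by (elim exE conjE, erule subst) auto

lemma isomorphic_induced_subgraph:
  assumes "graph_isomorphism \<phi> \<Gamma> \<Gamma>'" "I \<subseteq> verts \<Gamma>"
  shows "isomorphic (induced_subgraph \<Gamma> I) (induced_subgraph \<Gamma>' (\<phi> ` I))"
  unfolding isomorphic_iff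
  using assms by (intro exI[of _ \<phi>])
    (auto simp: graph_isomorphism_def bij_betw_def subset_iff inj_on_def)

lemma induced_subgraph_induced:
  "J \<subseteq> I \<Longrightarrow> induced_subgraph (induced_subgraph \<Gamma> I) J = induced_subgraph \<Gamma> J"
  by (auto simp: induced_subgraph_def)

lemma induced_subgraph_verts: "\<Gamma> \<in> framed_graphs \<Longrightarrow> isomorphic (induced_subgraph \<Gamma> (verts \<Gamma>)) \<Gamma>"
  by (rule isomorphic_identity) auto

lemma isomorphic_empty: "verts \<Gamma> = {} \<Longrightarrow> isomorphic \<Gamma> empty_graph"
  by (rule isomorphic_identity) auto

lemma isomorphic_disjoint_union_right:
  assumes "isomorphic \<Gamma> \<Gamma>'"
  shows "isomorphic (disjoint_union \<Delta> \<Gamma>) (disjoint_union \<Delta> \<Gamma>')"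
proof -
  obtain \<phi> where \<phi>: "graph_isomorphism \<phi> \<Gamma> \<Gamma>'"
    using assms by (auto simp: isomorphic_iff)
  \<comment> \<open>Even vertices belong to \<Delta> and stay fixed; \<phi> acts on the odd
    half.\<close>
  define \<psi> where "\<psi> n = (if even n then n else 2 * \<phi> (n div 2) + 1)" for n
  have \<psi>: "\<psi> (2 * n) = 2 * n" "\<psi> (Suc (2 * n)) = Suc (2 * \<phi> n)" for n
    by (simp_all add: \<psi>_def)
  have im: "\<phi> ` verts \<Gamma> = verts \<Gamma>'" and inj: "inj_on \<phi> (verts \<Gamma>)"
    using \<phi> by (auto simp: graph_isomorphism_def bij_betw_def)
  have "inj_on \<psi> (verts (disjoint_union \<Delta> \<Gamma>))"
    by (rule inj_onI, unfold verts_simps, elim UnE imageE)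
      (simp_all add: \<psi> double_not_eq_Suc_double Suc_double_not_eq_double inj_on_eq_iff[OF inj])
  moreover have "\<psi> ` verts (disjoint_union \<Delta> \<Gamma>) = verts (disjoint_union \<Delta> \<Gamma>')"
    by (simp add: image_Un image_image \<psi> flip: im)
  ultimately have "bij_betw \<psi> (verts (disjoint_union \<Delta> \<Gamma>)) (verts (disjoint_union \<Delta> \<Gamma>'))"
    by (simp only: bij_betw_def)
  then have "graph_isomorphism \<psi> (disjoint_union \<Delta> \<Gamma>) (disjoint_union \<Delta> \<Gamma>')"
    using \<phi> by (auto simp: graph_isomorphism_def \<psi>)
  then show ?thesis
    by (auto simp: isomorphic_iff)
qed

lemma isomorphic_disjoint_union_commute:
  "isomorphic (disjoint_union \<Gamma> \<Gamma>') (disjoint_union \<Gamma>' \<Gamma>)"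
proof -
  \<comment> \<open>Exchanges 2n and 2n + 1.\<close>
  define \<psi> :: "nat \<Rightarrow> nat" where "\<psi> n = (if even n then n + 1 else n - 1)" for n
  have \<psi>: "\<psi> (2 * n) = Suc (2 * n)" "\<psi> (Suc (2 * n)) = 2 * n" for n
    by (simp_all add: \<psi>_def)
  have "bij_betw \<psi> (verts (disjoint_union \<Gamma> \<Gamma>')) (verts (disjoint_union \<Gamma>' \<Gamma>))"
    unfolding bij_betw_def
    by (auto simp: inj_on_def image_Un image_image \<psi> double_not_eq_Suc_double Suc_double_not_eq_double)
  then have "graph_isomorphism \<psi> (disjoint_union \<Gamma> \<Gamma>') (disjoint_union \<Gamma>' \<Gamma>)"
    by (auto simp: graph_isomorphism_def \<psi>)
  then show ?thesis
    by (auto simp: isomorphic_iff)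
qed

lemma isomorphic_disjoint_union_assoc:
  "isomorphic (disjoint_union (disjoint_union \<Gamma> \<Gamma>') \<Gamma>'') (disjoint_union \<Gamma> (disjoint_union \<Gamma>' \<Gamma>''))"
proof -
  \<comment> \<open>The three graphs sit at 4n, 4n + 2 and 2n + 1 in the left union, and at 2n, 4n +
    1 and 4n + 3 in the right one.\<close>
  define \<psi> :: "nat \<Rightarrow> nat" where "\<psi> n =
    (if odd n then 2 * n + 1 else if odd (n div 2) then n - 1 else n div 2)" for n
  have \<psi>: "\<psi> (2 * (2 * n)) = 2 * n" "\<psi> (2 * Suc (2 * n)) = Suc (2 * (2 * n))"
    "\<psi> (Suc (2 * n)) = Suc (2 * Suc (2 * n))" for n
    by (simp_all add: \<psi>_def)
  \<comment> \<open>The simplifier may turn \<open>2 * (2 * n)\<close> into \<open>4 * n\<close>, so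
    this value is kept in both forms.\<close>
  have \<psi>4: "\<psi> (4 * n) = 2 * n" for n
    by (simp add: \<psi>_def)
  \<comment> \<open>The inverse renumbering, which yields injectivity without comparing pairs of
    vertices case by case.\<close>
  define \<chi> :: "nat \<Rightarrow> nat" where "\<chi> n =
    (if even n then 2 * n else if even (n div 2) then n + 1 else n div 2)" for n
  have \<chi>: "\<chi> (2 * n) = 2 * (2 * n)" "\<chi> (Suc (4 * n)) = 2 * Suc (2 * n)"
    "\<chi> (Suc (2 * Suc (2 * n))) = Suc (2 * n)" for n
    by (simp_all add: \<chi>_def)
  have "bij_betw \<psi> (verts (disjoint_union (disjoint_union \<Gamma> \<Gamma>') \<Gamma>''))
     (verts (disjoint_union \<Gamma> (disjoint_union \<Gamma>' \<Gamma>'')))"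
  proof (rule bij_betw_imageI)
    show "inj_on \<psi> (verts (disjoint_union (disjoint_union \<Gamma> \<Gamma>') \<Gamma>''))"
      by (rule inj_on_inverseI[of _ \<chi>]) (auto simp: \<psi> \<psi>4 \<chi> simp del: mult_Suc_right)
    show "\<psi> ` verts (disjoint_union (disjoint_union \<Gamma> \<Gamma>') \<Gamma>'')
        = verts (disjoint_union \<Gamma> (disjoint_union \<Gamma>' \<Gamma>''))"
      by (simp add: image_Un image_image \<psi> \<psi>4 Un_assoc del: mult_Suc_right)
  qed
  then have "graph_isomorphism \<psi> (disjoint_union (disjoint_union \<Gamma> \<Gamma>') \<Gamma>'')
     (disjoint_union \<Gamma> (disjoint_union \<Gamma>' \<Gamma>''))"
    unfolding graph_isomorphism_def verts_simps
    by (intro conjI ballI; (assumption | elim UnE imageE;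
          simp only: edge_disjoint_union framing_simps \<psi> Suc_eq_plus1[symmetric] simp_thms))
  then show ?thesis
    by (auto simp: isomorphic_iff)
qed

text \<open>Only odd vertices occur, and halving restores their old numbers.\<close>

lemma isomorphic_disjoint_union_empty: "isomorphic (disjoint_union empty_graph \<Gamma>) \<Gamma>"
proof -
  have "bij_betw (\<lambda>n. n div 2) (verts (disjoint_union empty_graph \<Gamma>)) (verts \<Gamma>)"
    by (auto simp: bij_betw_def inj_on_def image_image)
  then have "graph_isomorphism (\<lambda>n. n div 2) (disjoint_union empty_graph \<Gamma>) \<Gamma>"
    by (auto simp: graph_isomorphism_def)
  then show ?thesis
    by (auto simp: isomorphic_iff)
qed

lemma black_simps:
  "black empty_graph"
  "black (disjoint_union \<Gamma> \<Gamma>') \<longleftrightarrow> black \<Gamma> \<and> black \<Gamma>'"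
  "black (erase_edge \<Gamma> u v) \<longleftrightarrow> black \<Gamma>"
  by (simp_all add: black_def ball_Un)

text \<open>If v is black, the framing does not change at all. If v is white, it remains white, so
  neither graph is black, whatever happens at u.\<close>

lemma black_slide:
  assumes "v \<in> verts \<Gamma>" "u \<noteq> v"
  shows "black (slide \<Gamma> u v) \<longleftrightarrow> black \<Gamma>"
proof (cases "framing \<Gamma> v = 0")
  case True
  then have "framing (slide \<Gamma> u v) = framing \<Gamma>"
    by (simp only: framing_simps add_0_right fun_upd_triv)
  then show ?thesis
    by (simp only: black_def verts_simps)
next
  case False
  moreover have "framing (slide \<Gamma> u v) v = framing \<Gamma> v"
    using assms(2) by simp
  ultimately show ?thesis
    using assms(1) unfolding black_def verts_simps by metis
qed

section \<open>The moves of the 4T-relation under restriction and disjoint union\<close>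

lemma induced_erase_outside:
  "u \<notin> I \<or> v \<notin> I \<Longrightarrow> isomorphic (induced_subgraph (erase_edge \<Gamma> u v) I) (induced_subgraph \<Gamma> I)"
  by (rule isomorphic_identity) (auto simp: doubleton_eq_iff)

text \<open>A slide alters edges and framing only at u, so removing u undoes it even when v
  stays.\<close>

lemma induced_slide_outside:
  "u \<notin> I \<Longrightarrow> isomorphic (induced_subgraph (slide \<Gamma> u v) I) (induced_subgraph \<Gamma> I)"
  by (rule isomorphic_identity) auto

text \<open>When both ends are kept, restriction commutes with the moves. This and the next two
  lemmas turn a restricted relation into a relation of the induced subgraph.\<close>

lemma induced_erase_inside:
  "u \<in> I \<Longrightarrow> v \<in> I \<Longrightarrow>
   isomorphic (induced_subgraph (erase_edge \<Gamma> u v) I) (erase_edge (induced_subgraph \<Gamma> I) u v)"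
  by (rule isomorphic_identity) auto

lemma induced_slide_inside:
  "u \<in> I \<Longrightarrow> v \<in> I \<Longrightarrow>
   isomorphic (induced_subgraph (slide \<Gamma> u v) I) (slide (induced_subgraph \<Gamma> I) u v)"
  by (rule isomorphic_identity) auto

lemma induced_erase_slide_inside:
  "u \<in> I \<Longrightarrow> v \<in> I \<Longrightarrow> isomorphic (induced_subgraph (erase_edge (slide \<Gamma> u v) u v) I)
     (erase_edge (slide (induced_subgraph \<Gamma> I) u v) u v)"
  by (rule isomorphic_identity) auto

text \<open>Together with the next two lemmas: the disjoint union of \<Delta> with the four graphs
  of a relation gives the four graphs of a relation at the renumbered edge.\<close>

lemma disjoint_union_erase:
  "isomorphic (disjoint_union \<Delta> (erase_edge \<Gamma> u v))
     (erase_edge (disjoint_union \<Delta> \<Gamma>) (Suc (2 * u)) (Suc (2 * v)))"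
  by (rule isomorphic_identity)
    (auto simp: doubleton_eq_iff double_not_eq_Suc_double Suc_double_not_eq_double
      simp del: insert_absorb2 split: if_splits)

lemma disjoint_union_slide:
  "isomorphic (disjoint_union \<Delta> (slide \<Gamma> u v))
     (slide (disjoint_union \<Delta> \<Gamma>) (Suc (2 * u)) (Suc (2 * v)))"
  by (rule isomorphic_identity)
    (auto simp: doubleton_eq_iff double_not_eq_Suc_double Suc_double_not_eq_double
      simp del: insert_absorb2 split: if_splits)

lemma disjoint_union_erase_slide:
  "isomorphic (disjoint_union \<Delta> (erase_edge (slide \<Gamma> u v) u v))
     (erase_edge (slide (disjoint_union \<Delta> \<Gamma>) (Suc (2 * u)) (Suc (2 * v))) (Suc (2 * u)) (Suc (2 * v)))"
  by (rule isomorphic_identity)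
    (auto simp: doubleton_eq_iff double_not_eq_Suc_double Suc_double_not_eq_double
      simp del: insert_absorb2 split: if_splits)

section \<open>Subsets of the vertex set of a disjoint union\<close>

definition union_verts :: "nat set \<Rightarrow> nat set \<Rightarrow> nat set"
  where "union_verts I J = (\<lambda>n. 2 * n) ` I \<union> (\<lambda>n. 2 * n + 1) ` J"

lemma union_verts_mem [simp]:
  "2 * n \<in> union_verts I J \<longleftrightarrow> n \<in> I" "Suc (2 * n) \<in> union_verts I J \<longleftrightarrow> n \<in> J"
  by (auto simp: union_verts_def double_not_eq_Suc_double Suc_double_not_eq_double)

lemma verts_disjoint_union: "verts (disjoint_union \<Gamma> \<Gamma>') = union_verts (verts \<Gamma>) (verts \<Gamma>')"
  by (simp add: union_verts_def)

lemma union_verts_eqI: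
  assumes "\<And>n. 2 * n \<in> K \<longleftrightarrow> n \<in> I" "\<And>n. Suc (2 * n) \<in> K \<longleftrightarrow> n \<in> J"
  shows "K = union_verts I J"
proof (rule Set.set_eqI)
  fix m
  show "m \<in> K \<longleftrightarrow> m \<in> union_verts I J"
  proof (cases "even m")
    case True
    then obtain n where "m = 2 * n" by (rule evenE)
    then show ?thesis using assms(1) by simp
  next
    case False
    then obtain n where "m = Suc (2 * n)" using oddE[of m] by auto
    then show ?thesis using assms(2) by simp
  qed
qed

lemma union_verts_diff: "union_verts A B - union_verts I J = union_verts (A - I) (B - J)"
  by (rule union_verts_eqI) auto

text \<open>Parity splits a subset of the union into one subset of each half. This makes a sum over
  decompositions of a disjoint union a double sum.\<close>

lemma union_verts_bij:
  "bij_betw (\<lambda>(I, J). union_verts I J) (Pow A \<times> Pow B) (Pow (union_verts A B))"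
proof (rule bij_betwI[where g = "\<lambda>K. ({n. 2 * n \<in> K}, {n. Suc (2 * n) \<in> K})"])
  show "(\<lambda>(I, J). union_verts I J) \<in> Pow A \<times> Pow B \<rightarrow> Pow (union_verts A B)"
    by (auto simp: union_verts_def)
  show "(\<lambda>K. ({n. 2 * n \<in> K}, {n. Suc (2 * n) \<in> K})) \<in> Pow (union_verts A B) \<rightarrow> Pow A \<times> Pow B"
    using union_verts_mem by (auto simp: subset_iff)
  show "(case ({n. 2 * n \<in> K}, {n. Suc (2 * n) \<in> K}) of (I, J) \<Rightarrow> union_verts I J) = K" for K
    by (simp flip: union_verts_eqI[of K])
qed auto

lemma induced_disjoint_union:
  "isomorphic (induced_subgraph (disjoint_union \<Gamma> \<Gamma>') (union_verts I J))
     (disjoint_union (induced_subgraph \<Gamma> I) (induced_subgraph \<Gamma>' J))"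
  by (rule isomorphic_identity)
    (auto simp: union_verts_def doubleton_eq_iff double_not_eq_Suc_double Suc_double_not_eq_double)

section \<open>Invariants of graphs\<close>

text \<open>The 4T-expression with an arbitrary function t of graphs in place of basis vectors. The
  relation itself is the case of the free module, and linear maps carry one case to another.\<close>

definition four_term_of ::
  "('k, 'm) ring_scheme \<Rightarrow> ('k, 'w, 'n) module_scheme \<Rightarrow> (framed_graph \<Rightarrow> 'w) \<Rightarrow>
   framed_graph \<Rightarrow> nat \<Rightarrow> nat \<Rightarrow> 'w"
  where
  "four_term_of K W t \<Gamma> u v = (t \<Gamma> \<ominus>\<^bsub>W\<^esub> t (erase_edge \<Gamma> u v)) \<ominus>\<^bsub>W\<^esub>
     (if framing \<Gamma> v = 0 then \<one>\<^bsub>K\<^esub> else \<ominus>\<^bsub>K\<^esub> \<one>\<^bsub>K\<^esub>) \<odot>\<^bsub>W\<^esub>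
       (t (slide \<Gamma> u v) \<ominus>\<^bsub>W\<^esub> t (erase_edge (slide \<Gamma> u v) u v))"

text \<open>The condition under which t descends to a linear map on
  \<open>graph_space K \<A>\<close>.\<close>

definition four_invariant ::
  "('k, 'm) ring_scheme \<Rightarrow> framed_graph set \<Rightarrow> ('k, 'w, 'n) module_scheme \<Rightarrow>
   (framed_graph \<Rightarrow> 'w) \<Rightarrow> bool"
  where
  "four_invariant K \<A> W t \<longleftrightarrow>
     (\<forall>\<Gamma>\<in>\<A>. t \<Gamma> \<in> carrier W) \<and>
     (\<forall>\<Gamma>\<in>\<A>. \<forall>\<Gamma>'\<in>\<A>. isomorphic \<Gamma> \<Gamma>' \<longrightarrow> t \<Gamma> = t \<Gamma>') \<and>
     (\<forall>\<Gamma>\<in>\<A>. \<forall>u v. {u, v} \<in> edges \<Gamma> \<longrightarrow> four_term_of K W t \<Gamma> u v = \<zero>\<^bsub>W\<^esub>)"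

lemma four_invariantI:
  assumes "\<And>\<Gamma>. \<Gamma> \<in> \<A> \<Longrightarrow> t \<Gamma> \<in> carrier W"
    and "\<And>\<Gamma> \<Gamma>'. \<Gamma> \<in> \<A> \<Longrightarrow> \<Gamma>' \<in> \<A> \<Longrightarrow> isomorphic \<Gamma> \<Gamma>' \<Longrightarrow> t \<Gamma> = t \<Gamma>'"
    and "\<And>\<Gamma> u v. \<Gamma> \<in> \<A> \<Longrightarrow> {u, v} \<in> edges \<Gamma> \<Longrightarrow> four_term_of K W t \<Gamma> u v = \<zero>\<^bsub>W\<^esub>"
  shows "four_invariant K \<A> W t"
  using assms unfolding four_invariant_def by blast

lemma four_invariantD:
  assumes "four_invariant K \<A> W t"
  shows "\<Gamma> \<in> \<A> \<Longrightarrow> t \<Gamma> \<in> carrier W"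
    and "\<Gamma> \<in> \<A> \<Longrightarrow> \<Gamma>' \<in> \<A> \<Longrightarrow> isomorphic \<Gamma> \<Gamma>' \<Longrightarrow> t \<Gamma> = t \<Gamma>'"
    and "\<Gamma> \<in> \<A> \<Longrightarrow> {u, v} \<in> edges \<Gamma> \<Longrightarrow> four_term_of K W t \<Gamma> u v = \<zero>\<^bsub>W\<^esub>"
  using assms unfolding four_invariant_def by blast+

context cring
begin

lemma sign_closed: "(if framing \<Gamma> v = 0 then \<one> else \<ominus> \<one>) \<in> carrier R"
  by simp

text \<open>If t does not notice the erased edge, both differences vanish, whatever the sign and
  however the slide acts.\<close>

lemma four_term_of_zero:
  assumes "module R W" "t \<Gamma> \<in> carrier W" "t (slide \<Gamma> u v) \<in> carrier W"
    "t (erase_edge \<Gamma> u v) = t \<Gamma>" "t (erase_edge (slide \<Gamma> u v) u v) = t (slide \<Gamma> u v)"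
  shows "four_term_of R W t \<Gamma> u v = \<zero>\<^bsub>W\<^esub>"
proof -
  interpret W: module R W by fact
  show ?thesis
    using assms(2-) W.smult_r_null[OF sign_closed[of \<Gamma> v]]
    by (simp add: four_term_of_def W.r_neg a_minus_def)
qed

lemma four_term_of_linear:
  assumes "linear_map R V W f" "module R V" "module R W"
    "t \<Gamma> \<in> carrier V" "t (erase_edge \<Gamma> u v) \<in> carrier V" "t (slide \<Gamma> u v) \<in> carrier V"
    "t (erase_edge (slide \<Gamma> u v) u v) \<in> carrier V"
  shows "f (four_term_of R V t \<Gamma> u v) = four_term_of R W (\<lambda>\<Gamma>. f (t \<Gamma>)) \<Gamma> u v"
proof -
  interpret V: module R V by fact
  note f = linear_map_minus[OF assms(1-3)] linear_map_smult[OF assms(1)]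
  show ?thesis
    unfolding four_term_of_def using assms(4-) sign_closed[of \<Gamma> v] by (simp only: f V.minus_closed V.smult_closed)
qed

text \<open>Here the graph is fixed and the argument y varies, so that a relation claimed for all y
  need only be checked for y in a spanning set.\<close>

lemma four_term_of_linear_map:
  assumes "module R W" "linear_map R V W (t \<Gamma>)" "linear_map R V W (t (erase_edge \<Gamma> u v))"
    "linear_map R V W (t (slide \<Gamma> u v))" "linear_map R V W (t (erase_edge (slide \<Gamma> u v) u v))"
  shows "linear_map R V W (\<lambda>y. four_term_of R W (\<lambda>\<Gamma>. t \<Gamma> y) \<Gamma> u v)"
proof -
  interpret W: module R W by fact
  have "linear_map R W W (\<lambda>x. s \<odot>\<^bsub>W\<^esub> x)" if "s \<in> carrier R" for s
    using that
    by (intro linear_mapI) (auto simp: W.smult_r_distr W.smult_assoc1[symmetric] m_comm)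
  note scale = this[OF sign_closed[of \<Gamma> v]]
  show ?thesis
    unfolding four_term_of_def
    by (intro linear_map_diff assms(1) linear_map_comp[OF linear_map_diff[OF assms(4,5,1)] scale]
        assms(2,3))
qed

text \<open>One index set has to serve all four graphs. Decompositions allow this because the moves
  keep the vertex set.\<close>

lemma four_term_of_finsum:
  assumes "module R W" "finite A"
    "\<And>i \<Delta>. i \<in> A \<Longrightarrow> \<Delta> \<in> {\<Gamma>, erase_edge \<Gamma> u v, slide \<Gamma> u v, erase_edge (slide \<Gamma> u v) u v} \<Longrightarrow>
       t i \<Delta> \<in> carrier W"
  shows "four_term_of R W (\<lambda>\<Gamma>. \<Oplus>\<^bsub>W\<^esub>i\<in>A. t i \<Gamma>) \<Gamma> u v = (\<Oplus>\<^bsub>W\<^esub>i\<in>A. four_term_of R W (t i) \<Gamma> u v)"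
proof -
  interpret W: module R W by fact
  have t: "t i \<Gamma> \<in> carrier W" "t i (erase_edge \<Gamma> u v) \<in> carrier W"
    "t i (slide \<Gamma> u v) \<in> carrier W" "t i (erase_edge (slide \<Gamma> u v) u v) \<in> carrier W"
    if "i \<in> A" for i
    using assms(3)[OF that] by simp_all
  define s where "s = (if framing \<Gamma> v = 0 then \<one> else \<ominus> \<one>)"
  have "s \<in> carrier R"
    by (simp add: s_def)
  then show ?thesis
    unfolding four_term_of_def s_def[symmetric] using assms(2) t
    by (simp add: W.finsum_a_minus Pi_def flip: W.finsum_smult_ldistr)
qed

end

text \<open>The closure conditions shared by all framed graphs and by the black ones. A slide is
  only taken along an edge, since otherwise u might not be a vertex and the new edges would leave
  the graph.\<close>

locale graph_family = cring R for R (structure) +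
  fixes \<A> :: "framed_graph set"
  assumes framed: "\<Gamma> \<in> \<A> \<Longrightarrow> \<Gamma> \<in> framed_graphs"
    and isomorphic_closed: "\<Gamma> \<in> \<A> \<Longrightarrow> \<Gamma>' \<in> framed_graphs \<Longrightarrow> isomorphic \<Gamma> \<Gamma>' \<Longrightarrow> \<Gamma>' \<in> \<A>"
    and empty_closed: "empty_graph \<in> \<A>"
    and union_closed: "\<Gamma> \<in> \<A> \<Longrightarrow> \<Gamma>' \<in> \<A> \<Longrightarrow> disjoint_union \<Gamma> \<Gamma>' \<in> \<A>"
    and induced_closed: "\<Gamma> \<in> \<A> \<Longrightarrow> I \<subseteq> verts \<Gamma> \<Longrightarrow> induced_subgraph \<Gamma> I \<in> \<A>"
    and erase_closed: "\<Gamma> \<in> \<A> \<Longrightarrow> erase_edge \<Gamma> u v \<in> \<A>"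
    and slide_closed: "\<Gamma> \<in> \<A> \<Longrightarrow> {u, v} \<in> edges \<Gamma> \<Longrightarrow> slide \<Gamma> u v \<in> \<A>"
begin

abbreviation S where "S \<equiv> graph_space R \<A>"
abbreviation T where "T \<equiv> tensor R S S"
abbreviation G where "G \<equiv> graph_element R \<A>"
abbreviation pure (infixl \<open>\<otimes>\<^sub>S\<close> 70) where "x \<otimes>\<^sub>S y \<equiv> pure_tensor R S S x y"

lemma finite_verts: "\<Gamma> \<in> \<A> \<Longrightarrow> finite (verts \<Gamma>)"
  by (rule framed_graph_finite[OF framed])

lemma four_term_eq:
  "four_term R \<A> \<Gamma> u v =
     four_term_of R (free R (iso_class ` \<A>)) (\<lambda>\<Gamma>. single R (iso_class \<Gamma>)) \<Gamma> u v"
  by (simp add: four_term_def four_term_of_def Let_def)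

lemma single_iso_class_closed: "\<Gamma> \<in> \<A> \<Longrightarrow> single R (iso_class \<Gamma>) \<in> carrier (free R (iso_class ` \<A>))"
  by (intro single_closed imageI)

lemma four_term_relations_closed:
  "four_term_relations R \<A> \<subseteq> carrier (free R (iso_class ` \<A>))"
proof
  fix r assume "r \<in> four_term_relations R \<A>"
  then obtain \<Gamma> u v where r: "\<Gamma> \<in> \<A>" "{u, v} \<in> edges \<Gamma>" "r = four_term R \<A> \<Gamma> u v"
    by (auto simp: four_term_relations_def)
  interpret F: module R "free R (iso_class ` \<A>)" by (rule free_module)
  show "r \<in> carrier (free R (iso_class ` \<A>))"
    unfolding r(3) four_term_eq four_term_of_def using r(1,2)
    by (intro F.minus_closed F.smult_closed sign_closed single_iso_class_closed
        erase_closed slide_closed)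
qed

lemmas relations = four_term_relations_closed

lemma S_module: "module R S"
  unfolding graph_space_def by (rule presented_module[OF relations])

lemma T_module: "module R T"
  by (intro tensor_module S_module)

lemma graph_element_closed: "\<Gamma> \<in> \<A> \<Longrightarrow> G \<Gamma> \<in> carrier S"
  unfolding graph_space_def graph_element_def by (intro generator_closed[OF relations] imageI)

lemma S_spans: "spans R S (G ` \<A>)"
proof -
  have "G ` \<A> = generator R (iso_class ` \<A>) (four_term_relations R \<A>) ` (iso_class ` \<A>)"
    by (simp add: graph_element_def image_image)
  then show ?thesis
    unfolding graph_space_def using presented_spans[OF relations] by simp
qed

lemma graph_element_cong: "isomorphic \<Gamma> \<Gamma>' \<Longrightarrow> G \<Gamma> = G \<Gamma>'"
  by (simp add: graph_element_def iso_class_eq)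

lemma graph_element_invariant: "four_invariant R \<A> S G"
proof (rule four_invariantI)
  fix \<Gamma> u v assume *: "\<Gamma> \<in> \<A>" "{u, v} \<in> edges \<Gamma>"
  then have "four_term R \<A> \<Gamma> u v \<in> four_term_relations R \<A>"
    by (auto simp: four_term_relations_def)
  from projection_relation[OF relations this]
    four_term_of_linear[OF projection_linear[OF relations] free_module presented_module[OF relations]]
  show "four_term_of R S G \<Gamma> u v = \<zero>\<^bsub>S\<^esub>"
    unfolding graph_element_def generator_def graph_space_def four_term_eq
    by (simp add: * single_iso_class_closed erase_closed slide_closed)
qed (simp add: graph_element_closed, rule graph_element_cong)

text \<open>\<open>graph_induced\<close> evaluates g at a chosen representative. Invariance under
  isomorphism makes the choice harmless, and the 4T-condition on g makes its extension kill the
  relations.\<close>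

lemma
  assumes W: "module R W" and g: "four_invariant R \<A> W g"
  shows graph_induced_linear: "linear_map R S W (graph_induced R W g)"
    and graph_induced_element: "\<Gamma> \<in> \<A> \<Longrightarrow> graph_induced R W g (G \<Gamma>) = g \<Gamma>"
proof -
  interpret W: module R W by (rule W)
  let ?h = "\<lambda>c. g (representative c)"
  note gD = four_invariantD[OF g]
  have h: "?h (iso_class \<Gamma>) = g \<Gamma>" if "\<Gamma> \<in> \<A>" for \<Gamma>
    using representative_isomorphic[OF framed[OF that]] representative_framed[OF framed[OF that]]
      gD(2)[OF that] isomorphic_closed[OF that] by metis
  then have h_closed: "?h \<in> iso_class ` \<A> \<rightarrow> carrier W"
    using gD(1) by auto
  note lin = linear_extension_linear[OF W h_closed]
  have ext: "linear_extension R W ?h (single R (iso_class \<Gamma>)) = g \<Gamma>" if "\<Gamma> \<in> \<A>" for \<Gamma>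
    using that h by (simp add: linear_extension_single[OF W h_closed])
  have "linear_extension R W ?h r = \<zero>\<^bsub>W\<^esub>" if r_in: "r \<in> four_term_relations R \<A>" for r
  proof -
    obtain \<Gamma> u v where r: "\<Gamma> \<in> \<A>" "{u, v} \<in> edges \<Gamma>" "r = four_term R \<A> \<Gamma> u v"
      using r_in by (auto simp: four_term_relations_def)
    note cl = r(1) erase_closed[OF r(1)] slide_closed[OF r(1,2)] erase_closed[OF slide_closed[OF r(1,2)]]
    have "linear_extension R W ?h r
        = four_term_of R W (\<lambda>\<Gamma>. linear_extension R W ?h (single R (iso_class \<Gamma>))) \<Gamma> u v"
      unfolding r(3) four_term_eq
      by (intro four_term_of_linear[OF lin free_module W] single_iso_class_closed cl)
    also have "\<dots> = four_term_of R W g \<Gamma> u v"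
      by (simp add: four_term_of_def ext cl)
    finally show ?thesis
      using gD(3)[OF r(1,2)] by simp
  qed
  note ind = relations W h_closed this
  show "linear_map R S W (graph_induced R W g)"
    unfolding graph_space_def graph_induced_def by (rule induced_linear[OF ind])
  show "\<Gamma> \<in> \<A> \<Longrightarrow> graph_induced R W g (G \<Gamma>) = g \<Gamma>"
    unfolding graph_induced_def graph_element_def
    by (subst induced_generator[OF ind]) (auto simp: h)
qed

text \<open>The edge uv becomes the edge between 2u + 1 and 2v + 1 of the union, and v keeps its
  framing, so the sign is the same.\<close>

lemma four_invariant_union_right:
  assumes "\<Delta> \<in> \<A>"
  shows "four_invariant R \<A> S (\<lambda>\<Gamma>. G (disjoint_union \<Delta> \<Gamma>))"
proof (rule four_invariantI)
  fix \<Gamma> u v assume *: "\<Gamma> \<in> \<A>" "{u, v} \<in> edges \<Gamma>"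
  then have "four_term_of R S G (disjoint_union \<Delta> \<Gamma>) (Suc (2 * u)) (Suc (2 * v)) = \<zero>\<^bsub>S\<^esub>"
    using assms union_closed by (intro four_invariantD(3)[OF graph_element_invariant]) auto
  then show "four_term_of R S (\<lambda>\<Gamma>. G (disjoint_union \<Delta> \<Gamma>)) \<Gamma> u v = \<zero>\<^bsub>S\<^esub>"
    by (simp add: four_term_of_def graph_element_cong[OF disjoint_union_erase[of \<Delta> \<Gamma> u v]]
        graph_element_cong[OF disjoint_union_slide[of \<Delta> \<Gamma> u v]]
        graph_element_cong[OF disjoint_union_erase_slide[of \<Delta> \<Gamma> u v]])
qed (simp add: assms graph_element_closed union_closed,
    intro graph_element_cong isomorphic_disjoint_union_right)

text \<open>Commutativity of the disjoint union spares a second calculation with even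
  vertices.\<close>

lemma four_invariant_union_left:
  assumes "\<Delta> \<in> \<A>"
  shows "four_invariant R \<A> S (\<lambda>\<Gamma>. G (disjoint_union \<Gamma> \<Delta>))"
  using four_invariant_union_right[OF assms]
  by (simp add: graph_element_cong[OF isomorphic_disjoint_union_commute[of _ \<Delta>]])

text \<open>The product descends in two stages. For a fixed graph, \<open>N \<Gamma>\<close> is
  induced in the second factor. For fixed y, the function \<open>N \<Gamma> y\<close> of \<Gamma> is
  then induced in the first factor. Linearity in y is explicit only when x is a generator, hence the
  use of \<open>bilinear_mapI_spanning\<close>.\<close>

lemma
  shows graph_mult_linear: "linear_map R T S (graph_mult R \<A>)"
    and graph_mult_pure: "\<Gamma> \<in> \<A> \<Longrightarrow> \<Gamma>' \<in> \<A> \<Longrightarrow>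
      graph_mult R \<A> (G \<Gamma> \<otimes>\<^sub>S G \<Gamma>') = G (disjoint_union \<Gamma> \<Gamma>')"
proof -
  interpret S: module R S by (rule S_module)
  define N where "N \<Gamma> = graph_induced R S (\<lambda>\<Gamma>'. G (disjoint_union \<Gamma> \<Gamma>'))" for \<Gamma>
  have N: "linear_map R S S (N \<Gamma>)" if "\<Gamma> \<in> \<A>" for \<Gamma>
    unfolding N_def by (rule graph_induced_linear[OF S_module four_invariant_union_right[OF that]])
  have NG: "N \<Gamma> (G \<Gamma>') = G (disjoint_union \<Gamma> \<Gamma>')" if "\<Gamma> \<in> \<A>" "\<Gamma>' \<in> \<A>" for \<Gamma> \<Gamma>'
    unfolding N_def using that
    by (simp add: graph_induced_element[OF S_module four_invariant_union_right])
  \<comment> \<open>No formula for \<open>N \<Gamma> y\<close> is available for general y. But both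
    conditions on \<Gamma> are identities between linear maps in y, so it is enough to check them
    for y the class of a graph.\<close>
  have inv: "four_invariant R \<A> S (\<lambda>\<Gamma>. N \<Gamma> y)" if y: "y \<in> carrier S" for y
  proof (rule four_invariantI)
    show "N \<Gamma> y \<in> carrier S" if "\<Gamma> \<in> \<A>" for \<Gamma>
      using linear_map_closed[OF N[OF that] y] .
  next
    fix \<Gamma> \<Gamma>' assume *: "\<Gamma> \<in> \<A>" "\<Gamma>' \<in> \<A>" "isomorphic \<Gamma> \<Gamma>'"
    show "N \<Gamma> y = N \<Gamma>' y"
    proof (rule linear_map_eqI[OF S_spans N[OF *(1)] N[OF *(2)] S_module S_module _ y])
      fix z assume "z \<in> G ` \<A>"
      then obtain \<Delta> where "\<Delta> \<in> \<A>" "z = G \<Delta>"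
        by blast
      then show "N \<Gamma> z = N \<Gamma>' z"
        using four_invariantD(2)[OF four_invariant_union_left *] * by (simp add: NG)
    qed
  next
    fix \<Gamma> u v assume *: "\<Gamma> \<in> \<A>" "{u, v} \<in> edges \<Gamma>"
    note cl = *(1) erase_closed[OF *(1)] slide_closed[OF *] erase_closed[OF slide_closed[OF *]]
    have lin: "linear_map R S S (\<lambda>y. four_term_of R S (\<lambda>\<Gamma>. N \<Gamma> y) \<Gamma> u v)"
      by (intro four_term_of_linear_map S_module N cl)
    have zero: "linear_map R S S (\<lambda>y. \<zero>\<^bsub>S\<^esub>)"
      by (intro linear_mapI) auto
    show "four_term_of R S (\<lambda>\<Gamma>. N \<Gamma> y) \<Gamma> u v = \<zero>\<^bsub>S\<^esub>"
    proof (rule linear_map_eqI[OF S_spans lin zero S_module S_module _ y])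
      fix z assume "z \<in> G ` \<A>"
      then obtain \<Delta> where z: "\<Delta> \<in> \<A>" "z = G \<Delta>"
        by blast
      have "four_term_of R S (\<lambda>\<Gamma>. N \<Gamma> z) \<Gamma> u v
          = four_term_of R S (\<lambda>\<Gamma>. G (disjoint_union \<Gamma> \<Delta>)) \<Gamma> u v"
        using z cl by (simp add: four_term_of_def NG)
      then show "four_term_of R S (\<lambda>\<Gamma>. N \<Gamma> z) \<Gamma> u v = \<zero>\<^bsub>S\<^esub>"
        using four_invariantD(3)[OF four_invariant_union_left[OF z(1)] *] by simp
    qed
  qed
  have "bilinear_map R S S S (\<lambda>x y. graph_induced R S (\<lambda>\<Gamma>. N \<Gamma> y) x)"
  proof (rule bilinear_mapI_spanning[OF S_spans S_module S_module S_module])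
    show "linear_map R S S (graph_induced R S (\<lambda>\<Gamma>. N \<Gamma> y))" if "y \<in> carrier S" for y
      by (rule graph_induced_linear[OF S_module inv[OF that]])
    fix x assume "x \<in> G ` \<A>"
    then obtain \<Gamma> where x: "\<Gamma> \<in> \<A>" "x = G \<Gamma>"
      by blast
    show "linear_map R S S (\<lambda>y. graph_induced R S (\<lambda>\<Gamma>. N \<Gamma> y) x)"
      using x by (intro linear_map_cong[OF N[OF x(1)] S_module])
        (simp add: graph_induced_element[OF S_module inv])
  qed
  note bil = S_module S_module S_module this
  have eq: "graph_mult R \<A> = tensor_lift R S (\<lambda>x y. graph_induced R S (\<lambda>\<Gamma>. N \<Gamma> y) x)"
    by (simp add: graph_mult_def N_def)
  show "linear_map R T S (graph_mult R \<A>)"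
    unfolding eq by (rule tensor_lift_linear[OF bil])
  show "graph_mult R \<A> (G \<Gamma> \<otimes>\<^sub>S G \<Gamma>') = G (disjoint_union \<Gamma> \<Gamma>')" if "\<Gamma> \<in> \<A>" "\<Gamma>' \<in> \<A>"
    unfolding eq using that
    by (simp add: tensor_lift_pure[OF bil] graph_element_closed
        graph_induced_element[OF S_module inv] NG)
qed

text \<open>The moves keep the vertex set, so both differences vanish. \<open>graph_counit\<close>
  does not mention \<open>\<A>\<close>: the same term is the counit of \<G> and of \<H>.\<close>

lemma
  shows graph_counit_linear: "linear_map R S (ground R) (graph_counit R)"
    and graph_counit_element: "\<Gamma> \<in> \<A> \<Longrightarrow>
      graph_counit R (G \<Gamma>) = (if verts \<Gamma> = {} then \<one> else \<zero>)"
proof -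
  interpret K: module R "ground R" by (rule ground_module)
  have inv: "four_invariant R \<A> (ground R) (\<lambda>\<Gamma>. if verts \<Gamma> = {} then \<one> else \<zero>)"
  proof (rule four_invariantI)
    fix \<Gamma> \<Gamma>' assume "isomorphic \<Gamma> \<Gamma>'"
    then have "verts \<Gamma> = {} \<longleftrightarrow> verts \<Gamma>' = {}"
      by (auto simp: isomorphic_def bij_betw_def)
    then show "(if verts \<Gamma> = {} then \<one> else \<zero>) = (if verts \<Gamma>' = {} then \<one> else \<zero>)"
      by simp
  next
    fix \<Gamma> u v assume "\<Gamma> \<in> \<A>" "{u, v} \<in> edges \<Gamma>"
    then show "four_term_of R (ground R) (\<lambda>\<Gamma>. if verts \<Gamma> = {} then \<one> else \<zero>) \<Gamma> u v = \<zero>\<^bsub>ground R\<^esub>"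
      by (intro four_term_of_zero ground_module) (auto simp: ground_simps)
  qed (simp add: ground_simps)
  show "linear_map R S (ground R) (graph_counit R)"
    unfolding graph_counit_def by (rule graph_induced_linear[OF ground_module inv])
  show "graph_counit R (G \<Gamma>) = (if verts \<Gamma> = {} then \<one> else \<zero>)" if "\<Gamma> \<in> \<A>"
    unfolding graph_counit_def using that by (rule graph_induced_element[OF ground_module inv])
qed

lemma
  shows graph_comult_linear: "linear_map R S T (graph_comult R \<A>)"
    and graph_comult_element: "\<Gamma> \<in> \<A> \<Longrightarrow> graph_comult R \<A> (G \<Gamma>) =
      (\<Oplus>\<^bsub>T\<^esub>I\<in>Pow (verts \<Gamma>). G (induced_subgraph \<Gamma> I) \<otimes>\<^sub>S G (induced_subgraph \<Gamma> (verts \<Gamma> - I)))"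
proof -
  interpret S: module R S by (rule S_module)
  interpret T: module R T by (rule T_module)
  note bil = pure_tensor_bilinear[OF S_module S_module]
  let ?t = "\<lambda>I \<Gamma>. G (induced_subgraph \<Gamma> I) \<otimes>\<^sub>S G (induced_subgraph \<Gamma> (verts \<Gamma> - I))"
  have GI: "G (induced_subgraph \<Gamma> I) \<in> carrier S" if "\<Gamma> \<in> \<A>" "I \<subseteq> verts \<Gamma>" for \<Gamma> I
    using that by (intro graph_element_closed induced_closed)
  have tI: "?t I \<Gamma> \<in> carrier T" if "\<Gamma> \<in> \<A>" "I \<subseteq> verts \<Gamma>" for \<Gamma> I
    using that by (intro pure_tensor_closed S_module GI) auto
  have inv: "four_invariant R \<A> T (\<lambda>\<Gamma>. \<Oplus>\<^bsub>T\<^esub>I\<in>Pow (verts \<Gamma>). ?t I \<Gamma>)"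
  proof (rule four_invariantI)
    show "(\<Oplus>\<^bsub>T\<^esub>I\<in>Pow (verts \<Gamma>). ?t I \<Gamma>) \<in> carrier T" if "\<Gamma> \<in> \<A>" for \<Gamma>
      using tI[OF that] by (intro T.finsum_closed) auto
  next
    fix \<Gamma> \<Gamma>' assume *: "\<Gamma> \<in> \<A>" "\<Gamma>' \<in> \<A>" "isomorphic \<Gamma> \<Gamma>'"
    then obtain \<phi> where \<phi>: "graph_isomorphism \<phi> \<Gamma> \<Gamma>'"
      by (auto simp: isomorphic_iff)
    then have bij: "bij_betw \<phi> (verts \<Gamma>) (verts \<Gamma>')"
      by (simp add: graph_isomorphism_def)
    \<comment> \<open>Taking images under \<phi> matches the decompositions of the two
      graphs.\<close>
    have "?t I \<Gamma> = ?t (\<phi> ` I) \<Gamma>'" if "I \<in> Pow (verts \<Gamma>)" for I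
    proof -
      have "\<phi> ` (verts \<Gamma> - I) = verts \<Gamma>' - \<phi> ` I"
        using that bij inj_on_image_set_diff[of \<phi> "verts \<Gamma>" "verts \<Gamma>" I]
        by (auto simp: bij_betw_def)
      then show ?thesis
        using that graph_element_cong[OF isomorphic_induced_subgraph[OF \<phi>]]
        by (metis Diff_subset PowD)
    qed
    then show "(\<Oplus>\<^bsub>T\<^esub>I\<in>Pow (verts \<Gamma>). ?t I \<Gamma>) = (\<Oplus>\<^bsub>T\<^esub>I\<in>Pow (verts \<Gamma>'). ?t I \<Gamma>')"
      using tI[OF *(2)] by (intro T.finsum_bij[OF bij_betw_Pow[OF bij]]) auto
  next
    fix \<Gamma> u v assume *: "\<Gamma> \<in> \<A>" "{u, v} \<in> edges \<Gamma>"
    let ?Q = "{\<Gamma>, erase_edge \<Gamma> u v, slide \<Gamma> u v, erase_edge (slide \<Gamma> u v) u v}"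
    have Q: "\<Delta> \<in> \<A>" "verts \<Delta> = verts \<Gamma>" if "\<Delta> \<in> ?Q" for \<Delta>
      using that * erase_closed slide_closed by auto
    have uv: "u \<in> verts \<Gamma>" "v \<in> verts \<Gamma>"
      using framed_graph_edgeD[OF framed *(2)] * by auto
    have outside: "G (induced_subgraph (erase_edge \<Gamma> u v) I) = G (induced_subgraph \<Gamma> I)"
      "G (induced_subgraph (slide \<Gamma> u v) I) = G (induced_subgraph \<Gamma> I)"
      "G (induced_subgraph (erase_edge (slide \<Gamma> u v) u v) I) = G (induced_subgraph \<Gamma> I)"
      if "u \<notin> I" for I
      using that graph_element_cong[OF induced_erase_outside[of u I v]]
        graph_element_cong[OF induced_slide_outside[of u I]] by simp_all
    have inside: "four_term_of R S (\<lambda>\<Gamma>. G (induced_subgraph \<Gamma> I)) \<Gamma> u v = \<zero>\<^bsub>S\<^esub>"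
      if "u \<in> I" "v \<in> I" "I \<subseteq> verts \<Gamma>" for I
    proof -
      have "four_term_of R S G (induced_subgraph \<Gamma> I) u v = \<zero>\<^bsub>S\<^esub>"
        using that * by (intro four_invariantD(3)[OF graph_element_invariant] induced_closed) auto
      then show ?thesis
        using that by (simp add: four_term_of_def graph_element_cong[OF induced_erase_inside[of u I v \<Gamma>]]
            graph_element_cong[OF induced_slide_inside[of u I v \<Gamma>]]
            graph_element_cong[OF induced_erase_slide_inside[of u I v \<Gamma>]])
    qed
    have summand: "four_term_of R T (?t I) \<Gamma> u v = \<zero>\<^bsub>T\<^esub>" if I: "I \<in> Pow (verts \<Gamma>)" for I
    proof -
      let ?J = "verts \<Gamma> - I"
      have cl: "G (induced_subgraph \<Gamma> K) \<in> carrier S"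
        "G (induced_subgraph (erase_edge \<Gamma> u v) K) \<in> carrier S"
        "G (induced_subgraph (slide \<Gamma> u v) K) \<in> carrier S"
        "G (induced_subgraph (erase_edge (slide \<Gamma> u v) u v) K) \<in> carrier S"
        if "K \<subseteq> verts \<Gamma>" for K
        using that GI[OF Q(1), of _ K] by simp_all
      have sub: "I \<subseteq> verts \<Gamma>" "?J \<subseteq> verts \<Gamma>"
        using I by auto
      consider "u \<in> I" "v \<in> I" | "u \<in> ?J" "v \<in> ?J" | "u \<in> I" "v \<in> ?J" | "u \<in> ?J" "v \<in> I"
        using uv by auto
      then show ?thesis
      proof cases
        case 1
        \<comment> \<open>The factor without u is the same for all four graphs, so the expression is
          the image of a 4T-expression under a linear map in the other factor.\<close>
        let ?f = "\<lambda>x. x \<otimes>\<^sub>S G (induced_subgraph \<Gamma> ?J)"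
        have lin: "linear_map R S T ?f"
          by (intro bilinear_map_left[OF bil] cl sub)
        have "four_term_of R T (?t I) \<Gamma> u v = four_term_of R T (\<lambda>\<Gamma>. ?f (G (induced_subgraph \<Gamma> I))) \<Gamma> u v"
          using 1 outside[of ?J] by (simp add: four_term_of_def)
        also have "\<dots> = ?f (four_term_of R S (\<lambda>\<Gamma>. G (induced_subgraph \<Gamma> I)) \<Gamma> u v)"
          by (intro four_term_of_linear[symmetric] lin S_module T_module cl sub)
        finally show ?thesis
          using inside 1 I linear_map_zero[OF lin S_module T_module] by simp
      next
        case 2
        let ?f = "\<lambda>x. G (induced_subgraph \<Gamma> I) \<otimes>\<^sub>S x"
        have lin: "linear_map R S T ?f"
          by (intro bilinear_map_right[OF bil] cl sub)
        have "four_term_of R T (?t I) \<Gamma> u v = four_term_of R T (\<lambda>\<Gamma>. ?f (G (induced_subgraph \<Gamma> ?J))) \<Gamma> u v"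
          using 2 outside[of I] by (simp add: four_term_of_def)
        also have "\<dots> = ?f (four_term_of R S (\<lambda>\<Gamma>. G (induced_subgraph \<Gamma> ?J)) \<Gamma> u v)"
          by (intro four_term_of_linear[symmetric] lin S_module T_module cl sub)
        finally show ?thesis
          using inside[of ?J] 2 linear_map_zero[OF lin S_module T_module] by simp
      next
        \<comment> \<open>Sliding may change the factor that contains u, so the two differences are
          not compared with each other. Each vanishes by itself, as no factor contains both ends of
          the erased edge.\<close>
        case 3
        then show ?thesis
          using I tI[OF *(1), of I] tI[OF Q(1), of "slide \<Gamma> u v" I] graph_element_cong[OF induced_erase_outside[of u I v]]
            graph_element_cong[OF induced_erase_outside[of u ?J v]]
          by (intro four_term_of_zero T_module) simp_all
      next
        case 4
        then show ?thesis
          using I tI[OF *(1), of I] tI[OF Q(1), of "slide \<Gamma> u v" I] graph_element_cong[OF induced_erase_outside[of u I v]]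
            graph_element_cong[OF induced_erase_outside[of u ?J v]]
          by (intro four_term_of_zero T_module) simp_all
      qed
    qed
    \<comment> \<open>The four vertex sets coincide, so the index set can be frozen at that of
      \<Gamma>.\<close>
    have "four_term_of R T (\<lambda>\<Gamma>. \<Oplus>\<^bsub>T\<^esub>I\<in>Pow (verts \<Gamma>). ?t I \<Gamma>) \<Gamma> u v
        = four_term_of R T (\<lambda>\<Delta>. \<Oplus>\<^bsub>T\<^esub>I\<in>Pow (verts \<Gamma>). ?t I \<Delta>) \<Gamma> u v"
      by (simp add: four_term_of_def)
    also have "\<dots> = (\<Oplus>\<^bsub>T\<^esub>I\<in>Pow (verts \<Gamma>). four_term_of R T (?t I) \<Gamma> u v)"
    proof (rule four_term_of_finsum[OF T_module])
      show "finite (Pow (verts \<Gamma>))"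
        using finite_verts[OF *(1)] by simp
      show "?t I \<Delta> \<in> carrier T" if "I \<in> Pow (verts \<Gamma>)" "\<Delta> \<in> ?Q" for I \<Delta>
        using tI[OF Q(1)[OF that(2)], of I] Q(2)[OF that(2)] that(1) by simp
    qed
    also have "\<dots> = \<zero>\<^bsub>T\<^esub>"
      using summand by (rule T.add.finprod_one_eqI)
    finally show "four_term_of R T (\<lambda>\<Gamma>. \<Oplus>\<^bsub>T\<^esub>I\<in>Pow (verts \<Gamma>). ?t I \<Gamma>) \<Gamma> u v = \<zero>\<^bsub>T\<^esub>" .
  qed
  have eq: "graph_comult R \<A> = graph_induced R T (\<lambda>\<Gamma>. \<Oplus>\<^bsub>T\<^esub>I\<in>Pow (verts \<Gamma>). ?t I \<Gamma>)"
    by (simp add: graph_comult_def Let_def)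
  show "linear_map R S T (graph_comult R \<A>)"
    unfolding eq by (rule graph_induced_linear[OF T_module inv])
  show "graph_comult R \<A> (G \<Gamma>) = (\<Oplus>\<^bsub>T\<^esub>I\<in>Pow (verts \<Gamma>). ?t I \<Gamma>)" if "\<Gamma> \<in> \<A>"
    unfolding eq using that by (rule graph_induced_element[OF T_module inv])
qed

section \<open>The Hopf algebra of graphs\<close>

lemma graph_element_induced_closed:
  "\<Gamma> \<in> \<A> \<Longrightarrow> I \<subseteq> verts \<Gamma> \<Longrightarrow> G (induced_subgraph \<Gamma> I) \<in> carrier S"
  by (intro graph_element_closed induced_closed)

lemma graph_element_induced_verts: "\<Gamma> \<in> \<A> \<Longrightarrow> G (induced_subgraph \<Gamma> (verts \<Gamma>)) = G \<Gamma>"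
  by (intro graph_element_cong induced_subgraph_verts framed)

lemma graph_unit_closed: "graph_unit R \<A> \<in> carrier S"
  unfolding graph_unit_def by (intro graph_element_closed empty_closed)

lemma graph_element_empty: "verts \<Gamma> = {} \<Longrightarrow> G \<Gamma> = graph_unit R \<A>"
  unfolding graph_unit_def by (intro graph_element_cong isomorphic_empty)

lemma S_eqI:
  assumes "module R W" "linear_map R S W f" "linear_map R S W g"
    "\<And>\<Gamma>. \<Gamma> \<in> \<A> \<Longrightarrow> f (G \<Gamma>) = g (G \<Gamma>)" "x \<in> carrier S"
  shows "f x = g x"
  by (rule linear_map_eqI[OF S_spans assms(2,3) S_module assms(1) _ assms(5)]) (use assms(4) in blast)

lemma T_eqI:
  assumes "module R W" "linear_map R T W f" "linear_map R T W g"
    "\<And>\<Gamma> \<Gamma>'. \<Gamma> \<in> \<A> \<Longrightarrow> \<Gamma>' \<in> \<A> \<Longrightarrow> f (G \<Gamma> \<otimes>\<^sub>S G \<Gamma>') = g (G \<Gamma> \<otimes>\<^sub>S G \<Gamma>')" "t \<in> carrier T"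
  shows "f t = g t"
  by (rule tensor_eqI[OF S_module S_module assms(1) S_spans S_spans assms(2,3) _ assms(5)])
    (use assms(4) in blast)

lemma graph_mult_bilinear: "bilinear_map R S S S (\<lambda>x y. graph_mult R \<A> (x \<otimes>\<^sub>S y))"
  by (rule linear_map_comp_bilinear[OF pure_tensor_bilinear[OF S_module S_module] graph_mult_linear])

text \<open>Written with \<open>swap_map\<close>, the exchange becomes an identity of linear maps on
  T, which can be tested on graphs.\<close>

lemma graph_mult_commute:
  assumes "x \<in> carrier S" "y \<in> carrier S"
  shows "graph_mult R \<A> (x \<otimes>\<^sub>S y) = graph_mult R \<A> (y \<otimes>\<^sub>S x)"
proof -
  note swap = swap_map_linear[OF S_module S_module] swap_map_pure[OF S_module S_module]
  have "graph_mult R \<A> (swap_map R S S (x \<otimes>\<^sub>S y)) = graph_mult R \<A> (x \<otimes>\<^sub>S y)"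
    by (rule T_eqI[OF S_module linear_map_comp[OF swap(1) graph_mult_linear] graph_mult_linear])
      (simp_all add: assms pure_tensor_closed S_module swap graph_element_closed graph_mult_pure
        graph_element_cong[OF isomorphic_disjoint_union_commute])
  then show ?thesis
    using assms swap by simp
qed

lemma graph_mult_unit:
  assumes "x \<in> carrier S"
  shows "graph_mult R \<A> (graph_unit R \<A> \<otimes>\<^sub>S x) = x"
    and "graph_mult R \<A> (x \<otimes>\<^sub>S graph_unit R \<A>) = x"
proof -
  show "graph_mult R \<A> (graph_unit R \<A> \<otimes>\<^sub>S x) = x"
    by (rule S_eqI[OF S_module bilinear_map_right[OF graph_mult_bilinear graph_unit_closed]
          linear_map_id[unfolded id_def] _ assms])
      (simp add: graph_unit_def graph_mult_pure empty_closed
        graph_element_cong[OF isomorphic_disjoint_union_empty])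
  then show "graph_mult R \<A> (x \<otimes>\<^sub>S graph_unit R \<A>) = x"
    using graph_mult_commute[OF assms graph_unit_closed] by simp
qed

lemma graph_mult_assoc:
  assumes "t \<in> carrier (tensor R T S)"
  shows "graph_mult R \<A> (tensor_map R S S (graph_mult R \<A>) id t) =
    graph_mult R \<A> (tensor_map R S S id (graph_mult R \<A>) (assoc_map R S S S t))"
proof (rule tensor_eqI[OF T_module S_module S_module tensor_spans[OF S_module S_module S_spans S_spans]
      S_spans _ _ _ assms])
  note left = T_module S_module S_module S_module graph_mult_linear linear_map_id
  note right = S_module T_module S_module S_module linear_map_id graph_mult_linear
  note assoc = S_module S_module S_module
  show "linear_map R (tensor R T S) S (\<lambda>t. graph_mult R \<A> (tensor_map R S S (graph_mult R \<A>) id t))"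
    by (rule linear_map_comp[OF tensor_map_linear[OF left] graph_mult_linear])
  show "linear_map R (tensor R T S) S
      (\<lambda>t. graph_mult R \<A> (tensor_map R S S id (graph_mult R \<A>) (assoc_map R S S S t)))"
    by (rule linear_map_comp[OF linear_map_comp[OF assoc_map_linear[OF assoc]
            tensor_map_linear[OF right]] graph_mult_linear])
  fix p z assume "p \<in> case_prod pure ` (G ` \<A> \<times> G ` \<A>)" "z \<in> G ` \<A>"
  then obtain \<Gamma> \<Gamma>' \<Gamma>'' where *: "p = G \<Gamma> \<otimes>\<^sub>S G \<Gamma>'" "z = G \<Gamma>''" "\<Gamma> \<in> \<A>" "\<Gamma>' \<in> \<A>" "\<Gamma>'' \<in> \<A>"
    by auto
  then show "graph_mult R \<A> (tensor_map R S S (graph_mult R \<A>) id (pure_tensor R T S p z)) =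
      graph_mult R \<A> (tensor_map R S S id (graph_mult R \<A>) (assoc_map R S S S (pure_tensor R T S p z)))"
    by (simp add: tensor_map_pure[OF left] tensor_map_pure[OF right] assoc_map_pure[OF assoc]
        graph_element_closed pure_tensor_closed S_module graph_mult_pure union_closed
        graph_element_cong[OF isomorphic_disjoint_union_assoc])
qed

text \<open>The common computation behind the counit and coassociativity laws, convolution and the
  coaction: two maps applied to the parts of every decomposition.\<close>

lemma tensor_map_comult:
  assumes mods: "module R V" "module R W" and f: "linear_map R S V f" and g: "linear_map R S W g"
    and "\<Gamma> \<in> \<A>"
  shows "tensor_map R V W f g (graph_comult R \<A> (G \<Gamma>)) =
    (\<Oplus>\<^bsub>tensor R V W\<^esub>I\<in>Pow (verts \<Gamma>). pure_tensor R V W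
       (f (G (induced_subgraph \<Gamma> I))) (g (G (induced_subgraph \<Gamma> (verts \<Gamma> - I)))))"
proof -
  interpret VW: module R "tensor R V W" using mods by (rule tensor_module)
  note tm = S_module S_module mods f g
  have cl: "G (induced_subgraph \<Gamma> I) \<otimes>\<^sub>S G (induced_subgraph \<Gamma> (verts \<Gamma> - I)) \<in> carrier T"
    if "I \<subseteq> verts \<Gamma>" for I
    using that assms by (intro pure_tensor_closed S_module graph_element_induced_closed) auto
  have "tensor_map R V W f g (graph_comult R \<A> (G \<Gamma>)) = (\<Oplus>\<^bsub>tensor R V W\<^esub>I\<in>Pow (verts \<Gamma>).
      tensor_map R V W f g (G (induced_subgraph \<Gamma> I) \<otimes>\<^sub>S G (induced_subgraph \<Gamma> (verts \<Gamma> - I))))"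
    unfolding graph_comult_element[OF \<open>\<Gamma> \<in> \<A>\<close>] using cl finite_verts[OF \<open>\<Gamma> \<in> \<A>\<close>]
    by (intro linear_map_finsum[OF tensor_map_linear[OF tm] T_module VW.module_axioms]) auto
  also have "\<dots> = (\<Oplus>\<^bsub>tensor R V W\<^esub>I\<in>Pow (verts \<Gamma>). pure_tensor R V W
       (f (G (induced_subgraph \<Gamma> I))) (g (G (induced_subgraph \<Gamma> (verts \<Gamma> - I)))))"
    using assms(5)
    by (intro VW.finsum_cong' refl)
      (auto simp: tensor_map_pure[OF tm] graph_element_induced_closed
        intro!: pure_tensor_closed[OF mods] linear_map_closed[OF f] linear_map_closed[OF g])
  finally show ?thesis .
qed

lemma linear_map_tensor_map_comult:
  assumes "module R V" "module R W" "linear_map R S V f" "linear_map R S W g"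
  shows "linear_map R S (tensor R V W) (\<lambda>x. tensor_map R V W f g (graph_comult R \<A> x))"
  by (rule linear_map_comp[OF graph_comult_linear tensor_map_linear[OF S_module S_module assms]])

lemma graph_comult_counit:
  assumes "x \<in> carrier S"
  shows "left_unit_map R S (tensor_map R (ground R) S (graph_counit R) id (graph_comult R \<A> x)) = x"
    and "right_unit_map R S (tensor_map R S (ground R) id (graph_counit R) (graph_comult R \<A> x)) = x"
proof -
  interpret S: module R S by (rule S_module)
  note left = ground_module S_module graph_counit_linear linear_map_id
  note right = S_module ground_module linear_map_id graph_counit_linear
  have closed: "graph_counit R (G (induced_subgraph \<Gamma> I)) \<in> carrier R"
      "G (induced_subgraph \<Gamma> I) \<in> carrier S" if "\<Gamma> \<in> \<A>" "I \<subseteq> verts \<Gamma>" for \<Gamma> I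
    using that linear_map_closed[OF graph_counit_linear] graph_element_induced_closed
    by (auto simp: ground_simps)
  show "left_unit_map R S (tensor_map R (ground R) S (graph_counit R) id (graph_comult R \<A> x)) = x"
  proof (rule S_eqI[OF S_module linear_map_comp[OF linear_map_tensor_map_comult[OF left]
          left_unit_map_linear[OF S_module]] linear_map_id[unfolded id_def] _ assms])
    fix \<Gamma> assume \<Gamma>: "\<Gamma> \<in> \<A>"
    have "left_unit_map R S (tensor_map R (ground R) S (graph_counit R) id (graph_comult R \<A> (G \<Gamma>)))
        = (\<Oplus>\<^bsub>S\<^esub>I\<in>Pow (verts \<Gamma>). left_unit_map R S (pure_tensor R (ground R) S
            (graph_counit R (G (induced_subgraph \<Gamma> I))) (G (induced_subgraph \<Gamma> (verts \<Gamma> - I)))))"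
      unfolding tensor_map_comult[OF left \<Gamma>] id_apply using \<Gamma> closed finite_verts[OF \<Gamma>]
      by (intro linear_map_finsum[OF left_unit_map_linear[OF S_module]] tensor_module ground_module S_module)
        (auto intro!: pure_tensor_closed ground_module S_module simp: ground_simps)
    \<comment> \<open>The counit kills every first part except the empty one.\<close>
    also have "\<dots> = (\<Oplus>\<^bsub>S\<^esub>I\<in>Pow (verts \<Gamma>). if I = {} then G \<Gamma> else \<zero>\<^bsub>S\<^esub>)"
      using \<Gamma> closed[OF \<Gamma>] graph_element_closed[OF \<Gamma>]
      by (intro S.finsum_cong' refl)
        (auto simp: left_unit_map_pure[OF S_module] graph_counit_element induced_closed
          graph_element_induced_verts)
    also have "\<dots> = G \<Gamma>"
      using \<Gamma> graph_element_closed[OF \<Gamma>] finite_verts[OF \<Gamma>]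
      by (intro S.add.finprod_singleton_swap) auto
    finally show "left_unit_map R S (tensor_map R (ground R) S (graph_counit R) id
      (graph_comult R \<A> (G \<Gamma>))) = G \<Gamma>" .
  qed
  show "right_unit_map R S (tensor_map R S (ground R) id (graph_counit R) (graph_comult R \<A> x)) = x"
  proof (rule S_eqI[OF S_module linear_map_comp[OF linear_map_tensor_map_comult[OF right]
          right_unit_map_linear[OF S_module]] linear_map_id[unfolded id_def] _ assms])
    fix \<Gamma> assume \<Gamma>: "\<Gamma> \<in> \<A>"
    have "right_unit_map R S (tensor_map R S (ground R) id (graph_counit R) (graph_comult R \<A> (G \<Gamma>)))
        = (\<Oplus>\<^bsub>S\<^esub>I\<in>Pow (verts \<Gamma>). right_unit_map R S (pure_tensor R S (ground R)
            (G (induced_subgraph \<Gamma> I)) (graph_counit R (G (induced_subgraph \<Gamma> (verts \<Gamma> - I))))))"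
      unfolding tensor_map_comult[OF right \<Gamma>] id_apply using \<Gamma> closed finite_verts[OF \<Gamma>]
      by (intro linear_map_finsum[OF right_unit_map_linear[OF S_module]] tensor_module ground_module S_module)
        (auto intro!: pure_tensor_closed ground_module S_module simp: ground_simps)
    also have "\<dots> = (\<Oplus>\<^bsub>S\<^esub>I\<in>Pow (verts \<Gamma>). if I = verts \<Gamma> then G \<Gamma> else \<zero>\<^bsub>S\<^esub>)"
      using \<Gamma> closed[OF \<Gamma>] graph_element_closed[OF \<Gamma>]
      by (intro S.finsum_cong' refl)
        (auto simp: right_unit_map_pure[OF S_module] graph_counit_element induced_closed
          graph_element_induced_verts)
    also have "\<dots> = G \<Gamma>"
      using \<Gamma> graph_element_closed[OF \<Gamma>] finite_verts[OF \<Gamma>]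
      by (intro S.add.finprod_singleton_swap) auto
    finally show "right_unit_map R S (tensor_map R S (ground R) id (graph_counit R)
      (graph_comult R \<A> (G \<Gamma>))) = G \<Gamma>" .
  qed
qed

lemma graph_comult_coassoc:
  assumes "x \<in> carrier S"
  shows "tensor_map R S T id (graph_comult R \<A>) (graph_comult R \<A> x) =
    assoc_map R S S S (tensor_map R T S (graph_comult R \<A>) id (graph_comult R \<A> x))"
proof -
  let ?U = "tensor R S T" and ?U' = "tensor R T S"
  interpret S: module R S by (rule S_module)
  interpret T: module R T by (rule T_module)
  interpret U: module R ?U by (intro tensor_module S_module)
  interpret U': module R ?U' by (intro tensor_module S_module)
  note left = S_module T_module linear_map_id graph_comult_linear
  note right = T_module S_module graph_comult_linear linear_map_id
  note assoc = assoc_map_linear[OF S_module S_module S_module]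
  show ?thesis
  proof (rule S_eqI[OF U.module_axioms linear_map_tensor_map_comult[OF left]
        linear_map_comp[OF linear_map_tensor_map_comult[OF right] assoc] _ assms])
    fix \<Gamma> assume \<Gamma>: "\<Gamma> \<in> \<A>"
    let ?G = "\<lambda>I. G (induced_subgraph \<Gamma> I)" and ?V = "verts \<Gamma>"
    \<comment> \<open>Extension by zero, because \<open>finsum_Pow_coassoc\<close> asks for values
      in the carrier on all triples of sets.\<close>
    define F where "F I = (if I \<subseteq> ?V then ?G I else \<zero>\<^bsub>S\<^esub>)" for I
    have FG: "?G I = F I" if "I \<subseteq> ?V" for I
      using that by (simp add: F_def)
    have F: "F I \<in> carrier S" for I
      using graph_element_induced_closed[OF \<Gamma>] by (simp add: F_def)
    have P: "F I \<otimes>\<^sub>S F J \<in> carrier T" for I J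
      by (intro pure_tensor_closed S_module F)
    have fin: "finite (Pow I)" if "I \<subseteq> ?V" for I
      using that finite_verts[OF \<Gamma>] finite_subset by auto
    have comult: "graph_comult R \<A> (F I) = (\<Oplus>\<^bsub>T\<^esub>J\<in>Pow I. F J \<otimes>\<^sub>S F (I - J))" if "I \<subseteq> ?V" for I
      unfolding FG[OF that, symmetric] graph_comult_element[OF induced_closed[OF \<Gamma> that]]
      using that P
      by (intro T.finsum_cong') (auto simp: induced_subgraph_induced FG subset_iff)
    have "tensor_map R S T id (graph_comult R \<A>) (graph_comult R \<A> (G \<Gamma>))
        = (\<Oplus>\<^bsub>?U\<^esub>I\<in>Pow ?V. \<Oplus>\<^bsub>?U\<^esub>J\<in>Pow (?V - I). pure_tensor R S T (F I) (F J \<otimes>\<^sub>S F (?V - I - J)))"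
      unfolding tensor_map_comult[OF left \<Gamma>] id_apply
    proof (intro U.finsum_cong' refl)
      fix I assume I: "I \<in> Pow ?V"
      have "pure_tensor R S T (F I) (\<Oplus>\<^bsub>T\<^esub>J\<in>Pow (?V - I). F J \<otimes>\<^sub>S F (?V - I - J))
        = (\<Oplus>\<^bsub>?U\<^esub>J\<in>Pow (?V - I). pure_tensor R S T (F I) (F J \<otimes>\<^sub>S F (?V - I - J)))"
        by (intro linear_map_finsum[OF bilinear_map_right[OF pure_tensor_bilinear]]
            S_module T_module U.module_axioms F fin) (auto simp: P)
      then show "pure_tensor R S T (?G I) (graph_comult R \<A> (?G (?V - I)))
        = (\<Oplus>\<^bsub>?U\<^esub>J\<in>Pow (?V - I). pure_tensor R S T (F I) (F J \<otimes>\<^sub>S F (?V - I - J)))"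
        using I by (simp add: FG comult)
    qed (auto intro!: U.finsum_closed pure_tensor_closed S_module T_module F)
    also have "\<dots> = (\<Oplus>\<^bsub>?U\<^esub>M\<in>Pow ?V. \<Oplus>\<^bsub>?U\<^esub>I\<in>Pow M. pure_tensor R S T (F I) (F (M - I) \<otimes>\<^sub>S F (?V - M)))"
      by (intro U.finsum_Pow_coassoc finite_verts[OF \<Gamma>] pure_tensor_closed S_module T_module F)
    also have "\<dots> = (\<Oplus>\<^bsub>?U\<^esub>M\<in>Pow ?V. assoc_map R S S S
        (pure_tensor R T S (graph_comult R \<A> (?G M)) (?G (?V - M))))"
    proof (intro U.finsum_cong' refl)
      fix M assume M: "M \<in> Pow ?V"
      have "assoc_map R S S S (pure_tensor R T S (\<Oplus>\<^bsub>T\<^esub>I\<in>Pow M. F I \<otimes>\<^sub>S F (M - I)) (F (?V - M)))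
          = (\<Oplus>\<^bsub>?U\<^esub>I\<in>Pow M. assoc_map R S S S (pure_tensor R T S (F I \<otimes>\<^sub>S F (M - I)) (F (?V - M))))"
        using M
        by (intro linear_map_finsum[OF linear_map_comp[OF bilinear_map_left[OF pure_tensor_bilinear] assoc]]
            S_module T_module U.module_axioms F fin) (auto simp: P)
      then show "(\<Oplus>\<^bsub>?U\<^esub>I\<in>Pow M. pure_tensor R S T (F I) (F (M - I) \<otimes>\<^sub>S F (?V - M)))
          = assoc_map R S S S (pure_tensor R T S (graph_comult R \<A> (?G M)) (?G (?V - M)))"
        using M by (simp add: FG comult assoc_map_pure S_module F)
    next
      show "(\<lambda>M. assoc_map R S S S (pure_tensor R T S (graph_comult R \<A> (?G M)) (?G (?V - M))))
          \<in> Pow ?V \<rightarrow> carrier ?U"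
        by (auto simp: FG intro!: linear_map_closed[OF assoc] pure_tensor_closed S_module T_module
            linear_map_closed[OF graph_comult_linear] F)
    qed
    also have "\<dots> = assoc_map R S S S (tensor_map R T S (graph_comult R \<A>) id (graph_comult R \<A> (G \<Gamma>)))"
      unfolding tensor_map_comult[OF right \<Gamma>] id_apply
      by (intro linear_map_finsum[OF assoc, symmetric] U.module_axioms U'.module_axioms fin subset_refl)
        (auto simp: FG intro!: pure_tensor_closed S_module T_module linear_map_closed[OF graph_comult_linear] F)
    finally show "tensor_map R S T id (graph_comult R \<A>) (graph_comult R \<A> (G \<Gamma>)) =
      assoc_map R S S S (tensor_map R T S (graph_comult R \<A>) id (graph_comult R \<A> (G \<Gamma>)))" .
  qed
qed

text \<open>Stated for an arbitrary bilinear b, so that it serves both the coproduct of a product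
  and, with the projection built into b, the coaction on a product.\<close>

lemma graph_comult_union:
  assumes \<Gamma>: "\<Gamma> \<in> \<A>" and \<Gamma>': "\<Gamma>' \<in> \<A>"
    and W: "module R W" and b: "bilinear_map R S S W b"
  shows "(\<Oplus>\<^bsub>W\<^esub>K\<in>Pow (verts (disjoint_union \<Gamma> \<Gamma>')).
      b (G (induced_subgraph (disjoint_union \<Gamma> \<Gamma>') K))
        (G (induced_subgraph (disjoint_union \<Gamma> \<Gamma>') (verts (disjoint_union \<Gamma> \<Gamma>') - K))))
    = (\<Oplus>\<^bsub>W\<^esub>I\<in>Pow (verts \<Gamma>). \<Oplus>\<^bsub>W\<^esub>J\<in>Pow (verts \<Gamma>').
        b (G (disjoint_union (induced_subgraph \<Gamma> I) (induced_subgraph \<Gamma>' J)))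
          (G (disjoint_union (induced_subgraph \<Gamma> (verts \<Gamma> - I)) (induced_subgraph \<Gamma>' (verts \<Gamma>' - J)))))"
proof -
  interpret W: module R W by (rule W)
  let ?D = "disjoint_union \<Gamma> \<Gamma>'"
  let ?f = "\<lambda>K. b (G (induced_subgraph ?D K)) (G (induced_subgraph ?D (verts ?D - K)))"
  let ?g = "\<lambda>I J. b (G (disjoint_union (induced_subgraph \<Gamma> I) (induced_subgraph \<Gamma>' J)))
          (G (disjoint_union (induced_subgraph \<Gamma> (verts \<Gamma> - I)) (induced_subgraph \<Gamma>' (verts \<Gamma>' - J))))"
  have f: "?f K \<in> carrier W" if "K \<subseteq> verts ?D" for K
    using that \<Gamma> \<Gamma>'
    by (intro bilinear_map_closed[OF b] graph_element_induced_closed union_closed) auto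
  have g: "?g I J \<in> carrier W" if "I \<subseteq> verts \<Gamma>" "J \<subseteq> verts \<Gamma>'" for I J
    using that \<Gamma> \<Gamma>'
    by (intro bilinear_map_closed[OF b] graph_element_closed induced_closed union_closed) auto
  have "(\<Oplus>\<^bsub>W\<^esub>I\<in>Pow (verts \<Gamma>). \<Oplus>\<^bsub>W\<^esub>J\<in>Pow (verts \<Gamma>'). ?g I J)
      = (\<Oplus>\<^bsub>W\<^esub>p\<in>Pow (verts \<Gamma>) \<times> Pow (verts \<Gamma>'). ?g (fst p) (snd p))"
    using g finite_verts[OF \<Gamma>] finite_verts[OF \<Gamma>'] by (intro W.finsum_Sigma) auto
  also have "\<dots> = (\<Oplus>\<^bsub>W\<^esub>K\<in>Pow (verts ?D). ?f K)"
  proof (rule W.finsum_bij)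
    show "bij_betw (\<lambda>(I, J). union_verts I J) (Pow (verts \<Gamma>) \<times> Pow (verts \<Gamma>')) (Pow (verts ?D))"
      unfolding verts_disjoint_union by (rule union_verts_bij)
    show "?f \<in> Pow (verts ?D) \<rightarrow> carrier W"
      using f by auto
    fix p
    show "?g (fst p) (snd p) = ?f (case p of (I, J) \<Rightarrow> union_verts I J)"
      unfolding verts_disjoint_union
      by (simp add: case_prod_unfold union_verts_diff graph_element_cong[OF induced_disjoint_union])
  qed
  finally show ?thesis
    by simp
qed

lemma graph_comult_mult:
  assumes "t \<in> carrier T"
  shows "graph_comult R \<A> (graph_mult R \<A> t) =
    tensor_map R S S (graph_mult R \<A>) (graph_mult R \<A>)
      (middle_swap_map R S S S S (tensor_map R T T (graph_comult R \<A>) (graph_comult R \<A>) t))"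
proof -
  let ?TT = "tensor R T T"
  let ?m = "graph_mult R \<A>" and ?c = "graph_comult R \<A>" and ?s = "middle_swap_map R S S S S"
  interpret S: module R S by (rule S_module)
  interpret T: module R T by (rule T_module)
  interpret TT: module R ?TT by (intro tensor_module S_module)
  note mm = T_module T_module S_module S_module graph_mult_linear graph_mult_linear
  note cc = S_module S_module T_module T_module graph_comult_linear graph_comult_linear
  note swap = middle_swap_map_linear[OF S_module S_module S_module S_module]
  have lin: "linear_map R ?TT T (\<lambda>t. tensor_map R S S ?m ?m (?s t))"
    by (rule linear_map_comp[OF swap tensor_map_linear[OF mm]])
  \<comment> \<open>As a bilinear map of the two coproducts, the right-hand side lets both sums be
    pulled out at once.\<close>
  have bil: "bilinear_map R T T T (\<lambda>x y. tensor_map R S S ?m ?m (?s (pure_tensor R T T x y)))"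
    by (rule linear_map_comp_bilinear[OF pure_tensor_bilinear[OF T_module T_module] lin])
  show ?thesis
  proof (rule T_eqI[OF T_module linear_map_comp[OF graph_mult_linear graph_comult_linear]
        linear_map_comp[OF tensor_map_linear[OF cc] lin] _ assms])
    fix \<Gamma> \<Gamma>' assume \<Gamma>: "\<Gamma> \<in> \<A>" and \<Gamma>': "\<Gamma>' \<in> \<A>"
    let ?P = "\<lambda>\<Gamma> I. G (induced_subgraph \<Gamma> I) \<otimes>\<^sub>S G (induced_subgraph \<Gamma> (verts \<Gamma> - I))"
    have P: "?P \<Gamma> I \<in> carrier T" if "\<Gamma> \<in> \<A>" "I \<in> Pow (verts \<Gamma>)" for \<Gamma> I
      using that by (intro pure_tensor_closed S_module graph_element_induced_closed) auto
    have summand: "tensor_map R S S ?m ?m (?s (pure_tensor R T T (?P \<Gamma> I) (?P \<Gamma>' J)))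
        = G (disjoint_union (induced_subgraph \<Gamma> I) (induced_subgraph \<Gamma>' J)) \<otimes>\<^sub>S
          G (disjoint_union (induced_subgraph \<Gamma> (verts \<Gamma> - I)) (induced_subgraph \<Gamma>' (verts \<Gamma>' - J)))"
      if "I \<in> Pow (verts \<Gamma>)" "J \<in> Pow (verts \<Gamma>')" for I J
      using that \<Gamma> \<Gamma>'
      by (simp add: middle_swap_map_pure[OF S_module S_module S_module S_module]
          tensor_map_pure[OF mm] pure_tensor_closed S_module graph_element_closed induced_closed
          graph_mult_pure)
    have "?c (?m (G \<Gamma> \<otimes>\<^sub>S G \<Gamma>')) = ?c (G (disjoint_union \<Gamma> \<Gamma>'))"
      using \<Gamma> \<Gamma>' by (simp add: graph_mult_pure)
    also have "\<dots> = (\<Oplus>\<^bsub>T\<^esub>I\<in>Pow (verts \<Gamma>). \<Oplus>\<^bsub>T\<^esub>J\<in>Pow (verts \<Gamma>').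
        G (disjoint_union (induced_subgraph \<Gamma> I) (induced_subgraph \<Gamma>' J)) \<otimes>\<^sub>S
        G (disjoint_union (induced_subgraph \<Gamma> (verts \<Gamma> - I)) (induced_subgraph \<Gamma>' (verts \<Gamma>' - J))))"
      unfolding graph_comult_element[OF union_closed[OF \<Gamma> \<Gamma>']]
      by (rule graph_comult_union[OF \<Gamma> \<Gamma>' T_module pure_tensor_bilinear[OF S_module S_module]])
    also have "\<dots> = (\<Oplus>\<^bsub>T\<^esub>I\<in>Pow (verts \<Gamma>). \<Oplus>\<^bsub>T\<^esub>J\<in>Pow (verts \<Gamma>').
        tensor_map R S S ?m ?m (?s (pure_tensor R T T (?P \<Gamma> I) (?P \<Gamma>' J))))"
      using bilinear_map_closed[OF bil P[OF \<Gamma>] P[OF \<Gamma>']]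
      by (intro T.finsum_cong' refl summand[symmetric] Pi_I T.finsum_closed) auto
    also have "\<dots> = tensor_map R S S ?m ?m (?s (pure_tensor R T T (?c (G \<Gamma>)) (?c (G \<Gamma>'))))"
      unfolding graph_comult_element[OF \<Gamma>] graph_comult_element[OF \<Gamma>']
      using finite_verts[OF \<Gamma>] finite_verts[OF \<Gamma>']
      by (intro bilinear_map_finsum[OF bil, symmetric] T_module P \<Gamma> \<Gamma>') auto
    also have "\<dots> = tensor_map R S S ?m ?m (?s (tensor_map R T T ?c ?c (G \<Gamma> \<otimes>\<^sub>S G \<Gamma>')))"
      using \<Gamma> \<Gamma>' by (simp add: tensor_map_pure[OF cc] graph_element_closed)
    finally show "?c (?m (G \<Gamma> \<otimes>\<^sub>S G \<Gamma>'))
        = tensor_map R S S ?m ?m (?s (tensor_map R T T ?c ?c (G \<Gamma> \<otimes>\<^sub>S G \<Gamma>')))" .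
  qed
qed

lemma graph_comult_unit: "graph_comult R \<A> (graph_unit R \<A>) = graph_unit R \<A> \<otimes>\<^sub>S graph_unit R \<A>"
proof -
  interpret T: module R T by (rule T_module)
  have "G (induced_subgraph empty_graph {}) = graph_unit R \<A>"
    by (rule graph_element_empty) simp
  then show ?thesis
    unfolding graph_unit_def[symmetric]
    by (simp add: graph_comult_element[OF empty_closed, folded graph_unit_def]
        pure_tensor_closed S_module graph_unit_closed)
qed

lemma graph_counit_unit: "graph_counit R (graph_unit R \<A>) = \<one>"
  unfolding graph_unit_def by (simp add: graph_counit_element empty_closed)

lemma graph_counit_mult:
  assumes "t \<in> carrier T"
  shows "graph_counit R (graph_mult R \<A> t) = left_unit_map R (ground R)
    (tensor_map R (ground R) (ground R) (graph_counit R) (graph_counit R) t)"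
proof -
  note counits = S_module S_module ground_module ground_module graph_counit_linear graph_counit_linear
  show ?thesis
    by (rule T_eqI[OF ground_module linear_map_comp[OF graph_mult_linear graph_counit_linear]
          linear_map_comp[OF tensor_map_linear[OF counits] left_unit_map_linear[OF ground_module]] _ assms])
      (auto simp: tensor_map_pure[OF counits] left_unit_map_pure[OF ground_module]
        graph_counit_element graph_mult_pure union_closed graph_element_closed ground_simps)
qed

section \<open>Convolution and the antipode\<close>

definition convolution where
  "convolution f g x = graph_mult R \<A> (tensor_map R S S f g (graph_comult R \<A> x))"

lemma convolution_linear:
  "linear_map R S S f \<Longrightarrow> linear_map R S S g \<Longrightarrow> linear_map R S S (convolution f g)"
  unfolding convolution_def
  by (rule linear_map_comp[OF linear_map_tensor_map_comult[OF S_module S_module] graph_mult_linear])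

lemma convolution_element:
  assumes f: "linear_map R S S f" and g: "linear_map R S S g" and \<Gamma>: "\<Gamma> \<in> \<A>"
  shows "convolution f g (G \<Gamma>) = (\<Oplus>\<^bsub>S\<^esub>I\<in>Pow (verts \<Gamma>). graph_mult R \<A>
    (f (G (induced_subgraph \<Gamma> I)) \<otimes>\<^sub>S g (G (induced_subgraph \<Gamma> (verts \<Gamma> - I)))))"
  unfolding convolution_def tensor_map_comult[OF S_module S_module f g \<Gamma>]
  using finite_verts[OF \<Gamma>]
  by (intro linear_map_finsum[OF graph_mult_linear T_module S_module])
    (auto intro!: pure_tensor_closed S_module linear_map_closed[OF f] linear_map_closed[OF g]
      graph_element_induced_closed[OF \<Gamma>])

text \<open>The neutral element of the convolution product.\<close>

definition counit_unit where
  "counit_unit x = graph_counit R x \<odot>\<^bsub>S\<^esub> graph_unit R \<A>"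

text \<open>Vanishes on the empty graph, so only decompositions into nonempty parts contribute to
  its convolution powers; on a given graph, powers beyond the number of vertices are zero.\<close>

definition reduced where
  "reduced x = x \<ominus>\<^bsub>S\<^esub> counit_unit x"

text \<open>The geometric series for the convolution inverse of
  \<open>id = counit_unit + reduced\<close>, truncated at order \<open>n\<close>.\<close>

primrec antipode_approx where
  "antipode_approx 0 = counit_unit"
| "antipode_approx (Suc n) = (\<lambda>x. counit_unit x \<ominus>\<^bsub>S\<^esub> convolution (antipode_approx n) reduced x)"

lemma counit_unit_linear: "linear_map R S S counit_unit"
  unfolding counit_unit_def
  by (rule linear_map_smult_const[OF graph_counit_linear S_module graph_unit_closed])

lemma reduced_linear: "linear_map R S S reduced"
  unfolding reduced_def
  by (rule linear_map_diff[OF linear_map_id[unfolded id_def] counit_unit_linear S_module])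

lemma antipode_approx_linear: "linear_map R S S (antipode_approx n)"
  by (induction n) (simp_all add: counit_unit_linear linear_map_diff convolution_linear
      reduced_linear S_module)

lemma counit_unit_element:
  assumes "\<Gamma> \<in> \<A>"
  shows "counit_unit (G \<Gamma>) = (if verts \<Gamma> = {} then graph_unit R \<A> else \<zero>\<^bsub>S\<^esub>)"
proof -
  interpret S: module R S by (rule S_module)
  show ?thesis
    using assms graph_unit_closed by (simp add: counit_unit_def graph_counit_element)
qed

lemma reduced_element_empty:
  assumes "\<Gamma> \<in> \<A>" "verts \<Gamma> = {}"
  shows "reduced (G \<Gamma>) = \<zero>\<^bsub>S\<^esub>"
proof -
  interpret S: module R S by (rule S_module)
  show ?thesis
    unfolding reduced_def counit_unit_element[OF assms(1)]
    using assms(2) graph_unit_closed by (simp add: graph_element_empty S.a_minus_zero_iff)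
qed

lemma graph_mult_zero_right: "x \<in> carrier S \<Longrightarrow> graph_mult R \<A> (x \<otimes>\<^sub>S \<zero>\<^bsub>S\<^esub>) = \<zero>\<^bsub>S\<^esub>"
  using linear_map_zero[OF bilinear_map_right[OF graph_mult_bilinear] S_module S_module] by simp

text \<open>In the recursion, the term with I the whole vertex set vanishes, as
  \<open>reduced\<close> kills the empty complement. All other terms involve fewer vertices and are
  covered by the induction hypothesis.\<close>

lemma antipode_approx_Suc:
  assumes "\<Gamma> \<in> \<A>" "card (verts \<Gamma>) \<le> n"
  shows "antipode_approx (Suc n) (G \<Gamma>) = antipode_approx n (G \<Gamma>)"
  using assms
proof (induction n arbitrary: \<Gamma>)
  case 0
  interpret S: module R S by (rule S_module)
  have empty: "verts \<Gamma> = {}"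
    using 0 finite_verts by auto
  have "G (induced_subgraph \<Gamma> {}) \<in> carrier S"
    using 0 by (simp add: graph_element_induced_closed)
  moreover have "reduced (G (induced_subgraph \<Gamma> {})) = \<zero>\<^bsub>S\<^esub>"
    using 0 by (simp add: reduced_element_empty induced_closed)
  ultimately have "convolution counit_unit reduced (G \<Gamma>) = \<zero>\<^bsub>S\<^esub>"
    using 0 empty linear_map_closed[OF counit_unit_linear]
    by (simp add: convolution_element counit_unit_linear reduced_linear graph_mult_zero_right)
  then show ?case
    using linear_map_closed[OF counit_unit_linear graph_element_closed[OF 0(1)]]
    by (simp add: a_minus_def)
next
  case (Suc n)
  interpret S: module R S by (rule S_module)
  note fin = finite_verts[OF Suc.prems(1)]
  let ?t = "\<lambda>n I. graph_mult R \<A> (antipode_approx n (G (induced_subgraph \<Gamma> I)) \<otimes>\<^sub>S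
    reduced (G (induced_subgraph \<Gamma> (verts \<Gamma> - I))))"
  have closed: "?t n I \<in> carrier S" if "I \<in> Pow (verts \<Gamma>)" for n I
    using that Suc.prems(1)
    by (intro bilinear_map_closed[OF graph_mult_bilinear] linear_map_closed[OF antipode_approx_linear]
        linear_map_closed[OF reduced_linear] graph_element_induced_closed) auto
  have "?t (Suc n) I = ?t n I" if I: "I \<in> Pow (verts \<Gamma>)" for I
  proof (cases "I = verts \<Gamma>")
    case True
    then have "reduced (G (induced_subgraph \<Gamma> (verts \<Gamma> - I))) = \<zero>\<^bsub>S\<^esub>"
      using Suc.prems(1) by (intro reduced_element_empty induced_closed) auto
    then show ?thesis
      using I linear_map_closed[OF antipode_approx_linear graph_element_induced_closed[OF Suc.prems(1)]]
      by (simp add: graph_mult_zero_right del: antipode_approx.simps)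
  next
    case False
    then have "card I < card (verts \<Gamma>)"
      using I fin by (intro psubset_card_mono) auto
    then have "antipode_approx (Suc n) (G (induced_subgraph \<Gamma> I)) = antipode_approx n (G (induced_subgraph \<Gamma> I))"
      using I Suc.prems by (intro Suc.IH induced_closed) auto
    then show ?thesis
      by (simp only:)
  qed
  then have "(\<Oplus>\<^bsub>S\<^esub>I\<in>Pow (verts \<Gamma>). ?t (Suc n) I) = (\<Oplus>\<^bsub>S\<^esub>I\<in>Pow (verts \<Gamma>). ?t n I)"
    using closed by (intro S.finsum_cong' refl) auto
  then have "convolution (antipode_approx (Suc n)) reduced (G \<Gamma>)
      = convolution (antipode_approx n) reduced (G \<Gamma>)"
    unfolding convolution_element[OF antipode_approx_linear reduced_linear Suc.prems(1)] .
  then show ?case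
    \<comment> \<open>Each side is unfolded once only; what remains are the two convolutions just
      compared.\<close>
    by (subst (1 2) antipode_approx.simps(2)) (simp only:)
qed

lemma antipode_approx_stable:
  assumes "\<Gamma> \<in> \<A>" "card (verts \<Gamma>) \<le> n"
  shows "antipode_approx n (G \<Gamma>) = antipode_approx (card (verts \<Gamma>)) (G \<Gamma>)"
  using assms(2)
proof (induction n rule: dec_induct)
  case (step n)
  then show ?case
    using antipode_approx_Suc[OF assms(1)] by metis
qed simp

text \<open>The truncation order follows the graph: from its number of vertices on, the
  approximations no longer change.\<close>

definition antipode_map where
  "antipode_map = graph_induced R S (\<lambda>\<Gamma>. antipode_approx (card (verts \<Gamma>)) (G \<Gamma>))"

lemma
  shows antipode_map_linear: "linear_map R S S antipode_map"
    and antipode_map_element: "\<Gamma> \<in> \<A> \<Longrightarrow> card (verts \<Gamma>) \<le> n \<Longrightarrow>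
      antipode_map (G \<Gamma>) = antipode_approx n (G \<Gamma>)"
proof -
  have inv: "four_invariant R \<A> S (\<lambda>\<Gamma>. antipode_approx (card (verts \<Gamma>)) (G \<Gamma>))"
  proof (rule four_invariantI)
    fix \<Gamma> \<Gamma>' assume "isomorphic \<Gamma> \<Gamma>'"
    then show "antipode_approx (card (verts \<Gamma>)) (G \<Gamma>) = antipode_approx (card (verts \<Gamma>')) (G \<Gamma>')"
      by (simp add: isomorphic_card[of \<Gamma> \<Gamma>'] graph_element_cong[of \<Gamma> \<Gamma>'])
  next
    fix \<Gamma> u v assume *: "\<Gamma> \<in> \<A>" "{u, v} \<in> edges \<Gamma>"
    note lin = antipode_approx_linear[of "card (verts \<Gamma>)"]
    have "four_term_of R S (\<lambda>\<Gamma>. antipode_approx (card (verts \<Gamma>)) (G \<Gamma>)) \<Gamma> u v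
        = four_term_of R S (\<lambda>\<Delta>. antipode_approx (card (verts \<Gamma>)) (G \<Delta>)) \<Gamma> u v"
      by (simp add: four_term_of_def)
    also have "\<dots> = antipode_approx (card (verts \<Gamma>)) (four_term_of R S G \<Gamma> u v)"
      using * by (intro four_term_of_linear[OF lin, symmetric] S_module graph_element_closed
          erase_closed slide_closed)
    also have "\<dots> = \<zero>\<^bsub>S\<^esub>"
      using four_invariantD(3)[OF graph_element_invariant *] linear_map_zero[OF lin S_module S_module]
      by simp
    finally show "four_term_of R S (\<lambda>\<Gamma>. antipode_approx (card (verts \<Gamma>)) (G \<Gamma>)) \<Gamma> u v = \<zero>\<^bsub>S\<^esub>" .
  qed (rule linear_map_closed[OF antipode_approx_linear graph_element_closed])
  show "linear_map R S S antipode_map"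
    unfolding antipode_map_def by (rule graph_induced_linear[OF S_module inv])
  show "antipode_map (G \<Gamma>) = antipode_approx n (G \<Gamma>)" if "\<Gamma> \<in> \<A>" "card (verts \<Gamma>) \<le> n"
    unfolding antipode_map_def using that
    by (simp add: graph_induced_element[OF S_module inv] antipode_approx_stable[of \<Gamma> n])
qed

text \<open>Only the decomposition with empty second part survives.\<close>

lemma convolution_counit_unit:
  assumes f: "linear_map R S S f" and x: "x \<in> carrier S"
  shows "convolution f counit_unit x = f x"
proof (rule S_eqI[OF S_module convolution_linear[OF f counit_unit_linear] f _ x])
  interpret S: module R S by (rule S_module)
  fix \<Gamma> assume \<Gamma>: "\<Gamma> \<in> \<A>"
  have cl: "f (G (induced_subgraph \<Gamma> I)) \<in> carrier S" if "I \<subseteq> verts \<Gamma>" for I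
    using that linear_map_closed[OF f graph_element_induced_closed[OF \<Gamma>]] by simp
  have "convolution f counit_unit (G \<Gamma>) = (\<Oplus>\<^bsub>S\<^esub>I\<in>Pow (verts \<Gamma>). if I = verts \<Gamma> then f (G \<Gamma>) else \<zero>\<^bsub>S\<^esub>)"
    unfolding convolution_element[OF f counit_unit_linear \<Gamma>]
    using \<Gamma> cl linear_map_closed[OF f graph_element_closed[OF \<Gamma>]]
    by (intro S.finsum_cong' refl)
      (auto simp: counit_unit_element induced_closed graph_mult_unit graph_mult_zero_right
        graph_element_induced_verts)
  also have "\<dots> = f (G \<Gamma>)"
    using linear_map_closed[OF f graph_element_closed[OF \<Gamma>]] finite_verts[OF \<Gamma>]
    by (intro S.add.finprod_singleton_swap) auto
  finally show "convolution f counit_unit (G \<Gamma>) = f (G \<Gamma>)" .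
qed

text \<open>Splitting the identity into \<open>reduced\<close> and \<open>counit_unit\<close> gives
  f * id = f * \<open>reduced\<close> + f, where * is convolution. By the recursion and its
  stability, f equals \<open>counit_unit\<close> minus f * \<open>reduced\<close> on the graph at
  hand.\<close>

lemma antipode_left:
  assumes "x \<in> carrier S"
  shows "convolution antipode_map id x = counit_unit x"
proof (rule S_eqI[OF S_module convolution_linear[OF antipode_map_linear linear_map_id] counit_unit_linear _ assms])
  interpret S: module R S by (rule S_module)
  fix \<Gamma> assume \<Gamma>: "\<Gamma> \<in> \<A>"
  \<comment> \<open>The order of \<Gamma> suffices for all its induced subgraphs, so the whole sum
    involves a single linear map.\<close>
  define f where "f = antipode_approx (card (verts \<Gamma>))"
  have f: "linear_map R S S f"
    unfolding f_def by (rule antipode_approx_linear)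
  let ?G = "\<lambda>I. G (induced_subgraph \<Gamma> I)" and ?V = "verts \<Gamma>"
  have cl: "?G I \<in> carrier S" "f (?G I) \<in> carrier S" "reduced (?G I) \<in> carrier S"
    "counit_unit (?G I) \<in> carrier S" if "I \<subseteq> ?V" for I
    using graph_element_induced_closed[OF \<Gamma> that] linear_map_closed[OF f]
      linear_map_closed[OF reduced_linear] linear_map_closed[OF counit_unit_linear] by simp_all
  note mult_closed = bilinear_map_closed[OF graph_mult_bilinear]
  have summand: "graph_mult R \<A> (antipode_map (?G I) \<otimes>\<^sub>S id (?G (?V - I))) =
     graph_mult R \<A> (f (?G I) \<otimes>\<^sub>S reduced (?G (?V - I))) \<oplus>\<^bsub>S\<^esub>
     graph_mult R \<A> (f (?G I) \<otimes>\<^sub>S counit_unit (?G (?V - I)))" if I: "I \<in> Pow ?V" for I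
  proof -
    have anti: "antipode_map (?G I) = f (?G I)"
      unfolding f_def using I \<Gamma> finite_verts[OF \<Gamma>]
      by (intro antipode_map_element induced_closed) (auto intro: card_mono)
    have "?G (?V - I) = reduced (?G (?V - I)) \<oplus>\<^bsub>S\<^esub> counit_unit (?G (?V - I))"
      using cl[of "?V - I"] by (simp add: reduced_def a_minus_def S.a_assoc S.l_neg)
    note split = this
    have "graph_mult R \<A> (f (?G I) \<otimes>\<^sub>S (reduced (?G (?V - I)) \<oplus>\<^bsub>S\<^esub> counit_unit (?G (?V - I)))) =
      graph_mult R \<A> (f (?G I) \<otimes>\<^sub>S reduced (?G (?V - I))) \<oplus>\<^bsub>S\<^esub>
      graph_mult R \<A> (f (?G I) \<otimes>\<^sub>S counit_unit (?G (?V - I)))"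
      using I cl by (intro linear_map_add[OF bilinear_map_right[OF graph_mult_bilinear]]) auto
    then show ?thesis
      by (simp only: anti id_apply flip: split)
  qed
  have "convolution antipode_map id (G \<Gamma>) =
     (\<Oplus>\<^bsub>S\<^esub>I\<in>Pow ?V. graph_mult R \<A> (f (?G I) \<otimes>\<^sub>S reduced (?G (?V - I))) \<oplus>\<^bsub>S\<^esub>
       graph_mult R \<A> (f (?G I) \<otimes>\<^sub>S counit_unit (?G (?V - I))))"
    unfolding convolution_element[OF antipode_map_linear linear_map_id \<Gamma>] using cl
    by (intro S.finsum_cong' refl summand Pi_I S.a_closed mult_closed) auto
  also have "\<dots> = convolution f reduced (G \<Gamma>) \<oplus>\<^bsub>S\<^esub> convolution f counit_unit (G \<Gamma>)"
    unfolding convolution_element[OF f reduced_linear \<Gamma>] convolution_element[OF f counit_unit_linear \<Gamma>]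
    using cl by (intro S.finsum_addf Pi_I mult_closed) auto
  also have "\<dots> = convolution f reduced (G \<Gamma>) \<oplus>\<^bsub>S\<^esub> f (G \<Gamma>)"
    using graph_element_closed[OF \<Gamma>] by (simp add: convolution_counit_unit f)
  \<comment> \<open>By stability, f may be replaced by the next approximation, which the recursion
    expresses through f.\<close>
  also have "f (G \<Gamma>) = counit_unit (G \<Gamma>) \<ominus>\<^bsub>S\<^esub> convolution f reduced (G \<Gamma>)"
    using antipode_approx_Suc[OF \<Gamma> order_refl] by (simp add: f_def)
  also have "convolution f reduced (G \<Gamma>) \<oplus>\<^bsub>S\<^esub> (counit_unit (G \<Gamma>) \<ominus>\<^bsub>S\<^esub> convolution f reduced (G \<Gamma>))
      = counit_unit (G \<Gamma>)"
    using linear_map_closed[OF counit_unit_linear graph_element_closed[OF \<Gamma>]]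
      linear_map_closed[OF convolution_linear[OF f reduced_linear] graph_element_closed[OF \<Gamma>]]
    by (simp add: a_minus_def S.a_lcomm S.r_neg)
  finally show "convolution antipode_map id (G \<Gamma>) = counit_unit (G \<Gamma>)" .
qed

text \<open>Passing to complements reverses every decomposition, and the product is commutative. It
  yields the right antipode identity from the left one.\<close>

lemma convolution_commute:
  assumes f: "linear_map R S S f" and g: "linear_map R S S g" and x: "x \<in> carrier S"
  shows "convolution f g x = convolution g f x"
proof (rule S_eqI[OF S_module convolution_linear[OF f g] convolution_linear[OF g f] _ x])
  interpret S: module R S by (rule S_module)
  fix \<Gamma> assume \<Gamma>: "\<Gamma> \<in> \<A>"
  let ?G = "\<lambda>I. G (induced_subgraph \<Gamma> I)" and ?V = "verts \<Gamma>"
  have cl: "f (?G I) \<in> carrier S" "g (?G I) \<in> carrier S" if "I \<subseteq> ?V" for I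
    using graph_element_induced_closed[OF \<Gamma> that] linear_map_closed[OF f]
      linear_map_closed[OF g] by simp_all
  show "convolution f g (G \<Gamma>) = convolution g f (G \<Gamma>)"
    unfolding convolution_element[OF f g \<Gamma>] convolution_element[OF g f \<Gamma>]
  proof (rule S.finsum_bij)
    show "bij_betw (\<lambda>I. ?V - I) (Pow ?V) (Pow ?V)"
      by (rule bij_betwI[where g = "\<lambda>I. ?V - I"]) auto
    show "(\<lambda>I. graph_mult R \<A> (g (?G I) \<otimes>\<^sub>S f (?G (?V - I)))) \<in> Pow ?V \<rightarrow> carrier S"
      using cl by (intro Pi_I bilinear_map_closed[OF graph_mult_bilinear]) auto
    fix I assume "I \<in> Pow ?V"
    then have "?V - (?V - I) = I" "I \<subseteq> ?V"
      by auto
    then show "graph_mult R \<A> (f (?G I) \<otimes>\<^sub>S g (?G (?V - I))) =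
        graph_mult R \<A> (g (?G (?V - I)) \<otimes>\<^sub>S f (?G (?V - (?V - I))))"
      using cl by (simp add: graph_mult_commute)
  qed
qed

lemma graph_hopf_algebra:
  assumes "field R"
  shows "hopf_algebra R S (graph_mult R \<A>) (graph_unit R \<A>) (graph_comult R \<A>) (graph_counit R)"
proof (rule hopf_algebra.intro[OF assms S_module graph_mult_linear graph_unit_closed _ _
      graph_comult_linear graph_counit_linear _ _ _ graph_comult_unit _ graph_counit_unit])
  show "\<exists>A. linear_map R S S A \<and> (\<forall>x\<in>carrier S.
      graph_mult R \<A> (tensor_map R S S A id (graph_comult R \<A> x)) = graph_counit R x \<odot>\<^bsub>S\<^esub> graph_unit R \<A> \<and>
      graph_mult R \<A> (tensor_map R S S id A (graph_comult R \<A> x)) = graph_counit R x \<odot>\<^bsub>S\<^esub> graph_unit R \<A>)"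
    using antipode_map_linear antipode_left convolution_commute[OF antipode_map_linear linear_map_id]
    unfolding convolution_def counit_unit_def by (intro exI[of _ antipode_map]) simp
qed (intro ballI conjI graph_mult_assoc graph_mult_unit graph_comult_coassoc graph_comult_counit
    graph_comult_mult graph_counit_mult; assumption)+

end

section \<open>The two families: all framed graphs and black graphs\<close>

context cring
begin

lemma framed_graph_family: "graph_family R framed_graphs"
  by unfold_locales
    (auto intro: empty_graph_framed disjoint_union_framed induced_subgraph_framed erase_edge_framed
      slide_framed)

lemma black_graph_family: "graph_family R black_graphs"
proof unfold_locales
  show "induced_subgraph \<Gamma> I \<in> black_graphs" if "\<Gamma> \<in> black_graphs" "I \<subseteq> verts \<Gamma>" for \<Gamma> I
    using that by (auto simp: black_graphs_def black_def induced_subgraph_framed)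
  show "slide \<Gamma> u v \<in> black_graphs" if "\<Gamma> \<in> black_graphs" "{u, v} \<in> edges \<Gamma>" for \<Gamma> u v
    using that framed_graph_edgeD[of \<Gamma> u v]
    by (auto simp: black_graphs_def slide_framed black_slide)
qed (auto simp: black_graphs_def black_simps isomorphic_black empty_graph_framed disjoint_union_framed
    erase_edge_framed)

interpretation F: graph_family R framed_graphs
  by (rule framed_graph_family)

interpretation B: graph_family R black_graphs
  by (rule black_graph_family)

section \<open>The Hopf module of framed graphs\<close>

lemma black_graphs_framed: "\<Gamma> \<in> black_graphs \<Longrightarrow> \<Gamma> \<in> framed_graphs"
  and black_graphs_black: "\<Gamma> \<in> black_graphs \<Longrightarrow> black \<Gamma>"
  and black_graphsI: "\<Gamma> \<in> framed_graphs \<Longrightarrow> black \<Gamma> \<Longrightarrow> \<Gamma> \<in> black_graphs"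
  by (simp_all add: black_graphs_def)

text \<open>The relations imposed in \<G> are among those of \<H>, so the invariance of the classes
  in \<H> is inherited by black graphs.\<close>

lemma
  shows black_embedding_linear: "linear_map R (\<G> R) (\<H> R) (black_embedding R)"
    and black_embedding_element: "\<Gamma> \<in> black_graphs \<Longrightarrow>
      black_embedding R (graph_element R black_graphs \<Gamma>) = graph_element R framed_graphs \<Gamma>"
proof -
  have inv: "four_invariant R black_graphs (\<H> R) (graph_element R framed_graphs)"
    using F.graph_element_invariant by (auto simp: four_invariant_def black_graphs_framed)
  show "linear_map R (\<G> R) (\<H> R) (black_embedding R)"
    unfolding black_embedding_def by (rule B.graph_induced_linear[OF F.S_module inv])
  show "\<Gamma> \<in> black_graphs \<Longrightarrow>
      black_embedding R (graph_element R black_graphs \<Gamma>) = graph_element R framed_graphs \<Gamma>"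
    unfolding black_embedding_def by (rule B.graph_induced_element[OF F.S_module inv])
qed

text \<open>The four graphs of a relation are all black or all not black, so the relation is sent to
  a relation of \<G> or term by term to zero.\<close>

lemma
  shows black_projection_linear: "linear_map R (\<H> R) (\<G> R) (black_projection R)"
    and black_projection_element: "\<Gamma> \<in> framed_graphs \<Longrightarrow>
      black_projection R (graph_element R framed_graphs \<Gamma>) =
      (if black \<Gamma> then graph_element R black_graphs \<Gamma> else \<zero>\<^bsub>\<G> R\<^esub>)"
proof -
  interpret G: module R "\<G> R" by (rule B.S_module)
  let ?p = "\<lambda>\<Gamma>. if black \<Gamma> then graph_element R black_graphs \<Gamma> else \<zero>\<^bsub>\<G> R\<^esub>"
  have closed: "?p \<Gamma> \<in> carrier (\<G> R)" if "\<Gamma> \<in> framed_graphs" for \<Gamma>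
    using that by (simp add: black_graphsI B.graph_element_closed)
  have inv: "four_invariant R framed_graphs (\<G> R) ?p"
  proof (rule four_invariantI[OF closed])
    fix \<Gamma> \<Gamma>' assume "isomorphic \<Gamma> \<Gamma>'"
    then show "?p \<Gamma> = ?p \<Gamma>'"
      using isomorphic_black B.graph_element_cong by metis
  next
    fix \<Gamma> u v assume *: "\<Gamma> \<in> framed_graphs" "{u, v} \<in> edges \<Gamma>"
    note uv = framed_graph_edgeD[OF *]
    show "four_term_of R (\<G> R) ?p \<Gamma> u v = \<zero>\<^bsub>\<G> R\<^esub>"
    proof (cases "black \<Gamma>")
      case True
      then have "four_term_of R (\<G> R) (graph_element R black_graphs) \<Gamma> u v = \<zero>\<^bsub>\<G> R\<^esub>"
        using * by (intro four_invariantD(3)[OF B.graph_element_invariant]) (simp_all add: black_graphsI)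
      then show ?thesis
        using True uv by (simp add: four_term_of_def black_slide black_simps del: framing_simps)
    next
      case False
      then show ?thesis
        using uv by (intro four_term_of_zero B.S_module) (simp_all add: black_slide black_simps)
    qed
  qed
  show "linear_map R (\<H> R) (\<G> R) (black_projection R)"
    unfolding black_projection_def by (rule F.graph_induced_linear[OF B.S_module inv])
  show "\<Gamma> \<in> framed_graphs \<Longrightarrow> black_projection R (graph_element R framed_graphs \<Gamma>) = ?p \<Gamma>"
    unfolding black_projection_def by (rule F.graph_induced_element[OF B.S_module inv])
qed

lemma
  shows action_linear: "linear_map R (tensor R (\<G> R) (\<H> R)) (\<H> R) (\<H>_action R)"
    and action_element: "\<Gamma> \<in> black_graphs \<Longrightarrow> \<Gamma>' \<in> framed_graphs \<Longrightarrow>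
      \<H>_action R (pure_tensor R (\<G> R) (\<H> R)
        (graph_element R black_graphs \<Gamma>) (graph_element R framed_graphs \<Gamma>'))
      = graph_element R framed_graphs (disjoint_union \<Gamma> \<Gamma>')"
proof -
  note embed = B.S_module F.S_module F.S_module F.S_module black_embedding_linear linear_map_id
  show "linear_map R (tensor R (\<G> R) (\<H> R)) (\<H> R) (\<H>_action R)"
    unfolding \<H>_action_def comp_def
    by (rule linear_map_comp[OF tensor_map_linear[OF embed] F.graph_mult_linear])
  show "\<H>_action R (pure_tensor R (\<G> R) (\<H> R)
        (graph_element R black_graphs \<Gamma>) (graph_element R framed_graphs \<Gamma>'))
      = graph_element R framed_graphs (disjoint_union \<Gamma> \<Gamma>')"
    if "\<Gamma> \<in> black_graphs" "\<Gamma>' \<in> framed_graphs"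
    unfolding \<H>_action_def comp_def using that
    by (simp add: tensor_map_pure[OF embed] B.graph_element_closed F.graph_element_closed
        black_embedding_element F.graph_mult_pure black_graphs_framed)
qed

lemma black_induced_split:
  assumes "I \<subseteq> verts \<Gamma>"
  shows "black \<Gamma> \<longleftrightarrow> black (induced_subgraph \<Gamma> I) \<and> black (induced_subgraph \<Gamma> (verts \<Gamma> - I))"
  using assms by (auto simp: black_def)

lemma black_projection_comult:
  assumes "x \<in> carrier (\<H> R)"
  shows "tensor_map R (\<G> R) (\<G> R) (black_projection R) (black_projection R)
      (graph_comult R framed_graphs x) = graph_comult R black_graphs (black_projection R x)"
proof (rule F.S_eqI[OF B.T_module _ _ _ assms])
  note pp = B.S_module B.S_module black_projection_linear black_projection_linear
  interpret G: module R "\<G> R" by (rule B.S_module)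
  interpret GG: module R "tensor R (\<G> R) (\<G> R)" by (rule B.T_module)
  note bil = pure_tensor_bilinear[OF B.S_module B.S_module]
  show "linear_map R (\<H> R) (tensor R (\<G> R) (\<G> R)) (\<lambda>x. tensor_map R (\<G> R) (\<G> R)
      (black_projection R) (black_projection R) (graph_comult R framed_graphs x))"
    by (rule F.linear_map_tensor_map_comult[OF pp])
  show "linear_map R (\<H> R) (tensor R (\<G> R) (\<G> R))
      (\<lambda>x. graph_comult R black_graphs (black_projection R x))"
    by (rule linear_map_comp[OF black_projection_linear B.graph_comult_linear])
  fix \<Gamma> assume \<Gamma>: "\<Gamma> \<in> framed_graphs"
  let ?P = "\<lambda>I. black_projection R (graph_element R framed_graphs (induced_subgraph \<Gamma> I))"
  have cl: "?P I \<in> carrier (\<G> R)" if "I \<subseteq> verts \<Gamma>" for I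
    using that by (intro linear_map_closed[OF black_projection_linear]
        F.graph_element_induced_closed \<Gamma>)
  have P: "?P I = (if black (induced_subgraph \<Gamma> I)
      then graph_element R black_graphs (induced_subgraph \<Gamma> I) else \<zero>\<^bsub>\<G> R\<^esub>)" if "I \<subseteq> verts \<Gamma>" for I
    using that \<Gamma> by (simp add: black_projection_element induced_subgraph_framed)
  show "tensor_map R (\<G> R) (\<G> R) (black_projection R) (black_projection R)
      (graph_comult R framed_graphs (graph_element R framed_graphs \<Gamma>))
      = graph_comult R black_graphs (black_projection R (graph_element R framed_graphs \<Gamma>))"
  proof (cases "black \<Gamma>")
    case True
    then have B: "\<Gamma> \<in> black_graphs"
      using \<Gamma> by (simp add: black_graphsI)
    have "black_projection R (graph_element R framed_graphs \<Gamma>) = graph_element R black_graphs \<Gamma>"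
      using True \<Gamma> by (simp add: black_projection_element)
    moreover have "pure_tensor R (\<G> R) (\<G> R) (?P I) (?P (verts \<Gamma> - I))
        = pure_tensor R (\<G> R) (\<G> R) (graph_element R black_graphs (induced_subgraph \<Gamma> I))
            (graph_element R black_graphs (induced_subgraph \<Gamma> (verts \<Gamma> - I)))"
      if "I \<subseteq> verts \<Gamma>" for I
      using that True black_induced_split[OF that] by (simp add: P)
    moreover have "pure_tensor R (\<G> R) (\<G> R) (graph_element R black_graphs (induced_subgraph \<Gamma> I))
            (graph_element R black_graphs (induced_subgraph \<Gamma> (verts \<Gamma> - I)))
        \<in> carrier (tensor R (\<G> R) (\<G> R))" if "I \<subseteq> verts \<Gamma>" for I
      using that B by (intro pure_tensor_closed B.S_module B.graph_element_induced_closed) auto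
    ultimately show ?thesis
      unfolding F.tensor_map_comult[OF pp \<Gamma>]
      by (simp only: B.graph_comult_element[OF B]) (intro GG.finsum_cong' refl; auto)
  next
    case False
    then have "black_projection R (graph_element R framed_graphs \<Gamma>) = \<zero>\<^bsub>\<G> R\<^esub>"
      using \<Gamma> by (simp add: black_projection_element)
    moreover have "pure_tensor R (\<G> R) (\<G> R) (?P I) (?P (verts \<Gamma> - I)) = \<zero>\<^bsub>tensor R (\<G> R) (\<G> R)\<^esub>"
      if I: "I \<in> Pow (verts \<Gamma>)" for I
    proof -
      have "?P I = \<zero>\<^bsub>\<G> R\<^esub> \<or> ?P (verts \<Gamma> - I) = \<zero>\<^bsub>\<G> R\<^esub>"
        using I False black_induced_split[of I \<Gamma>] P[of I] P[of "verts \<Gamma> - I"] by auto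
      then show ?thesis
        using I cl[of I] cl[of "verts \<Gamma> - I"]
          linear_map_zero[OF bilinear_map_left[OF bil] B.S_module B.T_module]
          linear_map_zero[OF bilinear_map_right[OF bil] B.S_module B.T_module] by auto
    qed
    ultimately show ?thesis
      unfolding F.tensor_map_comult[OF pp \<Gamma>]
      using linear_map_zero[OF B.graph_comult_linear B.S_module B.T_module]
      by (simp only: GG.add.finprod_one_eqI)
  qed
qed

text \<open>A graph killed by the projection has a white vertex; it is nonempty, so its counit is
  zero as well.\<close>

lemma black_projection_counit:
  assumes "x \<in> carrier (\<H> R)"
  shows "graph_counit R (black_projection R x) = graph_counit R x"
proof (rule F.S_eqI[OF ground_module linear_map_comp[OF black_projection_linear B.graph_counit_linear]
      F.graph_counit_linear _ assms])
  fix \<Gamma> assume \<Gamma>: "\<Gamma> \<in> framed_graphs"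
  have "graph_counit R \<zero>\<^bsub>\<G> R\<^esub> = \<zero>"
    using linear_map_zero[OF B.graph_counit_linear B.S_module ground_module] by (simp add: ground_simps)
  moreover have "black \<Gamma>" if "verts \<Gamma> = {}"
    using that by (simp add: black_def)
  ultimately show "graph_counit R (black_projection R (graph_element R framed_graphs \<Gamma>))
      = graph_counit R (graph_element R framed_graphs \<Gamma>)"
    using \<Gamma> by (auto simp: black_projection_element F.graph_counit_element B.graph_counit_element
        black_graphsI)
qed

section \<open>The coaction and the comodule axioms\<close>

lemma coaction_eq: "\<H>_coaction R x = tensor_map R (\<G> R) (\<H> R) (black_projection R) id
    (graph_comult R framed_graphs x)"
  by (simp add: \<H>_coaction_def)

lemma coaction_linear: "linear_map R (\<H> R) (tensor R (\<G> R) (\<H> R)) (\<H>_coaction R)"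
  unfolding \<H>_coaction_def comp_def
  by (rule F.linear_map_tensor_map_comult[OF B.S_module F.S_module black_projection_linear linear_map_id])

lemma coaction_counit:
  assumes x: "x \<in> carrier (\<H> R)"
  shows "left_unit_map R (\<H> R) (tensor_map R (ground R) (\<H> R) (graph_counit R) id (\<H>_coaction R x)) = x"
proof -
  have "tensor_map R (ground R) (\<H> R) (graph_counit R) id (\<H>_coaction R x)
      = tensor_map R (ground R) (\<H> R) (graph_counit R) id (graph_comult R framed_graphs x)"
    unfolding coaction_eq
    by (rule tensor_map_compose[where A = "\<H> R" and B = "\<H> R"])
      (use x in \<open>simp_all add: F.S_module B.S_module ground_module black_projection_linear linear_map_id
        B.graph_counit_linear F.graph_counit_linear black_projection_counit
        linear_map_closed[OF F.graph_comult_linear]\<close>)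
  then show ?thesis
    using F.graph_comult_counit(1)[OF x] by simp
qed

text \<open>Both sides come from the twofold coproduct of \<H> by projecting the first two factors.
  On the left the projections are applied factor by factor; naturality of the rebracketing then
  brings them together.\<close>

lemma coaction_coassoc:
  assumes x: "x \<in> carrier (\<H> R)"
  shows "tensor_map R (\<G> R) (tensor R (\<G> R) (\<H> R)) id (\<H>_coaction R) (\<H>_coaction R x) =
    assoc_map R (\<G> R) (\<G> R) (\<H> R)
      (tensor_map R (tensor R (\<G> R) (\<G> R)) (\<H> R) (graph_comult R black_graphs) id (\<H>_coaction R x))"
proof -
  let ?G = "\<G> R" and ?H = "\<H> R"
  let ?GG = "tensor R ?G ?G" and ?GH = "tensor R ?G ?H" and ?HH = "tensor R ?H ?H"
  let ?P = "black_projection R" and ?c = "graph_comult R framed_graphs"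
  note mods = F.S_module B.S_module tensor_module
  have cx: "?c x \<in> carrier ?HH"
    using linear_map_closed[OF F.graph_comult_linear x] .
  have cc: "tensor_map R ?HH ?H ?c id (?c x) \<in> carrier (tensor R ?HH ?H)"
    by (rule linear_map_closed[OF F.linear_map_tensor_map_comult x])
      (intro mods F.graph_comult_linear linear_map_id)+
  have PIlin: "linear_map R ?HH ?GH (tensor_map R ?G ?H ?P id)"
    and PPlin: "linear_map R ?HH ?GG (tensor_map R ?G ?G ?P ?P)"
    by (intro tensor_map_linear mods black_projection_linear linear_map_id)+
  have cP: "linear_map R ?H ?GG (\<lambda>x. graph_comult R black_graphs (?P x))"
    by (rule linear_map_comp[OF black_projection_linear B.graph_comult_linear])
  have "tensor_map R ?G ?GH id (\<H>_coaction R) (\<H>_coaction R x)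
      = tensor_map R ?G ?GH ?P (\<H>_coaction R) (?c x)"
    unfolding coaction_eq[of x]
    by (intro tensor_map_compose[where A = ?H and B = ?H] mods linear_map_id black_projection_linear
        coaction_linear cx) simp_all
  also have "\<dots> = tensor_map R ?G ?GH ?P (tensor_map R ?G ?H ?P id) (tensor_map R ?H ?HH id ?c (?c x))"
    by (intro tensor_map_compose[symmetric, where A = ?H and B = ?H] mods linear_map_id
        black_projection_linear coaction_linear F.graph_comult_linear PIlin cx)
      (simp_all add: coaction_eq)
  also have "\<dots> = tensor_map R ?G ?GH ?P (tensor_map R ?G ?H ?P id)
      (assoc_map R ?H ?H ?H (tensor_map R ?HH ?H ?c id (?c x)))"
    by (simp only: F.graph_comult_coassoc[OF x])
  also have "\<dots> = assoc_map R ?G ?G ?H (tensor_map R ?GG ?H (tensor_map R ?G ?G ?P ?P) id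
      (tensor_map R ?HH ?H ?c id (?c x)))"
    by (intro assoc_map_natural mods black_projection_linear linear_map_id cc)
  \<comment> \<open>Here projecting both parts of the coproduct of \<H> is replaced by the coproduct
    of \<G> of the projection.\<close>
  also have "tensor_map R ?GG ?H (tensor_map R ?G ?G ?P ?P) id (tensor_map R ?HH ?H ?c id (?c x))
      = tensor_map R ?GG ?H (\<lambda>x. graph_comult R black_graphs (?P x)) id (?c x)"
    by (intro tensor_map_compose[where A = ?H and B = ?H] mods linear_map_id
        F.graph_comult_linear PPlin cP cx) (simp_all add: black_projection_comult)
  also have "\<dots> = tensor_map R ?GG ?H (graph_comult R black_graphs) id (\<H>_coaction R x)"
    unfolding coaction_eq[of x]
    by (intro tensor_map_compose[symmetric, where A = ?H and B = ?H] mods linear_map_id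
        black_projection_linear B.graph_comult_linear cP cx) simp_all
  finally show ?thesis .
qed

section \<open>The module axioms and the compatibility of action and coaction\<close>

lemma action_unit:
  assumes "x \<in> carrier (\<H> R)"
  shows "\<H>_action R (pure_tensor R (\<G> R) (\<H> R) (graph_unit R black_graphs) x) = x"
  by (rule F.S_eqI[OF F.S_module linear_map_comp[OF bilinear_map_right[OF
            pure_tensor_bilinear[OF B.S_module F.S_module] B.graph_unit_closed] action_linear]
        linear_map_id[unfolded id_def] _ assms])
    (simp add: graph_unit_def action_element B.empty_closed
      F.graph_element_cong[OF isomorphic_disjoint_union_empty])

lemma action_assoc:
  assumes "t \<in> carrier (tensor R (tensor R (\<G> R) (\<G> R)) (\<H> R))"
  shows "\<H>_action R (tensor_map R (\<G> R) (\<H> R) (graph_mult R black_graphs) id t) =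
    \<H>_action R (tensor_map R (\<G> R) (\<H> R) id (\<H>_action R) (assoc_map R (\<G> R) (\<G> R) (\<H> R) t))"
proof (rule tensor_eqI[OF B.T_module F.S_module F.S_module
      tensor_spans[OF B.S_module B.S_module B.S_spans B.S_spans] F.S_spans _ _ _ assms])
  let ?G = "\<G> R" and ?H = "\<H> R"
  note left = B.T_module F.S_module B.S_module F.S_module B.graph_mult_linear linear_map_id
  note right = B.S_module tensor_module[OF B.S_module F.S_module] B.S_module F.S_module
    linear_map_id action_linear
  note assoc = B.S_module B.S_module F.S_module
  show "linear_map R (tensor R (tensor R ?G ?G) ?H) ?H
      (\<lambda>t. \<H>_action R (tensor_map R ?G ?H (graph_mult R black_graphs) id t))"
    by (rule linear_map_comp[OF tensor_map_linear[OF left] action_linear])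
  show "linear_map R (tensor R (tensor R ?G ?G) ?H) ?H
      (\<lambda>t. \<H>_action R (tensor_map R ?G ?H id (\<H>_action R) (assoc_map R ?G ?G ?H t)))"
    by (rule linear_map_comp[OF linear_map_comp[OF assoc_map_linear[OF assoc]
            tensor_map_linear[OF right]] action_linear])
  fix p z
  assume "p \<in> case_prod (pure_tensor R ?G ?G) `
      (graph_element R black_graphs ` black_graphs \<times> graph_element R black_graphs ` black_graphs)"
    "z \<in> graph_element R framed_graphs ` framed_graphs"
  then obtain \<Gamma> \<Gamma>' \<Gamma>'' where
    "p = pure_tensor R ?G ?G (graph_element R black_graphs \<Gamma>) (graph_element R black_graphs \<Gamma>')"
    "z = graph_element R framed_graphs \<Gamma>''" "\<Gamma> \<in> black_graphs" "\<Gamma>' \<in> black_graphs" "\<Gamma>'' \<in> framed_graphs"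
    by auto
  then show "\<H>_action R (tensor_map R ?G ?H (graph_mult R black_graphs) id
        (pure_tensor R (tensor R ?G ?G) ?H p z)) =
      \<H>_action R (tensor_map R ?G ?H id (\<H>_action R)
        (assoc_map R ?G ?G ?H (pure_tensor R (tensor R ?G ?G) ?H p z)))"
    by (simp add: tensor_map_pure[OF left] tensor_map_pure[OF right] assoc_map_pure[OF assoc]
        B.graph_element_closed F.graph_element_closed pure_tensor_closed B.S_module F.S_module
        B.graph_mult_pure action_element B.union_closed F.union_closed black_graphs_framed
        F.graph_element_cong[OF isomorphic_disjoint_union_assoc])
qed

lemma coaction_action:
  assumes "t \<in> carrier (tensor R (\<G> R) (\<H> R))"
  shows "\<H>_coaction R (\<H>_action R t) =
    tensor_action R (\<G> R) (graph_mult R black_graphs) (graph_comult R black_graphs) (\<H> R) (\<H>_action R)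
      (tensor_map R (\<G> R) (tensor R (\<G> R) (\<H> R)) id (\<H>_coaction R) t)"
proof -
  let ?G = "\<G> R" and ?H = "\<H> R"
  let ?GG = "tensor R ?G ?G" and ?GH = "tensor R ?G ?H"
  let ?b = "graph_element R black_graphs" and ?f = "graph_element R framed_graphs"
  let ?P = "black_projection R" and ?m = "graph_mult R black_graphs" and ?a = "\<H>_action R"
  let ?A = "tensor_action R ?G ?m (graph_comult R black_graphs) ?H ?a"
  note mods = B.S_module F.S_module tensor_module
  interpret G: module R ?G by (rule B.S_module)
  interpret GH: module R ?GH by (intro mods)
  note ids = B.S_module F.S_module B.S_module F.S_module linear_map_id linear_map_id
  note cid = B.S_module tensor_module[OF B.S_module F.S_module] B.T_module
    tensor_module[OF B.S_module F.S_module] B.graph_comult_linear tensor_map_linear[OF ids]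
  note ma = B.T_module tensor_module[OF B.S_module F.S_module] B.S_module F.S_module
    B.graph_mult_linear action_linear
  note swap = B.S_module B.S_module B.S_module F.S_module
  note idd = B.S_module F.S_module B.S_module tensor_module[OF B.S_module F.S_module]
    linear_map_id coaction_linear
  have ms: "linear_map R (tensor R ?GG ?GH) ?GH
      (\<lambda>t. tensor_map R ?G ?H ?m ?a (middle_swap_map R ?G ?G ?G ?H t))"
    by (rule linear_map_comp[OF middle_swap_map_linear[OF swap] tensor_map_linear[OF ma]])
  have A: "linear_map R (tensor R ?G ?GH) ?GH ?A"
    unfolding tensor_action_def comp_def by (rule linear_map_comp[OF tensor_map_linear[OF cid] ms])
  have bil: "bilinear_map R ?GG ?GH ?GH
      (\<lambda>x y. tensor_map R ?G ?H ?m ?a (middle_swap_map R ?G ?G ?G ?H (pure_tensor R ?GG ?GH x y)))"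
    by (rule linear_map_comp_bilinear[OF pure_tensor_bilinear ms]) (intro mods)+
  have Pbil: "bilinear_map R ?H ?H ?GH (\<lambda>x y. pure_tensor R ?G ?H (?P x) (id y))"
    by (rule bilinear_map_comp[OF pure_tensor_bilinear black_projection_linear linear_map_id])
      (intro mods)+
  show ?thesis
  proof (rule tensor_eqI[OF B.S_module F.S_module GH.module_axioms B.S_spans F.S_spans
        linear_map_comp[OF action_linear coaction_linear]
        linear_map_comp[OF tensor_map_linear[OF idd] A] _ assms])
    fix x y assume "x \<in> ?b ` black_graphs" "y \<in> ?f ` framed_graphs"
    then obtain \<Gamma> \<Gamma>' where \<Gamma>: "\<Gamma> \<in> black_graphs" "x = ?b \<Gamma>"
      and \<Gamma>': "\<Gamma>' \<in> framed_graphs" "y = ?f \<Gamma>'"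
      by blast
    note fin = finite_Pow_iff[THEN iffD2, OF B.finite_verts[OF \<Gamma>(1)]]
      finite_Pow_iff[THEN iffD2, OF F.finite_verts[OF \<Gamma>'(1)]]
    let ?L = "\<lambda>I. induced_subgraph \<Gamma> I" and ?R = "\<lambda>J. induced_subgraph \<Gamma>' J"
    let ?B = "\<lambda>I. pure_tensor R ?G ?G (?b (?L I)) (?b (?L (verts \<Gamma> - I)))"
    let ?F = "\<lambda>J. pure_tensor R ?G ?H (?P (?f (?R J))) (?f (?R (verts \<Gamma>' - J)))"
    let ?D = "\<lambda>I J. disjoint_union (?L I) (?R J)"
    have L: "?L I \<in> black_graphs" if "I \<in> Pow (verts \<Gamma>)" for I
      using that \<Gamma> by (intro B.induced_closed) auto
    have R: "?R J \<in> framed_graphs" if "J \<in> Pow (verts \<Gamma>')" for J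
      using that \<Gamma>' by (intro F.induced_closed) auto
    have L': "?L (verts \<Gamma> - I) \<in> black_graphs" and R': "?R (verts \<Gamma>' - J) \<in> framed_graphs" for I J
      using \<Gamma> \<Gamma>' by (auto intro: B.induced_closed F.induced_closed)
    have Pcl: "?P (?f \<Delta>) \<in> carrier ?G" if "\<Delta> \<in> framed_graphs" for \<Delta>
      by (rule linear_map_closed[OF black_projection_linear F.graph_element_closed[OF that]])
    have B: "?B I \<in> carrier ?GG" if "I \<in> Pow (verts \<Gamma>)" for I
      by (intro pure_tensor_closed mods B.graph_element_closed L L' that)
    have F: "?F J \<in> carrier ?GH" if "J \<in> Pow (verts \<Gamma>')" for J
      by (intro pure_tensor_closed mods F.graph_element_closed Pcl R R' that)
    \<comment> \<open>The projection is linear over \<G>, checked on graphs; this handles the first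
      tensor factor of each summand, and the second is the action itself.\<close>
    have mP: "?m (pure_tensor R ?G ?G (?b \<Delta>) (?P (?f \<Delta>'))) = ?P (?f (disjoint_union \<Delta> \<Delta>'))"
      if "\<Delta> \<in> black_graphs" "\<Delta>' \<in> framed_graphs" for \<Delta> \<Delta>'
    proof (cases "black \<Delta>'")
      case True
      then have "\<Delta>' \<in> black_graphs"
        using that(2) by (simp add: black_graphsI)
      then show ?thesis
        using that True by (simp add: black_projection_element F.union_closed black_graphs_framed
            black_graphs_black black_simps B.graph_mult_pure)
    next
      case False
      then show ?thesis
        using that by (simp add: black_projection_element F.union_closed black_graphs_framed
            black_simps B.graph_mult_zero_right B.graph_element_closed)
    qed
    have summand: "tensor_map R ?G ?H ?m ?a (middle_swap_map R ?G ?G ?G ?H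
          (pure_tensor R ?GG ?GH (?B I) (?F J)))
        = pure_tensor R ?G ?H (?P (?f (?D I J))) (id (?f (?D (verts \<Gamma> - I) (verts \<Gamma>' - J))))"
      if "I \<in> Pow (verts \<Gamma>)" "J \<in> Pow (verts \<Gamma>')" for I J
      using L[OF that(1)] L'[of I] R[OF that(2)] R'[of J]
      by (simp add: middle_swap_map_pure[OF swap] tensor_map_pure[OF ma] pure_tensor_closed mods
          B.graph_element_closed F.graph_element_closed Pcl mP action_element)
    have "\<H>_coaction R (?a (pure_tensor R ?G ?H x y)) = \<H>_coaction R (?f (disjoint_union \<Gamma> \<Gamma>'))"
      using \<Gamma> \<Gamma>' by (simp add: action_element)
    also have "\<dots> = (\<Oplus>\<^bsub>?GH\<^esub>I\<in>Pow (verts \<Gamma>). \<Oplus>\<^bsub>?GH\<^esub>J\<in>Pow (verts \<Gamma>').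
        pure_tensor R ?G ?H (?P (?f (?D I J))) (id (?f (?D (verts \<Gamma> - I) (verts \<Gamma>' - J)))))"
      unfolding coaction_eq F.tensor_map_comult[OF B.S_module F.S_module black_projection_linear
          linear_map_id F.union_closed[OF black_graphs_framed[OF \<Gamma>(1)] \<Gamma>'(1)]]
      by (rule F.graph_comult_union[OF black_graphs_framed[OF \<Gamma>(1)] \<Gamma>'(1) GH.module_axioms Pbil])
    also have "\<dots> = (\<Oplus>\<^bsub>?GH\<^esub>I\<in>Pow (verts \<Gamma>). \<Oplus>\<^bsub>?GH\<^esub>J\<in>Pow (verts \<Gamma>').
        tensor_map R ?G ?H ?m ?a (middle_swap_map R ?G ?G ?G ?H (pure_tensor R ?GG ?GH (?B I) (?F J))))"
      by (intro GH.finsum_cong' refl summand[symmetric] Pi_I GH.finsum_closed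
          bilinear_map_closed[OF bil] B F)
    also have "\<dots> = tensor_map R ?G ?H ?m ?a (middle_swap_map R ?G ?G ?G ?H (pure_tensor R ?GG ?GH
        (graph_comult R black_graphs x) (\<H>_coaction R y)))"
      unfolding \<Gamma>(2) \<Gamma>'(2) coaction_eq B.graph_comult_element[OF \<Gamma>(1)]
        F.tensor_map_comult[OF B.S_module F.S_module black_projection_linear linear_map_id \<Gamma>'(1)] id_apply
      by (rule bilinear_map_finsum[OF bil B.T_module GH.module_axioms GH.module_axioms fin B F, symmetric])
    also have "\<dots> = ?A (pure_tensor R ?G ?GH x (\<H>_coaction R y))"
    proof -
      have y: "\<H>_coaction R y \<in> carrier ?GH" and x: "x \<in> carrier ?G"
        using \<Gamma> \<Gamma>' linear_map_closed[OF coaction_linear]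
        by (simp_all add: B.graph_element_closed F.graph_element_closed)
      \<comment> \<open>\<open>tensor_action\<close> contains this tensor product of identities,
        which is known to be the identity only on the carrier.\<close>
      have "tensor_map R ?G ?H id id s = id s" if "s \<in> carrier ?GH" for s
        by (rule tensor_eqI[OF B.S_module F.S_module GH.module_axioms spans_carrier spans_carrier
              tensor_map_linear[OF ids] linear_map_id _ that])
          (simp add: tensor_map_pure[OF ids])
      then show ?thesis
        using x y by (simp add: tensor_action_def tensor_map_pure[OF cid])
    qed
    also have "\<dots> = ?A (tensor_map R ?G ?GH id (\<H>_coaction R) (pure_tensor R ?G ?H x y))"
      using \<Gamma> \<Gamma>' by (simp add: tensor_map_pure[OF idd] B.graph_element_closed F.graph_element_closed)
    finally show "\<H>_coaction R (?a (pure_tensor R ?G ?H x y))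
        = ?A (tensor_map R ?G ?GH id (\<H>_coaction R) (pure_tensor R ?G ?H x y))" .
  qed
qed

lemma graph_hopf_module:
  assumes "field R"
  shows "left_hopf_module R (\<G> R) (graph_mult R black_graphs) (graph_unit R black_graphs)
    (graph_comult R black_graphs) (graph_counit R) (\<H> R) (\<H>_action R) (\<H>_coaction R)"
proof -
  note hopf = B.graph_hopf_algebra[OF assms]
  show ?thesis
    by (intro left_hopf_module.intro left_module.intro left_module_axioms.intro left_comodule.intro
        left_comodule_axioms.intro left_hopf_module_axioms.intro hopf F.S_module action_linear
        coaction_linear ballI action_assoc action_unit coaction_coassoc coaction_counit coaction_action)
qed

end

theorem theorem2p2:
  fixes K :: "('k, 'm) ring_scheme"
  assumes "field K"
    and "\<forall>n::nat. n > 0 \<longrightarrow> [n] \<cdot>\<^bsub>K\<^esub> \<one>\<^bsub>K\<^esub> \<noteq> \<zero>\<^bsub>K\<^esub>"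
  shows "left_hopf_module K
    (\<G> K) (graph_mult K black_graphs) (graph_unit K black_graphs)
    (graph_comult K black_graphs) (graph_counit K)
    (\<H> K) (\<H>_action K) (\<H>_coaction K)"
proof -
  interpret K: field K by fact
  show ?thesis
    by (rule K.graph_hopf_module[OF assms(1)])
qed

end
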